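(* Let $K$ be a field with $\operatorname{char} K\neq 2$, let $0\neq\delta\in K$, and for $n\geq 3$ let $\mathrm{FTL}_n(\delta)$ be the forked Temperley-Lieb algebra over $K$. Then $\mathrm{FTL}_n(\delta)$ is semi-simple if and only if $Q_t(\delta)\neq 0$ for all $t\in\{2,\dots,n\}$.
   Context: Type $D_n$ graph: vertices $\bar 1,1,2,\dots,n-1$; edges $\{\bar 1,2\}$, $\{1,2\}$ and $\{i,i+1\}$ for $2\le i\le n-2$ (for $n=3$ only the first two edges). $\mathrm{FTL}_n(\delta)$ is the associative unital $K$-algebra generated by $e_{\bar 1},e_1,e_2,\dots,e_{n-1}$ subject to: (1) $e_i^2=\delta e_i$ for all $i$; (2) $e_ie_j=e_je_i$ if $i\ne j$ are not connected by an edge; (3) $e_ie_je_i=e_i$ if $i$ and $j$ are connected by an edge; (4) $e_{\bar 1}e_1=0$. The polynomials $Q_k(x)$ are defined by $Q_2(x)=x^2$, $Q_3(x)=x^3-2x$, $Q_{k+1}(x)=xQ_k(x)-Q_{k-1}(x)$ for $k\geq 3$. *)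

theory Defs
  imports
    "HOL-Algebra.QuotRing"
    "HOL-Computational_Algebra.Polynomial"
    "HOL-Library.Poly_Mapping"
    "HOL-Library.FuncSet"
begin

section \<open>Free associative algebras\<close>

text \<open>A copy of lists carrying the free monoid structure, written additively because
  the convolution product on finitely supported functions is indexed by additive monoids.\<close>

datatype 'g fmon = FMon (letters: "'g list")

instantiation fmon :: (type) monoid_add
begin

definition zero_fmon :: "'g fmon" where
  "zero_fmon = FMon []"

definition plus_fmon :: "'g fmon \<Rightarrow> 'g fmon \<Rightarrow> 'g fmon" where
  "plus_fmon u v = FMon (letters u @ letters v)"

instance
  by standard (simp_all add: zero_fmon_def plus_fmon_def)

end

text \<open>Noncommutative polynomials over \<open>'k\<close> in the letters of \<open>V\<close>. The product on
  \<open>'g fmon \<Rightarrow>\<^sub>0 'k\<close> is convolution, i.e. the bilinear extension of concatenation.\<close>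

definition free_algebra :: "'g set \<Rightarrow> ('g fmon \<Rightarrow>\<^sub>0 'k::field) ring" where
  "free_algebra V =
    \<lparr>carrier = {p. \<forall>w \<in> Poly_Mapping.keys p. set (letters w) \<subseteq> V},
     monoid.mult = (*), one = 1, zero = 0, add = (+)\<rparr>"

definition fgen :: "'g \<Rightarrow> ('g fmon \<Rightarrow>\<^sub>0 'k::field)" where
  "fgen g = Poly_Mapping.single (FMon [g]) 1"

definition fscalar :: "'k \<Rightarrow> ('g fmon \<Rightarrow>\<^sub>0 'k::field)" where
  "fscalar c = Poly_Mapping.single 0 c"

lemma letters_zero [simp]: "letters 0 = []"
  by (simp add: zero_fmon_def)

lemma letters_plus [simp]: "letters (u + v) = letters u @ letters v"
  by (simp add: plus_fmon_def)

lemma free_algebra_simps [simp]: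
  "monoid.mult (free_algebra V) = (*)" "one (free_algebra V) = 1"
  "zero (free_algebra V) = 0" "add (free_algebra V) = (+)"
  by (simp_all add: free_algebra_def)

lemma free_algebra_carrier:
  "p \<in> carrier (free_algebra V) \<longleftrightarrow> (\<forall>w \<in> Poly_Mapping.keys p. set (letters w) \<subseteq> V)"
  by (simp add: free_algebra_def)

lemma free_algebra_closed:
  shows fgen_closed: "g \<in> V \<Longrightarrow> fgen g \<in> carrier (free_algebra V)"
    and fscalar_closed: "fscalar c \<in> carrier (free_algebra V)"
    and one_closed: "1 \<in> carrier (free_algebra V)"
    and zero_closed: "0 \<in> carrier (free_algebra V)"
    and add_closed: "p \<in> carrier (free_algebra V) \<Longrightarrow> q \<in> carrier (free_algebra V)
      \<Longrightarrow> p + q \<in> carrier (free_algebra V)"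
    and uminus_closed: "p \<in> carrier (free_algebra V) \<Longrightarrow> - p \<in> carrier (free_algebra V)"
    and minus_closed: "p \<in> carrier (free_algebra V) \<Longrightarrow> q \<in> carrier (free_algebra V)
      \<Longrightarrow> p - q \<in> carrier (free_algebra V)"
    and mult_closed: "p \<in> carrier (free_algebra V) \<Longrightarrow> q \<in> carrier (free_algebra V)
      \<Longrightarrow> p * q \<in> carrier (free_algebra V)"
proof -
  show add: "p + q \<in> carrier (free_algebra V)"
    if "p \<in> carrier (free_algebra V)" "q \<in> carrier (free_algebra V)" for p q
    using that Poly_Mapping.keys_add[of p q] unfolding free_algebra_carrier by blast
  show um: "- p \<in> carrier (free_algebra V)" if "p \<in> carrier (free_algebra V)" for p
    using that by (simp add: free_algebra_carrier)
  show "p - q \<in> carrier (free_algebra V)"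
    if "p \<in> carrier (free_algebra V)" "q \<in> carrier (free_algebra V)" for p q
    using add[OF that(1) um[OF that(2)]] by simp
  show "p * q \<in> carrier (free_algebra V)"
    if "p \<in> carrier (free_algebra V)" "q \<in> carrier (free_algebra V)" for p q
    using that keys_mult[of p q] unfolding free_algebra_carrier by fastforce
qed (auto simp: free_algebra_carrier fgen_def fscalar_def split: if_splits)

lemma free_algebra_ring: "ring (free_algebra V :: ('g fmon \<Rightarrow>\<^sub>0 'k::field) ring)"
proof (rule ringI)
  show "abelian_group (free_algebra V :: ('g fmon \<Rightarrow>\<^sub>0 'k::field) ring)"
  proof (rule abelian_groupI)
    fix x :: "'g fmon \<Rightarrow>\<^sub>0 'k" assume "x \<in> carrier (free_algebra V)"
    then show "\<exists>y\<in>carrier (free_algebra V). y \<oplus>\<^bsub>free_algebra V\<^esub> x = \<zero>\<^bsub>free_algebra V\<^esub>"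
      using uminus_closed[of x V] by (intro bexI[of _ "- x"]) simp_all
  qed (simp_all add: add_closed zero_closed ac_simps)
  show "monoid (free_algebra V :: ('g fmon \<Rightarrow>\<^sub>0 'k::field) ring)"
    by (rule monoidI) (simp_all add: mult_closed one_closed mult.assoc)
qed (simp_all add: algebra_simps)


section \<open>Semisimple rings\<close>

definition left_ideal :: "'a set \<Rightarrow> ('a, 'b) ring_scheme \<Rightarrow> bool" where
  "left_ideal L R \<longleftrightarrow>
    additive_subgroup L R \<and> (\<forall>r \<in> carrier R. \<forall>x \<in> L. r \<otimes>\<^bsub>R\<^esub> x \<in> L)"

definition simple_left_ideal :: "'a set \<Rightarrow> ('a, 'b) ring_scheme \<Rightarrow> bool" where
  "simple_left_ideal L R \<longleftrightarrow>
    left_ideal L R \<and> L \<noteq> {\<zero>\<^bsub>R\<^esub>} \<and>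
    (\<forall>M. left_ideal M R \<and> M \<subseteq> L \<longrightarrow> M = {\<zero>\<^bsub>R\<^esub>} \<or> M = L)"

text \<open>\<open>R\<close> is the internal direct sum of the left ideals in \<open>S\<close>. Families are taken to be
  extensional on \<open>S\<close>, so that uniqueness is not spoilt by values outside \<open>S\<close>.\<close>

definition direct_sum_left_ideals :: "'a set set \<Rightarrow> ('a, 'b) ring_scheme \<Rightarrow> bool" where
  "direct_sum_left_ideals S R \<longleftrightarrow>
    (\<forall>L \<in> S. left_ideal L R) \<and>
    (\<forall>x \<in> carrier R. \<exists>!f. f \<in> (\<Pi>\<^sub>E L \<in> S. L) \<and> finite {L \<in> S. f L \<noteq> \<zero>\<^bsub>R\<^esub>} \<and>
       x = finsum R f {L \<in> S. f L \<noteq> \<zero>\<^bsub>R\<^esub>})"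

text \<open>The regular left module is a direct sum of simple modules. For a unital algebra over a
  field, left ideals are automatically subspaces, so the scalar action need not be mentioned.\<close>

definition semisimple_ring :: "('a, 'b) ring_scheme \<Rightarrow> bool" where
  "semisimple_ring R \<longleftrightarrow>
    ring R \<and> (\<exists>S. (\<forall>L \<in> S. simple_left_ideal L R) \<and> direct_sum_left_ideals S R)"


section \<open>The forked Temperley-Lieb algebra\<close>

text \<open>\<open>VBar\<close> is the vertex \<open>1\<close> with a bar.\<close>

datatype vertex = VBar | V nat

definition D_vertices :: "nat \<Rightarrow> vertex set" where
  "D_vertices n = insert VBar (V ` {1..n - 1})"

definition D_edges :: "nat \<Rightarrow> vertex set set" where
  "D_edges n = {{VBar, V 2}, {V 1, V 2}} \<union> {{V i, V (i + 1)} | i. 2 \<le> i \<and> i + 2 \<le> n}"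

definition FTL_relators :: "nat \<Rightarrow> 'k::field \<Rightarrow> (vertex fmon \<Rightarrow>\<^sub>0 'k) set" where
  "FTL_relators n \<delta> =
     {fgen i * fgen i - fscalar \<delta> * fgen i | i. i \<in> D_vertices n}
   \<union> {fgen i * fgen j - fgen j * fgen i | i j.
        i \<in> D_vertices n \<and> j \<in> D_vertices n \<and> i \<noteq> j \<and> {i, j} \<notin> D_edges n}
   \<union> {fgen i * fgen j * fgen i - fgen i | i j.
        i \<in> D_vertices n \<and> j \<in> D_vertices n \<and> {i, j} \<in> D_edges n}
   \<union> {fgen VBar * fgen (V 1)}"

definition FTL :: "nat \<Rightarrow> 'k::field \<Rightarrow> (vertex fmon \<Rightarrow>\<^sub>0 'k) set ring" where
  "FTL n \<delta> = free_algebra (D_vertices n) Quot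
     (genideal (free_algebra (D_vertices n)) (FTL_relators n \<delta>))"

lemma FTL_relators_closed:
  assumes "n \<ge> 2"
  shows "FTL_relators n \<delta> \<subseteq> carrier (free_algebra (D_vertices n))"
proof -
  have "VBar \<in> D_vertices n" "V 1 \<in> D_vertices n"
    using assms by (auto simp: D_vertices_def)
  then show ?thesis
    by (auto simp: FTL_relators_def intro!: minus_closed mult_closed fgen_closed fscalar_closed)
qed

lemma FTL_ring:
  assumes "n \<ge> 2"
  shows "ring (FTL n \<delta>)"
  unfolding FTL_def
  by (intro ideal.quotient_is_ring ring.genideal_ideal free_algebra_ring
      FTL_relators_closed assms)


section \<open>The polynomials \<open>Q\<^sub>k\<close>\<close>

text \<open>The values at \<open>0\<close> and \<open>1\<close> are junk. The recursion must not be used below \<open>k = 3\<close>: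
  \<open>Q\<^sub>2\<close> and \<open>Q\<^sub>3\<close> are both initial values.\<close>

fun Q :: "nat \<Rightarrow> 'k::comm_ring_1 poly" where
  "Q 0 = 0"
| "Q (Suc 0) = 0"
| "Q (Suc (Suc 0)) = [:0, 1:] ^ 2"
| "Q (Suc (Suc (Suc 0))) = [:0, 1:] ^ 3 - 2 * [:0, 1:]"
| "Q (Suc (Suc (Suc (Suc k)))) = [:0, 1:] * Q (Suc (Suc (Suc k))) - Q (Suc (Suc k))"

lemma Q_2: "Q 2 = [:0, 1:] ^ 2"
  by (simp add: numeral_2_eq_2 del: power_Suc)

lemma Q_3: "Q 3 = [:0, 1:] ^ 3 - 2 * [:0, 1:]"
  by (simp add: numeral_3_eq_3 del: power_Suc)

lemma Q_rec: "k \<ge> 3 \<Longrightarrow> Q (k + 1) = [:0, 1:] * Q k - Q (k - 1)"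
  by (induction k rule: Q.induct) simp_all

end

theory Submission
  imports Defs
begin

text \<open>
  Put \<open>q\<^sub>t = Q\<^sub>t(\<delta>)\<close>. As long as \<open>q\<^sub>2, \<dots>, q\<^sub>m\<close> are nonzero there is a Jones-Wenzl projection \<open>p\<^sub>m\<close>,
  i.e. an idempotent in \<open>1 + (e\<^sub>i)\<close> annihilated by all generators of index below \<open>m\<close>; the recursion
  \<open>p\<^sub>m\<^sub>+\<^sub>1 = p\<^sub>m - (q\<^sub>m / q\<^sub>m\<^sub>+\<^sub>1) p\<^sub>m e\<^sub>m p\<^sub>m\<close> rests on \<open>e\<^sub>m p\<^sub>m e\<^sub>m = (q\<^sub>m\<^sub>+\<^sub>1 / q\<^sub>m) p\<^sub>m\<^sub>-\<^sub>1 e\<^sub>m\<close>. With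
  \<open>F\<^sub>k = e\<^sub>n\<^sub>-\<^sub>1 e\<^sub>n\<^sub>-\<^sub>3 \<dots>\<close> (\<open>k\<close> factors) the corner of \<open>F\<^sub>k\<close> is the image of the algebra on \<open>n - 2k\<close> vertices.

  If all \<open>q\<^sub>t\<close> are nonzero, the elements \<open>p\<^sub>n\<^sub>-\<^sub>2\<^sub>k F\<^sub>k\<close>, together with two more when \<open>n\<close> is even, are pairwise
  orthogonal through the algebra, have one-dimensional corners and generate the unit ideal, so that
  they generate simple left ideals which sum up to the whole algebra.

  If \<open>m\<close> is minimal with \<open>q\<^sub>m = 0\<close>, then \<open>x = p\<^sub>m\<^sub>-\<^sub>1 e\<^sub>m\<^sub>-\<^sub>1 p\<^sub>m\<^sub>-\<^sub>1\<close> is annihilated by the generators of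
  index below \<open>m\<close> and has square zero, and \<open>x e\<^sub>m x - x\<close> behaves likewise one step further. Multiplied by the
  \<open>F\<^sub>k\<close> of the right parity, one of the two gives a \<open>z\<close> with \<open>z R z = 0\<close>, which a semisimple ring only
  admits for \<open>z = 0\<close>. That \<open>z \<noteq> 0\<close> is seen in a representation on functions of walks in a binary tree:
  \<open>e\<^sub>i\<close> vanishes at walks that do not backtrack at step \<open>i\<close>, hence the projections act as the
  identity on the relevant matrix entry.
\<close>

section \<open>Socles and semisimplicity\<close>

context ring
begin

section \<open>Left ideals and their translates\<close>

lemma left_ideal_iff:
  "left_ideal L R \<longleftrightarrow> L \<subseteq> carrier R \<and> \<zero> \<in> L \<and> (\<forall>x\<in>L. \<forall>y\<in>L. x \<oplus> y \<in> L)
     \<and> (\<forall>r\<in>carrier R. \<forall>x\<in>L. r \<otimes> x \<in> L)"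
proof
  assume "left_ideal L R"
  then interpret additive_subgroup L R by (simp add: left_ideal_def)
  show "L \<subseteq> carrier R \<and> \<zero> \<in> L \<and> (\<forall>x\<in>L. \<forall>y\<in>L. x \<oplus> y \<in> L)
     \<and> (\<forall>r\<in>carrier R. \<forall>x\<in>L. r \<otimes> x \<in> L)"
    using \<open>left_ideal L R\<close> a_subset by (auto simp: left_ideal_def)
next
  assume L: "L \<subseteq> carrier R \<and> \<zero> \<in> L \<and> (\<forall>x\<in>L. \<forall>y\<in>L. x \<oplus> y \<in> L)
     \<and> (\<forall>r\<in>carrier R. \<forall>x\<in>L. r \<otimes> x \<in> L)"
  \<comment> \<open>Negatives come from multiplication by \<open>\<ominus> \<one>\<close>, so the
    criterion can leave them out.\<close>
  have "\<ominus> x \<in> L" if "x \<in> L" for x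
  proof -
    have "(\<ominus> \<one>) \<otimes> x \<in> L" using L that by auto
    moreover have "x \<in> carrier R" using L that by blast
    then have "(\<ominus> \<one>) \<otimes> x = \<ominus> x" by (simp add: l_minus)
    ultimately show ?thesis by simp
  qed
  then have "subgroup L (add_monoid R)"
    using L by (intro add.subgroupI) (auto simp: a_inv_def)
  then show "left_ideal L R"
    using L by (auto simp: left_ideal_def additive_subgroup_def)
qed

lemma left_idealD:
  assumes "left_ideal L R"
  shows "L \<subseteq> carrier R" "\<zero> \<in> L" "\<And>x y. x \<in> L \<Longrightarrow> y \<in> L \<Longrightarrow> x \<oplus> y \<in> L"
    "\<And>r x. r \<in> carrier R \<Longrightarrow> x \<in> L \<Longrightarrow> r \<otimes> x \<in> L" "\<And>x. x \<in> L \<Longrightarrow> \<ominus> x \<in> L"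
proof -
  show "L \<subseteq> carrier R" "\<zero> \<in> L" "\<And>x y. x \<in> L \<Longrightarrow> y \<in> L \<Longrightarrow> x \<oplus> y \<in> L"
    and mult: "\<And>r x. r \<in> carrier R \<Longrightarrow> x \<in> L \<Longrightarrow> r \<otimes> x \<in> L"
    using assms by (auto simp: left_ideal_iff)
  show "\<And>x. x \<in> L \<Longrightarrow> \<ominus> x \<in> L"
    using assms by (simp add: left_ideal_def additive_subgroup.a_inv_closed)
qed

lemma simple_left_idealD:
  assumes "simple_left_ideal L R" "left_ideal M R" "M \<subseteq> L" "x \<in> M" "x \<noteq> \<zero>"
  shows "M = L"
  using assms unfolding simple_left_ideal_def by auto

text \<open>Right multiplication by \<open>a\<close> is a homomorphism of left modules, and the
  image of a simple module under a homomorphism is zero or again simple.\<close>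

lemma simple_left_ideal_translate:
  assumes L: "simple_left_ideal L R" and a: "a \<in> carrier R"
  shows "(\<lambda>l. l \<otimes> a) ` L = {\<zero>} \<or> simple_left_ideal ((\<lambda>l. l \<otimes> a) ` L) R"
proof (rule disjCI)
  let ?K = "(\<lambda>l. l \<otimes> a) ` L"
  have LI: "left_ideal L R" using L by (simp add: simple_left_ideal_def)
  note l = left_idealD[OF LI]
  assume ns: "\<not> simple_left_ideal ?K R"
  have K: "left_ideal ?K R"
    unfolding left_ideal_iff
  proof (intro conjI ballI)
    show "?K \<subseteq> carrier R" using l(1) a by auto
    show "\<zero> \<in> ?K" using l(2) a by (intro image_eqI[of _ _ \<zero>]) auto
    fix x assume "x \<in> ?K"
    then obtain x' where x': "x' \<in> L" "x = x' \<otimes> a" by blast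
    show "x \<oplus> y \<in> ?K" if "y \<in> ?K" for y
    proof -
      from that obtain y' where y': "y' \<in> L" "y = y' \<otimes> a" by blast
      have "x \<oplus> y = (x' \<oplus> y') \<otimes> a" using x' y' l(1) a by (auto simp: l_distr subset_iff)
      then show ?thesis using l(3) x' y' by blast
    qed
    show "r \<otimes> x \<in> ?K" if "r \<in> carrier R" for r
    proof -
      have "r \<otimes> x = (r \<otimes> x') \<otimes> a" using x' that l(1) a by (auto simp: m_assoc subset_iff)
      then show ?thesis using l(4) x' that by blast
    qed
  qed
  show "?K = {\<zero>}"
  proof (rule ccontr)
    assume "?K \<noteq> {\<zero>}"
    then obtain M where M: "left_ideal M R" "M \<subseteq> ?K" "M \<noteq> {\<zero>}" "M \<noteq> ?K"
      using ns K by (auto simp: simple_left_ideal_def)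
    note m = left_idealD[OF M(1)]
    \<comment> \<open>The preimage of \<open>M\<close> in \<open>L\<close>. Simplicity of
      \<open>L\<close> makes it zero or all of \<open>L\<close>, so that \<open>M\<close> is zero or
      the whole image.\<close>
    let ?P = "{l \<in> L. l \<otimes> a \<in> M}"
    have "left_ideal ?P R"
      unfolding left_ideal_iff
      using l m a by (auto simp: subset_iff l_distr m_assoc)
    moreover have "?P \<subseteq> L" by auto
    ultimately consider "?P = {\<zero>}" | "?P = L"
      using L by (auto simp: simple_left_ideal_def)
    then show False
    proof cases
      case 1
      have "M \<subseteq> {\<zero>}"
      proof
        fix y assume "y \<in> M"
        then obtain l' where "l' \<in> L" "y = l' \<otimes> a" using M(2) by blast
        then have "l' \<in> ?P" using \<open>y \<in> M\<close> by auto
        then have "l' = \<zero>" using 1 by blast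
        then show "y \<in> {\<zero>}" using \<open>y = l' \<otimes> a\<close> a by simp
      qed
      then show False using M(3) m(2) by blast
    next
      case 2
      then show False using M(2,4) by blast
    qed
  qed
qed

section \<open>The left socle, the sum of all simple left ideals\<close>

inductive_set left_socle :: "'a set" where
  zero: "\<zero> \<in> left_socle"
| add: "x \<in> left_socle \<Longrightarrow> simple_left_ideal L R \<Longrightarrow> l \<in> L \<Longrightarrow> x \<oplus> l \<in> left_socle"

lemma simple_left_ideal_subset: "simple_left_ideal L R \<Longrightarrow> L \<subseteq> carrier R"
  using left_idealD(1) by (auto simp: simple_left_ideal_def)

lemma left_socle_closed: "x \<in> left_socle \<Longrightarrow> x \<in> carrier R"
  by (induction rule: left_socle.induct) (auto dest: simple_left_ideal_subset)

lemma left_socle_superset: "simple_left_ideal L R \<Longrightarrow> l \<in> L \<Longrightarrow> l \<in> left_socle"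
  using left_socle.add[OF left_socle.zero] simple_left_ideal_subset by fastforce

lemma left_socle_add: "y \<in> left_socle \<Longrightarrow> x \<in> left_socle \<Longrightarrow> x \<oplus> y \<in> left_socle"
proof (induction rule: left_socle.induct)
  case (add y L l)
  then have "x \<oplus> (y \<oplus> l) = (x \<oplus> y) \<oplus> l"
    using left_socle_closed simple_left_ideal_subset by (auto simp: a_assoc subset_iff)
  then show ?case using add left_socle.add by auto
qed (simp add: left_socle_closed)

lemma left_socle_lmult: "x \<in> left_socle \<Longrightarrow> r \<in> carrier R \<Longrightarrow> r \<otimes> x \<in> left_socle"
proof (induction rule: left_socle.induct)
  case (add x L l)
  have "r \<otimes> (x \<oplus> l) = r \<otimes> x \<oplus> r \<otimes> l"
    using add left_socle_closed simple_left_ideal_subset by (auto simp: r_distr subset_iff)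
  moreover have "r \<otimes> l \<in> L" using add by (auto simp: simple_left_ideal_def intro: left_idealD)
  ultimately show ?case using add by (auto intro: left_socle.add)
qed (auto intro: left_socle.zero)

text \<open>Translates of simple left ideals are zero or simple, so right multiplication keeps every
  summand inside the socle. This is what makes the socle a two-sided ideal.\<close>

lemma left_socle_rmult: "x \<in> left_socle \<Longrightarrow> r \<in> carrier R \<Longrightarrow> x \<otimes> r \<in> left_socle"
proof (induction rule: left_socle.induct)
  case (add x L l)
  have "(x \<oplus> l) \<otimes> r = x \<otimes> r \<oplus> l \<otimes> r"
    using add left_socle_closed simple_left_ideal_subset by (auto simp: l_distr subset_iff)
  moreover have "l \<otimes> r \<in> (\<lambda>l. l \<otimes> r) ` L" using add by blast
  then have "l \<otimes> r \<in> left_socle"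
    using simple_left_ideal_translate[OF \<open>simple_left_ideal L R\<close> \<open>r \<in> carrier R\<close>]
    by (metis left_socle_superset left_socle.zero singletonD)
  ultimately show ?case using add left_socle_add by auto
qed (auto intro: left_socle.zero)

lemma left_socle_ideal: "ideal left_socle R"
proof (rule idealI)
  show "ring R" by (rule ring_axioms)
  have "left_ideal left_socle R"
    unfolding left_ideal_iff
    using left_socle_closed left_socle_add left_socle_lmult left_socle.zero by auto
  then show "subgroup left_socle (add_monoid R)"
    by (simp add: left_ideal_def additive_subgroup_def)
qed (auto intro: left_socle_lmult left_socle_rmult)

section \<open>Finite sums of left ideals\<close>

definition left_ideal_sum :: "'a set set \<Rightarrow> 'a set" where
  "left_ideal_sum T = {finsum R f T | f. f \<in> (\<Pi> L\<in>T. L)}"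

lemma Pi_left_ideals_closed:
  "(\<And>L. L \<in> T \<Longrightarrow> left_ideal L R) \<Longrightarrow> f \<in> (\<Pi> L\<in>T. L) \<Longrightarrow> f \<in> T \<rightarrow> carrier R"
  using left_idealD(1) by blast

lemma left_ideal_sum_left_ideal:
  assumes T: "finite T" "\<And>L. L \<in> T \<Longrightarrow> left_ideal L R"
  shows "left_ideal (left_ideal_sum T) R"
  unfolding left_ideal_iff
proof (intro conjI ballI)
  note cl = Pi_left_ideals_closed[OF T(2)]
  show "left_ideal_sum T \<subseteq> carrier R"
    using cl by (auto simp: left_ideal_sum_def)
  show "\<zero> \<in> left_ideal_sum T"
    unfolding left_ideal_sum_def
    using T(2) by (intro CollectI exI[of _ "\<lambda>_. \<zero>"]) (auto intro: left_idealD)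
  fix x assume "x \<in> left_ideal_sum T"
  then obtain f where f: "x = finsum R f T" "f \<in> (\<Pi> L\<in>T. L)" by (auto simp: left_ideal_sum_def)
  show "x \<oplus> y \<in> left_ideal_sum T" if "y \<in> left_ideal_sum T" for y
  proof -
    from that obtain g where g: "y = finsum R g T" "g \<in> (\<Pi> L\<in>T. L)"
      by (auto simp: left_ideal_sum_def)
    have "x \<oplus> y = (\<Oplus>L\<in>T. f L \<oplus> g L)" using cl f g by simp
    moreover have "(\<lambda>L. f L \<oplus> g L) \<in> (\<Pi> L\<in>T. L)"
      using f g T(2) by (auto intro!: left_idealD(3))
    ultimately show ?thesis unfolding left_ideal_sum_def by blast
  qed
  show "r \<otimes> x \<in> left_ideal_sum T" if "r \<in> carrier R" for r
  proof -
    have "r \<otimes> x = (\<Oplus>L\<in>T. r \<otimes> f L)" using cl f that T(1) by (simp add: finsum_rdistr)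
    moreover have "(\<lambda>L. r \<otimes> f L) \<in> (\<Pi> L\<in>T. L)"
      using f that T(2) by (auto intro!: left_idealD(4))
    ultimately show ?thesis unfolding left_ideal_sum_def by blast
  qed
qed

lemma left_ideal_sum_superset:
  assumes T: "finite T" "\<And>L. L \<in> T \<Longrightarrow> left_ideal L R" and L: "L \<in> T" "l \<in> L"
  shows "l \<in> left_ideal_sum T"
proof -
  let ?f = "\<lambda>M. if L = M then l else \<zero>"
  have "?f \<in> (\<Pi> L\<in>T. L)"
  proof (rule Pi_I)
    show "?f M \<in> M" if "M \<in> T" for M using left_idealD(2)[OF T(2)[OF that]] L by auto
  qed
  moreover have "l \<in> carrier R" using left_idealD(1)[OF T(2)[OF L(1)]] L by blast
  then have "(\<lambda>_. l) \<in> T \<rightarrow> carrier R" by blast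
  then have "finsum R ?f T = l"
    by (rule add.finprod_singleton[OF L(1) T(1)])
  ultimately show ?thesis unfolding left_ideal_sum_def by (intro CollectI exI[of _ ?f]) simp
qed

text \<open>An element of the socle is built in finitely many steps, and each step contributes one
  simple left ideal.\<close>

lemma left_socle_in_left_ideal_sum:
  assumes "x \<in> left_socle"
  shows "\<exists>T. finite T \<and> (\<forall>L\<in>T. simple_left_ideal L R) \<and> x \<in> left_ideal_sum T"
  using assms
proof (induction rule: left_socle.induct)
  case zero
  show ?case by (intro exI[of _ "{}"]) (auto simp: left_ideal_sum_def)
next
  case (add x L l)
  then obtain T where T: "finite T" "\<forall>L\<in>T. simple_left_ideal L R" "x \<in> left_ideal_sum T" by blast
  \<comment> \<open>\<open>L\<close> may already lie in \<open>T\<close>. Therefore \<open>x\<close>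
    and \<open>l\<close> are placed in the sum over \<open>?T\<close> separately and added there,
    instead of extending a choice function at \<open>L\<close>.\<close>
  let ?T = "insert L T"
  have s: "\<forall>L\<in>?T. simple_left_ideal L R" using T add by auto
  then have li: "\<And>L. L \<in> ?T \<Longrightarrow> left_ideal L R" by (auto simp: simple_left_ideal_def)
  have *: "left_ideal (left_ideal_sum ?T) R"
    using li T by (intro left_ideal_sum_left_ideal) auto
  have "l \<in> left_ideal_sum ?T"
    using left_ideal_sum_superset[where T="?T" and L=L and l=l] li T(1) add by auto
  moreover have "x \<in> left_ideal_sum ?T"
  proof -
    obtain f where f: "x = finsum R f T" "f \<in> (\<Pi> L\<in>T. L)" using T by (auto simp: left_ideal_sum_def)
    let ?f = "\<lambda>M. if M \<in> T then f M else \<zero>"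
    have "finsum R f T = finsum R ?f ?T"
      using Pi_left_ideals_closed[where T=T and f=f] li f T
      by (intro add.finprod_mono_neutral_cong_left) auto
    moreover have "?f \<in> (\<Pi> L\<in>?T. L)"
    proof (rule Pi_I)
      show "?f M \<in> M" if "M \<in> ?T" for M using f left_idealD(2)[OF li[OF that]] by auto
    qed
    ultimately show ?thesis unfolding left_ideal_sum_def
      using f by (intro CollectI exI[of _ ?f]) simp
  qed
  ultimately have "x \<oplus> l \<in> left_ideal_sum ?T" using left_idealD(3)[OF *] by blast
  then show ?case using s T(1) by blast
qed

text \<open>If \<open>f L\<close> were nonzero, it would be the negative of the sum of the remaining
  terms, so \<open>L\<close> would meet the sum \<open>S\<close> of the other left ideals
  nontrivially. By simplicity \<open>L \<subseteq> S\<close>, and dropping \<open>L\<close> would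
  not change the sum, against \<open>min\<close>.\<close>

lemma left_ideal_sum_independent:
  assumes T: "finite T" "\<And>L. L \<in> T \<Longrightarrow> simple_left_ideal L R"
    and min: "\<And>L. L \<in> T \<Longrightarrow> left_ideal_sum (T - {L}) \<noteq> left_ideal_sum T"
    and f: "f \<in> (\<Pi> L\<in>T. L)" "finsum R f T = \<zero>" and L: "L \<in> T"
  shows "f L = \<zero>"
proof (rule ccontr)
  assume nz: "f L \<noteq> \<zero>"
  have li: "\<And>L. L \<in> T \<Longrightarrow> left_ideal L R" using T by (auto simp: simple_left_ideal_def)
  define S where "S = left_ideal_sum (T - {L})"
  have S: "left_ideal S R" unfolding S_def using T li by (intro left_ideal_sum_left_ideal) auto
  have fc: "f \<in> T \<rightarrow> carrier R" using Pi_left_ideals_closed[OF li f(1)] .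
  define s where "s = finsum R f (T - {L})"
  have s: "s \<in> S" unfolding S_def s_def left_ideal_sum_def using f by blast
  have sc: "s \<in> carrier R" "f L \<in> carrier R" using left_idealD(1)[OF S] s fc L by auto
  have "finsum R f (insert L (T - {L})) = f L \<oplus> s"
    unfolding s_def using T fc L by (intro finsum_insert) auto
  then have "f L \<oplus> s = \<zero>" using f L by (simp add: insert_absorb)
  then have "f L = \<ominus> s" using sc by (metis add.inv_equality)
  then have fS: "f L \<in> S" using left_idealD(5)[OF S s] by simp
  have "f L \<in> L" using f L by auto
  have "left_ideal (S \<inter> L) R"
    using left_idealD[OF S] left_idealD[OF li[OF L]] by (auto simp: left_ideal_iff)
  then have "S \<inter> L = L"
    using simple_left_idealD[OF T(2)[OF L]] fS \<open>f L \<in> L\<close> nz by blast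
  then have LS: "L \<subseteq> S" by blast
  have "left_ideal_sum T \<subseteq> S"
  proof
    fix x assume "x \<in> left_ideal_sum T"
    then obtain g where g: "x = finsum R g T" "g \<in> (\<Pi> L\<in>T. L)" by (auto simp: left_ideal_sum_def)
    have gc: "g \<in> T \<rightarrow> carrier R" using Pi_left_ideals_closed[OF li g(2)] .
    have "finsum R g (insert L (T - {L})) = g L \<oplus> finsum R g (T - {L})"
      using T gc L by (intro finsum_insert) auto
    then have "x = g L \<oplus> finsum R g (T - {L})" using g L by (simp add: insert_absorb)
    moreover have "g L \<in> S" using g L LS by auto
    moreover have "finsum R g (T - {L}) \<in> S"
      unfolding S_def left_ideal_sum_def using g by blast
    ultimately show "x \<in> S" using left_idealD(3)[OF S] by simp
  qed
  moreover have "S \<subseteq> left_ideal_sum T"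
  proof
    fix x assume "x \<in> S"
    then obtain g where g: "x = finsum R g (T - {L})" "g \<in> (\<Pi> L\<in>T - {L}. L)"
      by (auto simp: S_def left_ideal_sum_def)
    let ?g = "\<lambda>M. if M = L then \<zero> else g M"
    have "finsum R g (T - {L}) = finsum R ?g T"
      using Pi_left_ideals_closed[where T="T - {L}" and f=g] li g T
      by (intro add.finprod_mono_neutral_cong_left) auto
    moreover have "?g \<in> (\<Pi> L\<in>T. L)"
    proof (rule Pi_I)
      show "?g M \<in> M" if "M \<in> T" for M using g left_idealD(2)[OF li[OF that]] that by auto
    qed
    ultimately show "x \<in> left_ideal_sum T" unfolding left_ideal_sum_def
      using g by (intro CollectI exI[of _ ?g]) simp
  qed
  ultimately show False using min[OF L] by (auto simp: S_def)
qed

text \<open>Existence is \<open>spans\<close>; uniqueness holds because the difference of two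
  decompositions decomposes zero. As \<open>T\<close> is finite, sums over supports are sums over
  \<open>T\<close>, and restricting to \<open>T\<close> meets the extensionality convention.\<close>

lemma direct_sum_left_idealsI:
  assumes T: "finite T" "\<And>L. L \<in> T \<Longrightarrow> left_ideal L R"
    and spans: "carrier R \<subseteq> left_ideal_sum T"
    and indep: "\<And>f L. f \<in> (\<Pi> L\<in>T. L) \<Longrightarrow> finsum R f T = \<zero> \<Longrightarrow> L \<in> T \<Longrightarrow> f L = \<zero>"
  shows "direct_sum_left_ideals T R"
  unfolding direct_sum_left_ideals_def
proof (intro conjI ballI)
  show "left_ideal L R" if "L \<in> T" for L using that T by blast
  fix x assume x: "x \<in> carrier R"
  have supp: "finsum R f {L \<in> T. f L \<noteq> \<zero>} = finsum R f T" if "f \<in> (\<Pi> L\<in>T. L)" for f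
    using Pi_left_ideals_closed[OF T(2) that] T(1)
    by (intro add.finprod_mono_neutral_cong_left) auto
  obtain f where f: "x = finsum R f T" "f \<in> (\<Pi> L\<in>T. L)"
    using spans x by (auto simp: left_ideal_sum_def)
  let ?f = "restrict f T"
  have f': "?f \<in> (\<Pi>\<^sub>E L\<in>T. L)" using f by auto
  have fc: "f \<in> T \<rightarrow> carrier R" using Pi_left_ideals_closed[OF T(2) f(2)] .
  have f'': "?f \<in> (\<Pi> L\<in>T. L)"
  proof (rule Pi_I)
    show "?f M \<in> M" if "M \<in> T" for M using f(2) that by auto
  qed
  have eq: "finsum R ?f T = finsum R f T"
    using fc by (intro add.finprod_cong') auto
  have x': "x = finsum R ?f {L \<in> T. ?f L \<noteq> \<zero>}"
    unfolding supp[OF f''] eq by (rule f(1))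
  show "\<exists>!f. f \<in> (\<Pi>\<^sub>E L\<in>T. L) \<and> finite {L \<in> T. f L \<noteq> \<zero>} \<and> x = finsum R f {L \<in> T. f L \<noteq> \<zero>}"
  proof (rule ex1I[of _ ?f])
    show "?f \<in> (\<Pi>\<^sub>E L\<in>T. L) \<and> finite {L \<in> T. ?f L \<noteq> \<zero>} \<and> x = finsum R ?f {L \<in> T. ?f L \<noteq> \<zero>}"
      using T(1) by (intro conjI f' x') simp
    fix g assume g: "g \<in> (\<Pi>\<^sub>E L\<in>T. L) \<and> finite {L \<in> T. g L \<noteq> \<zero>} \<and> x = finsum R g {L \<in> T. g L \<noteq> \<zero>}"
    then have g2: "g \<in> (\<Pi> L\<in>T. L)" by auto
    have gc: "g \<in> T \<rightarrow> carrier R" using Pi_left_ideals_closed[OF T(2) g2] .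
    have xg: "x = finsum R g T" using g supp[OF g2] by simp
    have mg: "(\<lambda>L. \<ominus> g L) \<in> T \<rightarrow> carrier R" using gc by auto
    let ?h = "\<lambda>L. f L \<oplus> \<ominus> g L"
    have h: "?h \<in> (\<Pi> L\<in>T. L)"
      using f g2 T(2) by (auto intro!: left_idealD(3,5))
    have "finsum R ?h T = finsum R f T \<oplus> (\<Oplus>L\<in>T. \<ominus> g L)"
      using fc mg by simp
    moreover have "finsum R g T \<oplus> (\<Oplus>L\<in>T. \<ominus> g L) = (\<Oplus>L\<in>T. g L \<oplus> \<ominus> g L)"
      using gc mg by simp
    moreover have "(\<Oplus>L\<in>T. g L \<oplus> \<ominus> g L) = (\<Oplus>L\<in>T. \<zero>)"
      using gc by (intro add.finprod_cong') (simp_all add: Pi_iff r_neg)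
    ultimately have "finsum R ?h T = \<zero>" using f xg by simp
    then have "f L \<oplus> \<ominus> g L = \<zero>" if "L \<in> T" for L
      using indep[OF h _ that] by simp
    then have eq: "f L = g L" if "L \<in> T" for L
      using that fc gc minus_equality[of "f L" "\<ominus> g L"] by (simp add: Pi_iff)
    show "g = ?f"
    proof
      fix L
      have "g L = undefined" if "L \<notin> T" using g that by (blast intro: PiE_arb)
      then show "g L = ?f L" using eq[of L] by (cases "L \<in> T") simp_all
    qed
  qed
qed

text \<open>Among the finite sets of simple left ideals whose sum contains \<open>\<one>\<close>,
  one of least cardinality is irredundant and hence independent. A left ideal containing
  \<open>\<one>\<close> is everything.\<close>

lemma semisimple_ringI:
  assumes "\<one> \<in> left_socle"
  shows "semisimple_ring R"
proof -
  let ?P = "\<lambda>T. finite T \<and> (\<forall>L\<in>T. simple_left_ideal L R) \<and> \<one> \<in> left_ideal_sum T"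
  define T where "T = arg_min card ?P"
  obtain T0 where "?P T0" using left_socle_in_left_ideal_sum[OF assms] by blast
  then have T: "?P T" and least: "\<And>T'. ?P T' \<Longrightarrow> card T \<le> card T'"
    using arg_min_nat_lemma[of ?P T0 card] unfolding T_def by auto
  have li: "\<And>L. L \<in> T \<Longrightarrow> left_ideal L R" using T by (auto simp: simple_left_ideal_def)
  have "carrier R \<subseteq> left_ideal_sum T"
    using left_idealD(4)[OF left_ideal_sum_left_ideal, of T _ \<one>] T li by auto
  moreover have "left_ideal_sum (T - {L}) \<noteq> left_ideal_sum T" if "L \<in> T" for L
    using least[of "T - {L}"] T that card_Diff1_less[of T L] by auto
  ultimately have "direct_sum_left_ideals T R"
    using T li left_ideal_sum_independent[of T] by (intro direct_sum_left_idealsI) auto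
  then show ?thesis
    using T ring_axioms unfolding semisimple_ring_def by blast
qed

text \<open>The \<open>u \<in> U\<close> play the part of primitive idempotents, one for each block: each \<open>R u\<close> is simple.\<close>

lemma semisimple_ring_if_orthogonal_full:
  assumes U: "U \<subseteq> carrier R" and full: "\<And>J. ideal J R \<Longrightarrow> U \<subseteq> J \<Longrightarrow> \<one> \<in> J"
    and orth: "\<And>u v r. u \<in> U \<Longrightarrow> v \<in> U \<Longrightarrow> u \<noteq> v \<Longrightarrow> r \<in> carrier R \<Longrightarrow> u \<otimes> r \<otimes> v = \<zero>"
    and div: "\<And>u r. u \<in> U \<Longrightarrow> r \<in> carrier R \<Longrightarrow> u \<otimes> r \<otimes> u \<noteq> \<zero> \<Longrightarrow>
      \<exists>s\<in>carrier R. s \<otimes> (u \<otimes> r \<otimes> u) = u"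
  shows "semisimple_ring R"
proof -
  have "U \<subseteq> left_socle"
  proof
    fix u assume uU: "u \<in> U"
    then have u: "u \<in> carrier R" using U by blast
    show "u \<in> left_socle"
    proof (cases "u = \<zero>")
      case False
      let ?L = "(\<lambda>r. r \<otimes> u) ` carrier R"
      have uL: "u \<in> ?L" using u by (intro image_eqI[of _ _ \<one>]) auto
      have L: "left_ideal ?L R"
        unfolding left_ideal_iff
      proof (intro conjI ballI)
        show "?L \<subseteq> carrier R" using u by auto
        show "\<zero> \<in> ?L" using u by (intro image_eqI[of _ _ \<zero>]) auto
        fix x assume "x \<in> ?L"
        then obtain a where a: "a \<in> carrier R" "x = a \<otimes> u" by blast
        show "x \<oplus> y \<in> ?L" if y: "y \<in> ?L" for y
        proof -
          from y obtain b where b: "b \<in> carrier R" "y = b \<otimes> u" by blast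
          show ?thesis using a b u by (intro image_eqI[of _ _ "a \<oplus> b"]) (auto simp: l_distr)
        qed
        show "r \<otimes> x \<in> ?L" if "r \<in> carrier R" for r
          using a that u by (intro image_eqI[of _ _ "r \<otimes> a"]) (auto simp: m_assoc)
      qed
      have "simple_left_ideal ?L R"
        unfolding simple_left_ideal_def
      proof (intro conjI allI impI L)
        show "?L \<noteq> {\<zero>}" using uL False by blast
        fix M assume M: "left_ideal M R \<and> M \<subseteq> ?L"
        then have MI: "left_ideal M R" by blast
        show "M = {\<zero>} \<or> M = ?L"
        proof (rule disjCI)
          assume "M \<noteq> ?L"
          show "M = {\<zero>}"
          proof (rule ccontr)
            assume "M \<noteq> {\<zero>}"
            then obtain x where x: "x \<in> M" "x \<noteq> \<zero>" using left_idealD(2)[OF MI] by blast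
            then obtain a where a: "a \<in> carrier R" "x = a \<otimes> u" using M by blast
            have xc: "x \<in> carrier R" using a u by simp
            \<comment> \<open>This is a two-sided ideal, and it misses \<open>\<one>\<close> because
              \<open>x\<close> is nonzero. So some \<open>v\<close> in \<open>U\<close> lies outside
              it; orthogonality forces \<open>v = u\<close>, and \<open>div\<close> recovers
              \<open>u\<close> from \<open>x\<close>.\<close>
            let ?J = "{y \<in> carrier R. \<forall>r\<in>carrier R. y \<otimes> r \<otimes> x = \<zero>}"
            have "ideal ?J R"
            proof (rule idealI)
              show "ring R" by (rule ring_axioms)
              have "left_ideal ?J R"
                unfolding left_ideal_iff using xc by (auto simp: l_distr m_assoc)
              then show "subgroup ?J (add_monoid R)"
                by (simp add: left_ideal_def additive_subgroup_def)
              show "y \<otimes> b \<in> ?J" if y: "y \<in> ?J" and b: "b \<in> carrier R" for y b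
              proof -
                have "y \<otimes> b \<otimes> r \<otimes> x = \<zero>" if r: "r \<in> carrier R" for r
                proof -
                  have "y \<otimes> (b \<otimes> r) \<otimes> x = \<zero>" using y b r by blast
                  then show ?thesis using y b r by (simp add: m_assoc)
                qed
                then show ?thesis using y b by simp
              qed
            qed (use xc in \<open>auto simp: m_assoc\<close>)
            moreover have "\<one> \<notin> ?J" using x xc by (auto intro!: bexI[of _ \<one>])
            ultimately obtain v where v: "v \<in> U" "v \<notin> ?J" using full by blast
            then obtain r where r: "r \<in> carrier R" "v \<otimes> r \<otimes> x \<noteq> \<zero>" using U by blast
            have vc: "v \<in> carrier R" using v U by blast
            have e: "v \<otimes> r \<otimes> x = v \<otimes> (r \<otimes> a) \<otimes> u" using a r vc u by (simp add: m_assoc)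
            then have "v = u" using orth[OF v(1) uU, of "r \<otimes> a"] r a by auto
            then obtain s where s: "s \<in> carrier R" "s \<otimes> (v \<otimes> r \<otimes> x) = u"
              using div[OF uU, of "r \<otimes> a"] e r a by auto
            then have "u \<in> M" using left_idealD(4)[OF MI] x r vc by (metis m_closed)
            then have "?L \<subseteq> M" using left_idealD(4)[OF MI] by blast
            then show False using M \<open>M \<noteq> ?L\<close> by blast
          qed
        qed
      qed
      then show ?thesis using left_socle_superset uL by blast
    qed (simp add: left_socle.zero)
  qed
  then show ?thesis using semisimple_ringI full left_socle_ideal by blast
qed

text \<open>\<open>z\<close> annihilates every simple left ideal \<open>L\<close>: if
  \<open>z \<otimes> l\<close> were nonzero, it would generate \<open>L\<close>, so
  \<open>l = r \<otimes> (z \<otimes> l)\<close> for some \<open>r\<close>, and then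
  \<open>z \<otimes> l\<close> contains the factor \<open>z \<otimes> r \<otimes> z\<close>. Since
  \<open>\<one>\<close> is a sum of elements of simple left ideals, \<open>z\<close> is
  zero.\<close>

lemma semisimple_ring_semiprime:
  assumes ss: "semisimple_ring R" and z: "z \<in> carrier R"
    and zrz: "\<And>r. r \<in> carrier R \<Longrightarrow> z \<otimes> r \<otimes> z = \<zero>"
  shows "z = \<zero>"
proof -
  obtain S where S: "\<And>L. L \<in> S \<Longrightarrow> simple_left_ideal L R" "direct_sum_left_ideals S R"
    using ss by (auto simp: semisimple_ring_def)
  obtain f where f: "f \<in> (\<Pi>\<^sub>E L\<in>S. L)" "finite {L \<in> S. f L \<noteq> \<zero>}"
    "\<one> = finsum R f {L \<in> S. f L \<noteq> \<zero>}"
    using S(2) unfolding direct_sum_left_ideals_def by (meson one_closed)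
  have kill: "z \<otimes> l = \<zero>" if L: "L \<in> S" "l \<in> L" for l L
  proof (rule ccontr)
    assume nz: "z \<otimes> l \<noteq> \<zero>"
    have LI: "left_ideal L R" using S(1) L by (auto simp: simple_left_ideal_def)
    have l: "l \<in> carrier R" using left_idealD(1)[OF LI] L by blast
    let ?M = "(\<lambda>r. r \<otimes> (z \<otimes> l)) ` carrier R"
    have "left_ideal ?M R"
      unfolding left_ideal_iff
    proof (intro conjI ballI)
      show "?M \<subseteq> carrier R" using z l by auto
      show "\<zero> \<in> ?M" using z l by (intro image_eqI[of _ _ \<zero>]) auto
      fix x assume "x \<in> ?M"
      then obtain a where a: "a \<in> carrier R" "x = a \<otimes> (z \<otimes> l)" by blast
      show "x \<oplus> y \<in> ?M" if y: "y \<in> ?M" for y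
      proof -
        from y obtain b where b: "b \<in> carrier R" "y = b \<otimes> (z \<otimes> l)" by blast
        show ?thesis using a b z l by (intro image_eqI[of _ _ "a \<oplus> b"]) (auto simp: l_distr)
      qed
      show "r \<otimes> x \<in> ?M" if "r \<in> carrier R" for r
        using a that z l by (intro image_eqI[of _ _ "r \<otimes> a"]) (auto simp: m_assoc)
    qed
    moreover have "?M \<subseteq> L" using left_idealD(4)[OF LI] L z by auto
    moreover have "z \<otimes> l \<in> ?M" using z l by (intro image_eqI[of _ _ \<one>]) auto
    ultimately have "?M = L" using simple_left_idealD[OF S(1)[OF L(1)]] nz by blast
    then obtain r where r: "r \<in> carrier R" "l = r \<otimes> (z \<otimes> l)" using L by blast
    have "z \<otimes> l = z \<otimes> r \<otimes> z \<otimes> l" using r z l by (metis m_assoc m_closed)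
    then show False using zrz[OF r(1)] l nz by simp
  qed
  have fc: "f \<in> {L \<in> S. f L \<noteq> \<zero>} \<rightarrow> carrier R"
    using f(1) S(1) simple_left_ideal_subset by (fastforce simp: PiE_def Pi_def)
  have "z = z \<otimes> \<one>" using z by simp
  also have "\<dots> = z \<otimes> finsum R f {L \<in> S. f L \<noteq> \<zero>}" using f(3) by simp
  also have "\<dots> = (\<Oplus>L\<in>{L \<in> S. f L \<noteq> \<zero>}. z \<otimes> f L)"
    using f(2) fc z by (intro finsum_rdistr) auto
  also have "\<dots> = (\<Oplus>L\<in>{L \<in> S. f L \<noteq> \<zero>}. \<zero>)"
    using kill f(1) by (intro add.finprod_cong') (auto simp: PiE_def Pi_def)
  finally show ?thesis by simp
qed

end

section \<open>Algebras with forked Temperley-Lieb generators\<close>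

text \<open>The vertex \<open>1\<close> with a bar gets index \<open>0\<close>.\<close>

locale ftl_algebra = ring R for R (structure) +
  fixes \<delta> :: "'k::field" and N :: nat and e :: "nat \<Rightarrow> 'a"
    and smul :: "'k \<Rightarrow> 'a \<Rightarrow> 'a" (infixr "\<cdot>" 75)
  assumes N3: "3 \<le> N" and \<delta>_nz: "\<delta> \<noteq> 0"
    and smul_closed [simp, intro]: "x \<in> carrier R \<Longrightarrow> c \<cdot> x \<in> carrier R"
    and smul_add_left: "x \<in> carrier R \<Longrightarrow> (a + b) \<cdot> x = a \<cdot> x \<oplus> b \<cdot> x"
    and smul_add_right: "x \<in> carrier R \<Longrightarrow> y \<in> carrier R \<Longrightarrow> c \<cdot> (x \<oplus> y) = c \<cdot> x \<oplus> c \<cdot> y"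
    and smul_smul: "x \<in> carrier R \<Longrightarrow> a \<cdot> b \<cdot> x = (a * b) \<cdot> x"
    and smul_one [simp]: "x \<in> carrier R \<Longrightarrow> 1 \<cdot> x = x"
    and smul_mult_left: "x \<in> carrier R \<Longrightarrow> y \<in> carrier R \<Longrightarrow> (c \<cdot> x) \<otimes> y = c \<cdot> (x \<otimes> y)"
    and smul_mult_right: "x \<in> carrier R \<Longrightarrow> y \<in> carrier R \<Longrightarrow> x \<otimes> (c \<cdot> y) = c \<cdot> (x \<otimes> y)"
    and e_closed [simp, intro]: "i < N \<Longrightarrow> e i \<in> carrier R"
    and e_square: "i < N \<Longrightarrow> e i \<otimes> e i = \<delta> \<cdot> e i"
    and e_far: "i + 2 \<le> j \<Longrightarrow> j < N \<Longrightarrow> (i, j) \<noteq> (0, 2) \<Longrightarrow> e i \<otimes> e j = e j \<otimes> e i"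
    and e_up: "1 \<le> i \<Longrightarrow> Suc i < N \<Longrightarrow> e i \<otimes> e (Suc i) \<otimes> e i = e i"
    and e_down: "1 \<le> i \<Longrightarrow> Suc i < N \<Longrightarrow> e (Suc i) \<otimes> e i \<otimes> e (Suc i) = e (Suc i)"
    and e_020: "e 0 \<otimes> e 2 \<otimes> e 0 = e 0"
    and e_202: "e 2 \<otimes> e 0 \<otimes> e 2 = e 2"
    and e_01: "e 0 \<otimes> e 1 = \<zero>"
    and e_10: "e 1 \<otimes> e 0 = \<zero>"
begin

section \<open>Scalars, and the subalgebras generated by initial segments of the graph\<close>

lemma smul_zero_left [simp]: "x \<in> carrier R \<Longrightarrow> 0 \<cdot> x = \<zero>"
  using smul_add_left[of x 0 0] by (metis add.r_cancel_one' add_0 smul_closed)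

lemma smul_zero_right [simp]: "c \<cdot> \<zero> = \<zero>"
  using smul_add_right[of \<zero> \<zero> c] by (metis add.r_cancel_one' r_zero smul_closed zero_closed)

lemma smul_neg_cancel: "x \<in> carrier R \<Longrightarrow> x \<oplus> (- 1) \<cdot> x = \<zero>"
  using smul_add_left[of x 1 "- 1"] by simp

lemma smul_eq_zero: "x \<in> carrier R \<Longrightarrow> c \<noteq> 0 \<Longrightarrow> c \<cdot> x = \<zero> \<Longrightarrow> x = \<zero>"
  using smul_smul[of x "inverse c" c] by simp

lemma mult_assoc_eq:
  "x \<otimes> y = w \<Longrightarrow> x \<in> carrier R \<Longrightarrow> y \<in> carrier R \<Longrightarrow> z \<in> carrier R \<Longrightarrow> x \<otimes> (y \<otimes> z) = w \<otimes> z"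
  by (metis m_assoc)

lemmas smul_simps = smul_add_left smul_add_right smul_smul smul_mult_left smul_mult_right
  l_distr r_distr m_assoc

inductive_set alg :: "nat set \<Rightarrow> 'a set" for S where
  one: "\<one> \<in> alg S"
| gen: "i \<in> S \<Longrightarrow> e i \<in> alg S"
| add: "x \<in> alg S \<Longrightarrow> y \<in> alg S \<Longrightarrow> x \<oplus> y \<in> alg S"
| mult: "x \<in> alg S \<Longrightarrow> y \<in> alg S \<Longrightarrow> x \<otimes> y \<in> alg S"
| smul: "x \<in> alg S \<Longrightarrow> c \<cdot> x \<in> alg S"

lemma alg_closed: "x \<in> alg S \<Longrightarrow> S \<subseteq> {..<N} \<Longrightarrow> x \<in> carrier R"
  by (induction rule: alg.induct) auto

lemma alg_mono: "x \<in> alg S \<Longrightarrow> S \<subseteq> T \<Longrightarrow> x \<in> alg T"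
  by (induction rule: alg.induct) (auto intro: alg.intros)

lemma alg_commute:
  assumes "x \<in> alg S" "S \<subseteq> {..<N}" "y \<in> carrier R" "\<And>i. i \<in> S \<Longrightarrow> e i \<otimes> y = y \<otimes> e i"
  shows "x \<otimes> y = y \<otimes> x"
  using assms(1)
proof (induction rule: alg.induct)
  case (mult u v)
  then have "u \<in> carrier R" "v \<in> carrier R" using alg_closed assms(2) by auto
  then show ?case using mult assms(3) by (metis m_assoc)
qed (use assms alg_closed in \<open>auto simp: smul_simps\<close>)

lemma alg_empty: "x \<in> alg {} \<Longrightarrow> \<exists>c. x = c \<cdot> \<one>"
proof (induction rule: alg.induct)
  case one
  show ?case by (intro exI[of _ 1]) simp
next
  case (add x y)
  then show ?case by (metis one_closed smul_add_left)
next
  case (mult x y)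
  then obtain a b where "x = a \<cdot> \<one>" "y = b \<cdot> \<one>" by blast
  then have "x \<otimes> y = (a * b) \<cdot> \<one>" by (simp add: smul_simps mult.commute)
  then show ?case by blast
next
  case (smul x c)
  then show ?case by (metis one_closed smul_smul)
qed auto

text \<open>\<open>D\<^sub>1\<close> counts as the empty graph here, so that \<open>A 0 = A 1\<close> consists of the scalars.\<close>

definition G :: "nat \<Rightarrow> nat set" where
  "G m = (if m < 2 then {} else {..<m})"

abbreviation A :: "nat \<Rightarrow> 'a set" where
  "A m \<equiv> alg (G m)"

lemma G_bound: "m \<le> N \<Longrightarrow> G m \<subseteq> {..<N}"
  by (auto simp: G_def)

lemma G_mono: "m \<le> m' \<Longrightarrow> G m \<subseteq> G m'"
  by (auto simp: G_def)

lemma A_closed [intro]: "x \<in> A m \<Longrightarrow> m \<le> N \<Longrightarrow> x \<in> carrier R"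
  using alg_closed G_bound by blast

lemma A_mono: "x \<in> A m \<Longrightarrow> m \<le> m' \<Longrightarrow> x \<in> A m'"
  using alg_mono G_mono by blast

text \<open>The generators of \<open>A m\<close> have index at most \<open>j - 2\<close>. The
  adjacent pair \<open>(0, 2)\<close> does not arise: for \<open>j = 2\<close> one has
  \<open>m < 2\<close>, and then \<open>G m\<close> is empty.\<close>

lemma A_commute: "x \<in> A m \<Longrightarrow> m < j \<Longrightarrow> j < N \<Longrightarrow> e j \<otimes> x = x \<otimes> e j"
  by (rule sym, rule alg_commute[of x "G m"])
     (auto simp: G_def split: if_splits intro!: e_far)

lemma A_scalar: "x \<in> A m \<Longrightarrow> m < 2 \<Longrightarrow> \<exists>c. x = c \<cdot> \<one>"
  using alg_empty by (simp add: G_def)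

lemma e0_closed [simp]: "e 0 \<in> carrier R" and e1_closed [simp]: "e 1 \<in> carrier R"
  and e1_closed' [simp]: "e (Suc 0) \<in> carrier R" and e2_closed [simp]: "e 2 \<in> carrier R"
  using N3 by auto

text \<open>The product of \<open>e 0\<close> and \<open>e 1\<close> is zero in either order, so
  \<open>\<one>\<close>, \<open>e 0\<close> and \<open>e 1\<close> already span a
  subalgebra.\<close>

lemma A_2:
  assumes "x \<in> A 2"
  shows "\<exists>a b c. x = a \<cdot> \<one> \<oplus> b \<cdot> e 0 \<oplus> c \<cdot> e 1"
  using assms
proof (induction rule: alg.induct)
  case one
  show ?case by (intro exI[of _ 1] exI[of _ 0]) simp
next
  case (gen i)
  then consider "i = 0" | "i = 1" by (auto simp: G_def less_2_cases_iff)
  then show ?case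
  proof cases
    case 1
    then show ?thesis by (intro exI[of _ 0] exI[of _ 1]) (simp del: One_nat_def)
  next
    case 2
    show ?thesis unfolding 2 by (rule exI[of _ 0], rule exI[of _ 0], rule exI[of _ 1]) simp
  qed
next
  case (add x y)
  then obtain a b c a' b' c' where "x = a \<cdot> \<one> \<oplus> b \<cdot> e 0 \<oplus> c \<cdot> e 1"
    "y = a' \<cdot> \<one> \<oplus> b' \<cdot> e 0 \<oplus> c' \<cdot> e 1" by metis
  then have "x \<oplus> y = (a + a') \<cdot> \<one> \<oplus> (b + b') \<cdot> e 0 \<oplus> (c + c') \<cdot> e 1"
    by (simp add: smul_add_left a_ac)
  then show ?case by blast
next
  case (mult x y)
  then obtain a b c a' b' c' where "x = a \<cdot> \<one> \<oplus> b \<cdot> e 0 \<oplus> c \<cdot> e 1"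
    "y = a' \<cdot> \<one> \<oplus> b' \<cdot> e 0 \<oplus> c' \<cdot> e 1" by metis
  then have "x \<otimes> y = (a * a') \<cdot> \<one> \<oplus> (a * b' + b * a' + b * b' * \<delta>) \<cdot> e 0
      \<oplus> (a * c' + c * a' + c * c' * \<delta>) \<cdot> e 1"
    using e_01 e_10 e_square[of 0] e_square[of 1] N3
    by (simp add: smul_simps a_ac mult_ac)
  then show ?case by blast
next
  case (smul x d)
  then obtain a b c where "x = a \<cdot> \<one> \<oplus> b \<cdot> e 0 \<oplus> c \<cdot> e 1" by metis
  then have "d \<cdot> x = (d * a) \<cdot> \<one> \<oplus> (d * b) \<cdot> e 0 \<oplus> (d * c) \<cdot> e 1"
    by (simp add: smul_simps)
  then show ?case by blast
qed

section \<open>Normal forms and corners of the generated subalgebras\<close>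

inductive_set span :: "nat \<Rightarrow> 'a set" for k where
  base: "a \<in> A k \<Longrightarrow> a \<in> span k"
| cup: "a \<in> A k \<Longrightarrow> b \<in> A k \<Longrightarrow> a \<otimes> (e k \<otimes> b) \<in> span k"
| add: "x \<in> span k \<Longrightarrow> y \<in> span k \<Longrightarrow> x \<oplus> y \<in> span k"

lemma span_closed: "x \<in> span k \<Longrightarrow> k < N \<Longrightarrow> x \<in> carrier R"
  by (induction rule: span.induct) (auto simp: A_closed[of _ k])

lemma span_mult_left: "x \<in> span k \<Longrightarrow> a \<in> A k \<Longrightarrow> k < N \<Longrightarrow> a \<otimes> x \<in> span k"
proof (induction rule: span.induct)
  case (base b)
  then show ?case by (auto intro: span.base alg.mult)
next
  case (cup b c)
  then have "a \<in> carrier R" "b \<in> carrier R" "c \<in> carrier R" by auto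
  then have "a \<otimes> (b \<otimes> (e k \<otimes> c)) = (a \<otimes> b) \<otimes> (e k \<otimes> c)" using cup by (simp add: m_assoc)
  then show ?case using cup by (auto intro: span.cup alg.mult)
next
  case (add x y)
  then have "a \<otimes> (x \<oplus> y) = a \<otimes> x \<oplus> a \<otimes> y"
    using span_closed A_closed[of a k] by (simp add: r_distr)
  then show ?case using add by (auto intro: span.add)
qed

lemma span_mult_e:
  assumes k: "k < N" and P: "\<And>x. x \<in> A k \<Longrightarrow> \<exists>y\<in>A k. e k \<otimes> x \<otimes> e k = y \<otimes> e k"
  shows "x \<in> span k \<Longrightarrow> e k \<otimes> x \<in> span k"
proof (induction rule: span.induct)
  case (base b)
  then have "e k \<otimes> b = \<one> \<otimes> (e k \<otimes> b)" using k A_closed[of b k] by simp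
  then show ?case using span.cup[OF alg.one base] by simp
next
  case (cup b c)
  obtain y where y: "y \<in> A k" "e k \<otimes> b \<otimes> e k = y \<otimes> e k" using P cup by blast
  have "b \<in> carrier R" "c \<in> carrier R" "y \<in> carrier R" using cup y k by auto
  then have "e k \<otimes> (b \<otimes> (e k \<otimes> c)) = y \<otimes> (e k \<otimes> c)"
    using y k by (metis e_closed m_assoc m_closed)
  then show ?case using cup y by (auto intro: span.cup)
next
  case (add x y)
  then show ?case using span_closed k by (auto simp: r_distr intro: span.add)
qed

text \<open>At most one factor \<open>e k\<close> is needed, since by \<open>P\<close> two
  occurrences merge into one. So \<open>span k\<close> is stable under left multiplication by the
  generators of \<open>A (Suc k)\<close>, and it contains \<open>\<one>\<close>.\<close>

lemma A_Suc_span: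
  assumes k: "2 \<le> k" "k < N" and P: "\<And>x. x \<in> A k \<Longrightarrow> \<exists>y\<in>A k. e k \<otimes> x \<otimes> e k = y \<otimes> e k"
    and x: "x \<in> A (Suc k)"
  shows "x \<in> span k"
proof -
  have "x \<otimes> y \<in> span k" if "y \<in> span k" for y
    using x that
  proof (induction arbitrary: y rule: alg.induct)
    case (gen i)
    then have "i = k \<or> i \<in> G k" using k by (auto simp: G_def)
    then show ?case using gen span_mult_e[OF k(2) P] span_mult_left k alg.gen by blast
  next
    case (add u v)
    then have "u \<in> carrier R" "v \<in> carrier R" using k A_closed[of _ "Suc k"] by auto
    then show ?case using add span_closed k by (auto simp: l_distr intro: span.add)
  next
    case (mult u v)
    then have "u \<in> carrier R" "v \<in> carrier R" using k A_closed[of _ "Suc k"] by auto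
    then show ?case using mult span_closed k by (simp add: m_assoc)
  next
    case (smul u c)
    have c: "u \<in> carrier R" "y \<in> carrier R"
      using smul k A_closed[of _ "Suc k"] span_closed by auto
    have "(c \<cdot> \<one>) \<otimes> (u \<otimes> y) \<in> span k"
      by (rule span_mult_left[OF smul.IH[OF smul.prems] alg.smul[OF alg.one] k(2)])
    then show ?case using c by (simp add: smul_mult_left)
  qed (use span_closed k in auto)
  then have "x \<otimes> \<one> \<in> span k" using span.base alg.one by blast
  then show ?thesis using A_closed[OF x] k by simp
qed

text \<open>In the step, \<open>x\<close> is a sum of terms \<open>a\<close> and
  \<open>a \<otimes> (?f \<otimes> b)\<close> where \<open>a\<close> and \<open>b\<close> commute
  with \<open>?e\<close>; sandwiching turns them into \<open>\<delta> \<cdot> a\<close> and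
  \<open>a \<otimes> b\<close>, times \<open>?e\<close>. The induction hypothesis supplies the
  merging rule for \<open>A_Suc_span\<close>.\<close>

lemma conditional_expectation:
  "1 \<le> k \<Longrightarrow> Suc k < N \<Longrightarrow> x \<in> A (Suc k) \<Longrightarrow> \<exists>y\<in>A k. e (Suc k) \<otimes> x \<otimes> e (Suc k) = y \<otimes> e (Suc k)"
proof (induction k arbitrary: x rule: nat_induct_at_least)
  case base
  \<comment> \<open>Here \<open>e 2\<close> is adjacent to both leaves, so the sandwich turns each
    of \<open>e 0\<close> and \<open>e 1\<close> into \<open>e 2\<close>. The result is a scalar
    multiple, as membership in \<open>A 1\<close> demands.\<close>
  obtain a b c where x: "x = a \<cdot> \<one> \<oplus> b \<cdot> e 0 \<oplus> c \<cdot> e 1"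
    using A_2[of x] base by (metis Suc_1 One_nat_def)
  have "e 2 \<otimes> x \<otimes> e 2 = ((a * \<delta> + b + c) \<cdot> \<one>) \<otimes> e 2"
    using x e_202 e_down[of 1] e_square[of 2] N3 by (simp add: smul_simps numeral_2_eq_2)
  then show ?case by (auto simp: numeral_2_eq_2 intro!: bexI[of _ "(a * \<delta> + b + c) \<cdot> \<one>"] alg.intros)
next
  case (Suc k)
  let ?e = "e (Suc (Suc k))" and ?f = "e (Suc k)"
  have "x \<in> span (Suc k)"
  proof (rule A_Suc_span)
    show "\<exists>y\<in>A (Suc k). ?f \<otimes> z \<otimes> ?f = y \<otimes> ?f" if "z \<in> A (Suc k)" for z
      using Suc.IH[of z] that Suc.prems A_mono[of _ k "Suc k"] by fastforce
  qed (use Suc in auto)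
  then show ?case
  proof (induction rule: span.induct)
    case (base a)
    have a: "a \<in> carrier R" using base Suc.prems by auto
    have "?e \<otimes> a \<otimes> ?e = a \<otimes> (?e \<otimes> ?e)"
      using A_commute[OF base, of "Suc (Suc k)"] Suc.prems a by (simp add: m_assoc)
    also have "\<dots> = (\<delta> \<cdot> a) \<otimes> ?e" using Suc.prems a by (simp add: e_square smul_simps)
    finally show ?case using base by (blast intro: alg.smul)
  next
    case (cup a b)
    have c: "a \<in> carrier R" "b \<in> carrier R" "?e \<in> carrier R" "?f \<in> carrier R"
      using cup Suc.prems by auto
    have ca: "?e \<otimes> a = a \<otimes> ?e" "?e \<otimes> b = b \<otimes> ?e"
      using A_commute cup Suc.prems by auto
    have "?e \<otimes> (a \<otimes> (?f \<otimes> b)) \<otimes> ?e = (?e \<otimes> a) \<otimes> ?f \<otimes> (b \<otimes> ?e)" using c by (simp add: m_assoc)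
    also have "\<dots> = a \<otimes> (?e \<otimes> ?f \<otimes> ?e) \<otimes> b"
      unfolding ca(1) ca(2)[symmetric] using c by (simp add: m_assoc)
    also have "\<dots> = a \<otimes> (?e \<otimes> b)" using e_down[of "Suc k"] Suc.prems c by (simp add: m_assoc)
    also have "\<dots> = (a \<otimes> b) \<otimes> ?e" unfolding ca(2) using c by (simp add: m_assoc)
    finally show ?case using cup by (blast intro: alg.mult)
  next
    case (add u v)
    then obtain u' v' where *: "u' \<in> A (Suc k)" "v' \<in> A (Suc k)" "?e \<otimes> u \<otimes> ?e = u' \<otimes> ?e"
      "?e \<otimes> v \<otimes> ?e = v' \<otimes> ?e" by blast
    have "u \<in> carrier R" "v \<in> carrier R" "u' \<in> carrier R" "v' \<in> carrier R"
      using add * Suc.prems span_closed by auto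
    then have "?e \<otimes> (u \<oplus> v) \<otimes> ?e = (u' \<oplus> v') \<otimes> ?e"
      using * Suc.prems by (simp add: l_distr r_distr)
    then show ?case using * by (blast intro: alg.add)
  qed
qed

text \<open>Now \<open>x\<close> may itself contain \<open>e (Suc k)\<close>. In a term
  \<open>a \<otimes> (e (Suc k) \<otimes> b)\<close> the generator in the middle serves both sides,
  so \<open>a\<close> and \<open>b\<close> are sandwiched separately and
  \<open>conditional_expectation\<close> applies twice.\<close>

lemma corner:
  assumes k: "1 \<le> k" "Suc k < N" and x: "x \<in> A (Suc (Suc k))"
  shows "\<exists>y\<in>A k. e (Suc k) \<otimes> x \<otimes> e (Suc k) = y \<otimes> e (Suc k)"
proof -
  let ?e = "e (Suc k)"
  note P = conditional_expectation[OF k]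
  have e: "?e \<in> carrier R" using k by auto
  have "x \<in> span (Suc k)"
  proof (rule A_Suc_span)
    show "\<exists>y\<in>A (Suc k). ?e \<otimes> z \<otimes> ?e = y \<otimes> ?e" if "z \<in> A (Suc k)" for z
      using P[OF that] A_mono[of _ k "Suc k"] by fastforce
  qed (use k x in auto)
  then show ?thesis
  proof (induction rule: span.induct)
    case (base a)
    then show ?case by (rule P)
  next
    case (cup a b)
    obtain a' b' where *: "a' \<in> A k" "b' \<in> A k" "?e \<otimes> a \<otimes> ?e = a' \<otimes> ?e" "?e \<otimes> b \<otimes> ?e = b' \<otimes> ?e"
      using P cup by meson
    have c: "a \<in> carrier R" "b \<in> carrier R" "a' \<in> carrier R" "b' \<in> carrier R" using cup * k by auto
    have "?e \<otimes> (a \<otimes> (?e \<otimes> b)) \<otimes> ?e = (?e \<otimes> a \<otimes> ?e) \<otimes> (b \<otimes> ?e)" using c e by (simp add: m_assoc)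
    also have "\<dots> = a' \<otimes> (?e \<otimes> b \<otimes> ?e)" unfolding *(3) using c e by (simp add: m_assoc)
    also have "\<dots> = (a' \<otimes> b') \<otimes> ?e" unfolding *(4) using c e by (simp add: m_assoc)
    finally show ?case using * by (blast intro: alg.mult)
  next
    case (add u v)
    then obtain u' v' where *: "u' \<in> A k" "v' \<in> A k" "?e \<otimes> u \<otimes> ?e = u' \<otimes> ?e"
      "?e \<otimes> v \<otimes> ?e = v' \<otimes> ?e" by blast
    have "u \<in> carrier R" "v \<in> carrier R" "u' \<in> carrier R" "v' \<in> carrier R"
      using add * k span_closed by auto
    then have "?e \<otimes> (u \<oplus> v) \<otimes> ?e = (u' \<oplus> v') \<otimes> ?e"
      using * e by (simp add: l_distr r_distr)
    then show ?case using * by (blast intro: alg.add)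
  qed
qed

end

context ftl_algebra begin

subsection \<open>Jones-Wenzl projections\<close>

text \<open>One step of the Wenzl recursion, with \<open>p\<close>, \<open>q\<close>,
  \<open>E\<close> standing for \<open>jw m\<close>, \<open>jw (m - 1)\<close>, \<open>et m\<close>.
  Multiplied by \<open>E\<close>, the correction becomes \<open>c * \<kappa>\<close> times
  \<open>p \<otimes> E\<close>, because \<open>p \<otimes> q = p\<close>, and cancels the leading
  term.\<close>

lemma jw_step:
  assumes [simp]: "p \<in> carrier R" "q \<in> carrier R" "E \<in> carrier R"
    and pp: "p \<otimes> p = p" and qp: "q \<otimes> p = p" and pq: "p \<otimes> q = p" and Eq: "E \<otimes> q = q \<otimes> E"
    and EpE: "E \<otimes> p \<otimes> E = \<kappa> \<cdot> (q \<otimes> E)" and c: "c * \<kappa> = 1"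
    and p': "p' = p \<oplus> (- c) \<cdot> (p \<otimes> E \<otimes> p)"
  shows "p' \<otimes> E = \<zero>" "E \<otimes> p' = \<zero>" "p' \<otimes> p = p'" "p \<otimes> p' = p'" "p' \<otimes> p' = p'"
proof -
  have r: "p \<otimes> (p \<otimes> z) = p \<otimes> z" "q \<otimes> (p \<otimes> z) = p \<otimes> z" "p \<otimes> (q \<otimes> z) = p \<otimes> z"
    if "z \<in> carrier R" for z
    using that mult_assoc_eq[OF pp] mult_assoc_eq[OF qp] mult_assoc_eq[OF pq] by simp_all
  have EpE': "E \<otimes> (p \<otimes> E) = \<kappa> \<cdot> (q \<otimes> E)" using EpE by (simp add: m_assoc)
  have p'c: "p' \<in> carrier R" unfolding p' by simp
  show p'E: "p' \<otimes> E = \<zero>"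
    unfolding p' by (simp add: smul_simps EpE' r c smul_neg_cancel)
  have "E \<otimes> (p \<otimes> (E \<otimes> p)) = (E \<otimes> p \<otimes> E) \<otimes> p" by (simp add: m_assoc)
  also have "\<dots> = \<kappa> \<cdot> (E \<otimes> p)"
    unfolding EpE Eq[symmetric] by (simp add: smul_simps qp)
  finally show "E \<otimes> p' = \<zero>"
    unfolding p' by (simp add: smul_simps c smul_neg_cancel)
  show p'p: "p' \<otimes> p = p'" and "p \<otimes> p' = p'"
    unfolding p' by (simp_all add: smul_simps pp r)
  have "p' \<otimes> p' = p' \<otimes> p \<oplus> (- c) \<cdot> (p' \<otimes> p \<otimes> E \<otimes> p)"
    using p'c by (subst (2) p') (simp add: smul_simps)
  then show "p' \<otimes> p' = p'" using p'c p'E unfolding p'p by (simp add: m_assoc)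
qed

text \<open>The leaves \<open>e 0\<close> and \<open>e 1\<close> are orthogonal and satisfy the same
  quadratic relation, so their sum satisfies it too and can play the part of a single first
  generator.\<close>

definition et :: "nat \<Rightarrow> 'a" where
  "et k = (if k = 1 then e 0 \<oplus> e 1 else e k)"

text \<open>\<open>Q\<close> has a junk value at 1. The value \<open>\<delta>\<close> makes
  \<open>q 2 / q 1 = \<delta>\<close>, as the start of the recursion requires, and puts the
  coefficient 2 into \<open>q_3\<close>.\<close>

definition q :: "nat \<Rightarrow> 'k" where
  "q k = (if k = 1 then \<delta> else poly (Q k) \<delta>)"

lemma q_1: "q 1 = \<delta>" and q_2: "q 2 = \<delta> * \<delta>" and q_3: "q 3 = \<delta> * q 2 - 2 * q 1"
  by (simp_all add: q_def Q_2 Q_3 power2_eq_square power3_eq_cube algebra_simps)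

lemma q_rec: "2 \<le> m \<Longrightarrow> q (Suc (Suc m)) = \<delta> * q (Suc m) - q m"
  using Q_rec[of "Suc m", where 'a = 'k] by (simp add: q_def)

text \<open>\<open>A 0\<close> and \<open>A 1\<close> contain only scalars, so the first two values
  are \<open>\<one>\<close>. If \<open>q (Suc k)\<close> vanishes, division by zero makes the
  correction zero; the projection properties are claimed only where the \<open>q t\<close> do not
  vanish.\<close>

primrec jw :: "nat \<Rightarrow> 'a" where
  "jw 0 = \<one>"
| "jw (Suc k) = (if k = 0 then \<one> else jw k \<oplus> (- (q k / q (Suc k))) \<cdot> (jw k \<otimes> et k \<otimes> jw k))"

lemma jw_1 [simp]: "jw (Suc 0) = \<one>" by simp

declare jw.simps(2) [simp del]

lemma et_in_A: "1 \<le> k \<Longrightarrow> et k \<in> A (Suc k)"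
  by (auto simp: et_def G_def intro!: alg.intros)

lemma et_closed: "1 \<le> k \<Longrightarrow> k < N \<Longrightarrow> et k \<in> carrier R"
  using et_in_A[of k] A_closed[of _ "Suc k"] by auto

lemma jw_in_A: "jw m \<in> A m"
proof (induction m)
  case (Suc m)
  show ?case
  proof (cases "m = 0")
    case False
    then have "jw m \<in> A (Suc m)" "et m \<in> A (Suc m)" using Suc A_mono[of _ m] et_in_A by auto
    then show ?thesis using False by (auto simp: jw.simps(2) intro!: alg.intros)
  qed (auto intro: alg.one simp: jw.simps(2))
qed (auto intro: alg.one)

lemma jw_closed [simp]: "m \<le> N \<Longrightarrow> jw m \<in> carrier R"
  using jw_in_A by blast

text \<open>The clauses feed each other in the induction: absorption between neighbouring levels and
  the sandwich formula are what \<open>jw_step\<close> asks for at the next level. The sandwich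
  formula needs \<open>m < N\<close> so that \<open>e m\<close> exists.\<close>

definition jw_spec :: "nat \<Rightarrow> bool" where
  "jw_spec m \<longleftrightarrow> (\<forall>i\<in>G m. jw m \<otimes> e i = \<zero> \<and> e i \<otimes> jw m = \<zero>) \<and> jw m \<otimes> jw m = jw m
     \<and> jw (m - 1) \<otimes> jw m = jw m \<and> jw m \<otimes> jw (m - 1) = jw m
     \<and> (m < N \<longrightarrow> et m \<otimes> jw m \<otimes> et m = (q (Suc m) / q m) \<cdot> (jw (m - 1) \<otimes> et m))"

lemma et_commute: "x \<in> A (k - 1) \<Longrightarrow> 1 \<le> k \<Longrightarrow> k < N \<Longrightarrow> et k \<otimes> x = x \<otimes> et k"
proof (cases "k = 1")
  case True
  assume x: "x \<in> A (k - 1)"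
  then obtain c where "x = c \<cdot> \<one>" using A_scalar[of x 0] True by auto
  then show ?thesis using True by (simp add: et_def smul_simps)
next
  case False
  assume "x \<in> A (k - 1)" "1 \<le> k" "k < N"
  then show ?thesis using False A_commute[of x "k - 1" k] by (simp add: et_def)
qed

text \<open>For \<open>m = 1\<close> each leaf contributes one copy of \<open>e 2\<close>. This is
  the source of the coefficient 2 in \<open>Q 3\<close>.\<close>

lemma et_sandwich:
  assumes "1 \<le> m" "Suc m < N"
  shows "e (Suc m) \<otimes> et m \<otimes> e (Suc m) = (if m = 1 then 2 else 1) \<cdot> e (Suc m)"
proof (cases "m = 1")
  case True
  have "e 2 \<otimes> (e 0 \<oplus> e 1) \<otimes> e 2 = e 2 \<oplus> e 2"
    using e_202 e_down[of 1] N3 by (simp add: smul_simps numeral_2_eq_2)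
  also have "\<dots> = 2 \<cdot> e 2" using smul_add_left[of "e 2" 1 1] by simp
  finally show ?thesis using True by (simp add: et_def numeral_2_eq_2)
next
  case False
  then show ?thesis using e_down[of m] assms by (simp add: et_def)
qed

text \<open>\<open>jw_step\<close> gives idempotence and annihilation by \<open>et m\<close>;
  smaller generators are killed because \<open>p'\<close> absorbs \<open>p\<close>. As
  \<open>e (Suc m)\<close> commutes with \<open>p\<close>, the next sandwich formula reduces to a
  scalar identity, which is the recursion for \<open>q\<close>.\<close>

lemma jw_props:
  "1 \<le> m \<Longrightarrow> m \<le> N \<Longrightarrow> \<forall>t. 2 \<le> t \<and> t \<le> m \<longrightarrow> q t \<noteq> 0 \<Longrightarrow> jw_spec m"
proof (induction m rule: nat_induct_at_least)
  case base
  have "(e 0 \<oplus> e 1) \<otimes> (e 0 \<oplus> e 1) = \<delta> \<cdot> (e 0 \<oplus> e 1)"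
    using e_01 e_10 e_square[of 0] e_square[of 1] N3 by (simp add: smul_simps)
  moreover have "q 2 / q 1 = \<delta>" unfolding q_1 q_2 using \<delta>_nz by simp
  ultimately show ?case using N3
    by (simp add: jw_spec_def G_def et_def numeral_2_eq_2)
next
  case (Suc m)
  have m: "1 \<le> m" "m < N" using Suc by auto
  have qnz: "q m \<noteq> 0" "q (Suc m) \<noteq> 0"
    using Suc.prems(2)[rule_format, of m] Suc.prems(2)[rule_format, of "Suc m"] m \<delta>_nz q_1
    by (cases "m = 1"; simp)+
  have IH: "jw_spec m" using Suc by auto
  define p where "p = jw m"
  define p0 where "p0 = jw (m - 1)"
  define E where "E = et m"
  define c where "c = q m / q (Suc m)"
  define p' where "p' = jw (Suc m)"
  have c: "p \<in> carrier R" "p0 \<in> carrier R" "E \<in> carrier R" "p' \<in> carrier R"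
    using m Suc et_closed[of m] by (auto simp: p_def p0_def E_def p'_def)
  have s: "p \<otimes> p = p" "p0 \<otimes> p = p" "p \<otimes> p0 = p" "E \<otimes> p0 = p0 \<otimes> E"
    "E \<otimes> p \<otimes> E = (q (Suc m) / q m) \<cdot> (p0 \<otimes> E)"
    using IH m et_commute[OF jw_in_A m] unfolding jw_spec_def p_def p0_def E_def by auto
  have p'_eq: "p' = p \<oplus> (- c) \<cdot> (p \<otimes> E \<otimes> p)"
    using m by (simp add: p'_def p_def E_def c_def jw.simps(2))
  note st = jw_step[OF c(1-3) s _ p'_eq]
  have ck: "c * (q (Suc m) / q m) = 1" using qnz by (simp add: c_def)
  note st = st[OF ck]
  have gens: "p' \<otimes> e i = \<zero>" "e i \<otimes> p' = \<zero>" if i: "i \<in> G (Suc m)" for i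
  proof -
    have iN: "e i \<in> carrier R" using i Suc.prems by (auto simp: G_def split: if_splits)
    show "p' \<otimes> e i = \<zero>" "e i \<otimes> p' = \<zero>"
    proof (atomize (full), cases "m = 1")
      case True
      then have i01: "i = 0 \<or> i = 1" using i by (auto simp: G_def)
      \<comment> \<open>Annihilation by the sum of the leaves passes to each leaf, since the sum
        times one leaf is \<open>\<delta>\<close> times that leaf.\<close>
      have "E \<otimes> e i = \<delta> \<cdot> e i" "e i \<otimes> E = \<delta> \<cdot> e i"
        using i01 True e_01 e_10 e_square[of 0] e_square[of 1] N3
        by (auto simp: E_def et_def l_distr r_distr)
      then have "p' \<otimes> E \<otimes> e i = \<delta> \<cdot> (p' \<otimes> e i)" "e i \<otimes> (E \<otimes> p') = \<delta> \<cdot> (e i \<otimes> p')"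
        using c iN mult_assoc_eq[of "e i" E] by (simp_all add: m_assoc smul_mult_left smul_mult_right)
      then show "p' \<otimes> e i = \<zero> \<and> e i \<otimes> p' = \<zero>"
        using st(1,2) c iN \<delta>_nz smul_eq_zero[of _ \<delta>] by (metis l_null r_null m_closed)
    next
      case False
      show "p' \<otimes> e i = \<zero> \<and> e i \<otimes> p' = \<zero>"
      proof (cases "i = m")
        case True
        then show ?thesis using st(1,2) False by (simp add: E_def et_def)
      next
        case ne: False
        then have "i \<in> G m" using i False m by (auto simp: G_def split: if_splits)
        then have z: "p \<otimes> e i = \<zero>" "e i \<otimes> p = \<zero>" using IH by (auto simp: jw_spec_def p_def)
        have "p' \<otimes> e i = p' \<otimes> (p \<otimes> e i)" "e i \<otimes> p' = e i \<otimes> p \<otimes> p'"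
          using st(3,4) c iN by (metis m_assoc)+
        then show ?thesis using z c by simp
      qed
    qed
  qed
  have "et (Suc m) \<otimes> p' \<otimes> et (Suc m) = (q (Suc (Suc m)) / q (Suc m)) \<cdot> (p \<otimes> et (Suc m))"
    if mN: "Suc m < N"
  proof -
    let ?F = "e (Suc m)"
    let ?s = "if m = 1 then 2 else 1 :: 'k"
    have F: "?F \<in> carrier R" "et (Suc m) = ?F" using mN m by (auto simp: et_def)
    have Fp: "?F \<otimes> p = p \<otimes> ?F" using A_commute[OF jw_in_A] mN by (simp add: p_def)
    have "?F \<otimes> (p \<otimes> E \<otimes> p) \<otimes> ?F = (?F \<otimes> p) \<otimes> E \<otimes> (p \<otimes> ?F)"
      using c F by (simp add: m_assoc)
    also have "\<dots> = (p \<otimes> ?F) \<otimes> E \<otimes> (?F \<otimes> p)" by (simp only: Fp)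
    also have "\<dots> = p \<otimes> (?F \<otimes> E \<otimes> ?F) \<otimes> p" using c F by (simp add: m_assoc)
    also have "\<dots> = ?s \<cdot> (p \<otimes> (?F \<otimes> p))"
      unfolding E_def et_sandwich[OF m(1) mN] using c F by (simp add: smul_simps)
    also have "p \<otimes> (?F \<otimes> p) = p \<otimes> ?F"
      unfolding Fp using c F s(1) by (metis m_assoc)
    finally have 1: "?F \<otimes> (p \<otimes> E \<otimes> p) \<otimes> ?F = ?s \<cdot> (p \<otimes> ?F)" .
    have "?F \<otimes> p \<otimes> ?F = p \<otimes> (?F \<otimes> ?F)" unfolding Fp using c F by (simp add: m_assoc)
    then have 2: "?F \<otimes> p \<otimes> ?F = \<delta> \<cdot> (p \<otimes> ?F)" using e_square[OF mN] c F by (simp add: smul_simps)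
    have "?F \<otimes> p' \<otimes> ?F = ?F \<otimes> p \<otimes> ?F \<oplus> (- c) \<cdot> (?F \<otimes> (p \<otimes> E \<otimes> p) \<otimes> ?F)"
      unfolding p'_eq using c F by (simp add: smul_simps)
    also have "\<dots> = (\<delta> - c * ?s) \<cdot> (p \<otimes> ?F)"
      unfolding 1 2 using c F smul_add_left[of "p \<otimes> ?F" \<delta> "- (c * ?s)"] by (simp add: smul_smul)
    \<comment> \<open>The two cases are \<open>q_3\<close>, with its coefficient 2, and the generic
      recursion \<open>q_rec\<close>.\<close>
    also have "\<delta> - c * ?s = q (Suc (Suc m)) / q (Suc m)"
    proof (cases "m = 1")
      case True
      then show ?thesis using q_3 qnz by (simp add: c_def numeral_2_eq_2 numeral_3_eq_3 field_simps)
    next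
      case False
      then show ?thesis using q_rec[of m] m qnz by (simp add: c_def field_simps)
    qed
    finally show ?thesis unfolding F(2) .
  qed
  then show ?case
    using gens st(3-5) unfolding jw_spec_def by (simp add: p'_def p_def)
qed


text \<open>Every nonempty word in the generators kills \<open>w\<close>, so \<open>A m\<close> acts
  on \<open>w\<close> through scalars.\<close>

lemma right_annihilated:
  assumes "w \<in> carrier R" "m \<le> N" "\<And>i. i \<in> G m \<Longrightarrow> w \<otimes> e i = \<zero>" and "a \<in> A m"
  shows "\<exists>c. w \<otimes> a = c \<cdot> w"
  using assms(4)
proof (induction rule: alg.induct)
  case one
  show ?case using assms(1) by (intro exI[of _ 1]) simp
next
  case (gen i)
  show ?case using assms(1,3) gen by (intro exI[of _ 0]) simp
next
  case (add x y)
  then have "x \<in> carrier R" "y \<in> carrier R" using A_closed assms(2) by auto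
  then show ?case using add assms(1) by (metis r_distr smul_add_left)
next
  case (mult x y)
  have xy: "x \<in> carrier R" "y \<in> carrier R" using mult A_closed assms(2) by auto
  obtain c d where "w \<otimes> x = c \<cdot> w" "w \<otimes> y = d \<cdot> w" using mult by blast
  then have "w \<otimes> (x \<otimes> y) = (c * d) \<cdot> w"
    using xy assms(1) mult_assoc_eq[of w x "c \<cdot> w" y] by (simp add: smul_simps)
  then show ?case by blast
next
  case (smul x c)
  then have "x \<in> carrier R" using A_closed assms(2) by auto
  then show ?case using smul assms(1) by (metis smul_mult_right smul_smul)
qed

lemma left_annihilated:
  assumes "w \<in> carrier R" "m \<le> N" "\<And>i. i \<in> G m \<Longrightarrow> e i \<otimes> w = \<zero>" and "a \<in> A m"
  shows "\<exists>c. a \<otimes> w = c \<cdot> w"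
  using assms(4)
proof (induction rule: alg.induct)
  case one
  show ?case using assms(1) by (intro exI[of _ 1]) simp
next
  case (gen i)
  show ?case using assms(1,3) gen by (intro exI[of _ 0]) simp
next
  case (add x y)
  then have "x \<in> carrier R" "y \<in> carrier R" using A_closed assms(2) by auto
  then show ?case using add assms(1) by (metis l_distr smul_add_left)
next
  case (mult x y)
  have xy: "x \<in> carrier R" "y \<in> carrier R" using mult A_closed assms(2) by auto
  obtain c d where "x \<otimes> w = c \<cdot> w" "y \<otimes> w = d \<cdot> w" using mult by blast
  then have "(x \<otimes> y) \<otimes> w = (d * c) \<cdot> w"
    using xy assms(1) by (simp add: m_assoc smul_mult_right smul_smul)
  then show ?case by blast
next
  case (smul x c)
  then have "x \<in> carrier R" using A_closed assms(2) by auto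
  then show ?case using smul assms(1) by (metis smul_mult_left smul_smul)
qed

subsection \<open>Corners\<close>

text \<open>For \<open>0 < k\<close> and \<open>2 * k \<le> N\<close> the factors commute with each
  other, and the lowest index is \<open>N - 2 * k + 1\<close>, far enough from
  \<open>A (N - 2 * k)\<close> to commute with it.\<close>

primrec F :: "nat \<Rightarrow> 'a" where
  "F 0 = \<one>"
| "F (Suc k) = F k \<otimes> e (N - 2 * k - 1)"

lemma e_in_A: "i < m \<Longrightarrow> 2 \<le> m \<Longrightarrow> e i \<in> A m"
  by (auto simp: G_def intro: alg.gen)

lemma F_closed [simp]: "F k \<in> carrier R"
  using N3 by (induction k) auto

lemma F_commute: "2 * k \<le> N \<Longrightarrow> x \<in> A (N - 2 * k) \<Longrightarrow> F k \<otimes> x = x \<otimes> F k"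
proof (induction k)
  case 0
  then show ?case using A_closed[of x N] by simp
next
  case (Suc k)
  let ?e = "e (N - 2 * k - 1)"
  have x: "x \<in> carrier R" "x \<in> A (N - 2 * k)" "?e \<in> carrier R"
    using Suc.prems A_closed[OF Suc.prems(2)] A_mono[OF Suc.prems(2), of "N - 2 * k"] N3 by auto
  have "?e \<otimes> x = x \<otimes> ?e" using Suc.prems by (intro A_commute[of x "N - 2 * Suc k"]) auto
  moreover have "F k \<otimes> x = x \<otimes> F k" using Suc x by auto
  ultimately show ?case using x by (simp add: m_assoc) (metis F_closed m_assoc)
qed

lemma F_e_commute:
  assumes "2 * Suc k \<le> N"
  shows "F k \<otimes> e (N - 2 * k - 1) = e (N - 2 * k - 1) \<otimes> F k"
  using assms by (intro F_commute e_in_A) auto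

text \<open>A repeated factor can be moved next to its twin and squared, at the cost of
  \<open>\<delta>\<close>.\<close>

lemma F_absorb:
  "2 * k < N \<Longrightarrow> j < k \<Longrightarrow> e (N - 2 * j - 1) \<otimes> F k = \<delta> \<cdot> F k \<and> F k \<otimes> e (N - 2 * j - 1) = \<delta> \<cdot> F k"
proof (induction k)
  case (Suc k)
  let ?e = "e (N - 2 * k - 1)" and ?f = "e (N - 2 * j - 1)"
  have ef: "?e \<in> carrier R" "?f \<in> carrier R" using N3 by auto
  show ?case
  proof (cases "j = k")
    case True
    have "?e \<otimes> ?e = \<delta> \<cdot> ?e" using N3 by (intro e_square) auto
    moreover have "?e \<otimes> F k = F k \<otimes> ?e" using F_e_commute Suc.prems by auto
    ultimately show ?thesis using True ef mult_assoc_eq[of ?e "F k" "F k \<otimes> ?e" ?e]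
      by (simp add: m_assoc smul_mult_right)
  next
    case False
    then have jk: "j < k" using Suc.prems by auto
    have "?f \<otimes> ?e = ?e \<otimes> ?f"
      using Suc.prems jk by (intro A_commute[of _ "N - 2 * k"] e_in_A) auto
    moreover have "?f \<otimes> F k = \<delta> \<cdot> F k" "F k \<otimes> ?f = \<delta> \<cdot> F k" using Suc jk by auto
    ultimately show ?thesis using ef mult_assoc_eq[of ?f "F k" _ ?e] mult_assoc_eq[of "F k" ?f _ ?e]
      by (simp add: m_assoc smul_mult_left)
  qed
qed auto

lemma F_absorb_power:
  assumes "u \<in> carrier R" "\<And>i. i < j \<Longrightarrow> e (N - 2 * i - 1) \<otimes> u = \<delta> \<cdot> u" "2 * j < N"
  shows "F j \<otimes> u = \<delta> ^ j \<cdot> u"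
  using assms(2,3)
proof (induction j)
  case (Suc j)
  have "e (N - 2 * j - 1) \<in> carrier R" using N3 by auto
  then show ?case using Suc assms(1) by (simp add: m_assoc smul_mult_right smul_smul)
qed (use assms(1) in simp)

lemma absorb_F_power:
  assumes "u \<in> carrier R" "\<And>i. i < j \<Longrightarrow> u \<otimes> e (N - 2 * i - 1) = \<delta> \<cdot> u" "2 * j < N"
  shows "u \<otimes> F j = \<delta> ^ j \<cdot> u"
  using assms(2,3)
proof (induction j)
  case (Suc j)
  have "e (N - 2 * j - 1) \<in> carrier R" using N3 by auto
  then show ?case using Suc assms(1) mult_assoc_eq[of u "F j" _ "e (N - 2 * j - 1)"]
    by (simp add: smul_mult_left smul_smul mult.commute)
qed (use assms(1) in simp)

end

locale generated_ftl_algebra = ftl_algebra +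
  assumes generated: "carrier R \<subseteq> A N"
begin

text \<open>Passing from \<open>F k\<close> to \<open>F (Suc k)\<close> sandwiches the corner once
  more, with a generator that commutes with \<open>F k\<close>, and \<open>corner\<close> then
  removes two more vertices.\<close>

lemma F_corner:
  "2 * k < N \<Longrightarrow> r \<in> carrier R \<Longrightarrow> \<exists>a\<in>A (N - 2 * k). F k \<otimes> r \<otimes> F k = a \<otimes> F k"
proof (induction k)
  case 0
  then show ?case using generated by (auto intro!: bexI[of _ r])
next
  case (Suc k)
  define n where "n = N - 2 * Suc k"
  let ?e = "e (Suc n)"
  have n: "1 \<le> n" "N - 2 * k = Suc (Suc n)" "N - 2 * k - 1 = Suc n" "Suc n < N"
    using Suc.prems by (auto simp: n_def)
  have e: "?e \<in> carrier R" using n by auto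
  have Fe: "F k \<otimes> ?e = ?e \<otimes> F k" using F_e_commute[of k] Suc.prems n by auto
  obtain a where a: "a \<in> A (Suc (Suc n))" "F k \<otimes> r \<otimes> F k = a \<otimes> F k"
    using Suc n by auto
  obtain y where y: "y \<in> A n" "?e \<otimes> a \<otimes> ?e = y \<otimes> ?e" using corner[OF n(1,4) a(1)] by blast
  have c: "a \<in> carrier R" "y \<in> carrier R" using a y n A_closed by auto
  have "F (Suc k) \<otimes> r \<otimes> F (Suc k) = ?e \<otimes> (F k \<otimes> r \<otimes> F k) \<otimes> ?e"
    using n Fe e Suc.prems by (simp add: m_assoc)
  also have "\<dots> = (?e \<otimes> a) \<otimes> (F k \<otimes> ?e)" unfolding a(2) using e c by (simp add: m_assoc)
  also have "\<dots> = (?e \<otimes> a \<otimes> ?e) \<otimes> F k" unfolding Fe using e c by (simp add: m_assoc)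
  also have "\<dots> = y \<otimes> (?e \<otimes> F k)" unfolding y(2) using e c by (simp add: m_assoc)
  also have "?e \<otimes> F k = F (Suc k)" using n Fe by simp
  finally show ?case using y n_def by blast
qed

text \<open>In the middle stands \<open>F k \<otimes> r \<otimes> F k = a \<otimes> F k\<close>. As
  the generators kill \<open>w\<close>, the product \<open>w \<otimes> a\<close> is a multiple of
  \<open>w\<close>, and a factor \<open>w \<otimes> w\<close> remains.\<close>

lemma corner_nilpotent:
  assumes k: "2 * k < N" and w: "w \<in> A (N - 2 * k)" "w \<otimes> w = \<zero>"
    and ann: "\<And>i. i \<in> G (N - 2 * k) \<Longrightarrow> w \<otimes> e i = \<zero>" and r: "r \<in> carrier R"
  shows "(w \<otimes> F k) \<otimes> r \<otimes> (w \<otimes> F k) = \<zero>"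
proof -
  have wc: "w \<in> carrier R" using w k A_closed by auto
  obtain a where a: "a \<in> A (N - 2 * k)" "F k \<otimes> r \<otimes> F k = a \<otimes> F k" using F_corner k r by blast
  have ac: "a \<in> carrier R" using a k A_closed by auto
  obtain c where c: "w \<otimes> a = c \<cdot> w" using right_annihilated[OF wc _ ann a(1)] by auto
  have Fw: "F k \<otimes> w = w \<otimes> F k" using F_commute w k by auto
  have "(w \<otimes> F k) \<otimes> r \<otimes> (w \<otimes> F k) = (w \<otimes> F k) \<otimes> r \<otimes> (F k \<otimes> w)" unfolding Fw ..
  also have "\<dots> = w \<otimes> (F k \<otimes> r \<otimes> F k) \<otimes> w" using wc r by (simp add: m_assoc)
  also have "\<dots> = (w \<otimes> a) \<otimes> (F k \<otimes> w)" unfolding a(2) using wc ac by (simp add: m_assoc)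
  also have "\<dots> = c \<cdot> ((w \<otimes> w) \<otimes> F k)" unfolding c Fw using wc by (simp add: m_assoc smul_mult_left)
  finally show ?thesis using w by simp
qed

subsection \<open>The semisimple case\<close>

text \<open>The index 2 occurs among the \<open>N - 2 * k\<close> only for even \<open>N\<close>.
  There the two leaves give two further orthogonal elements besides \<open>jw 2\<close>.\<close>

definition W :: "nat \<Rightarrow> 'a set" where
  "W m = insert (jw m) (if m = 2 then {e 0, e 1} else {})"

lemma W_in_A: "g \<in> W m \<Longrightarrow> g \<in> A m"
  using jw_in_A e_in_A by (auto simp: W_def split: if_splits)

lemma W_scalar:
  assumes "jw_spec m" "m \<le> N" "g \<in> W m" "a \<in> A m"
  shows "\<exists>c. g \<otimes> a = c \<cdot> g"
proof (cases "g = jw m")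
  case True
  then show ?thesis using right_annihilated[of "jw m" m a] assms by (auto simp: jw_spec_def)
next
  case False
  then have m: "m = 2" "g = e 0 \<or> g = e 1" using assms by (auto simp: W_def split: if_splits)
  then obtain s b c where a: "a = s \<cdot> \<one> \<oplus> b \<cdot> e 0 \<oplus> c \<cdot> e 1" using A_2 assms by metis
  have "e 0 \<otimes> a = (s + b * \<delta>) \<cdot> e 0" "e 1 \<otimes> a = (s + c * \<delta>) \<cdot> e 1"
    using a e_01 e_10 e_square[of 0] e_square[of 1] N3 by (simp_all add: smul_simps)
  then show ?thesis using m by blast
qed

lemma W_orthogonal:
  assumes "jw_spec m" "m \<le> N" "g \<in> W m" "h \<in> W m" "g \<noteq> h"
  shows "g \<otimes> h = \<zero>"
proof -
  have "m = 2" using assms by (auto simp: W_def split: if_splits)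
  then show ?thesis
    using assms e_01 e_10 by (auto simp: W_def jw_spec_def G_def)
qed

text \<open>\<open>U\<close> meets the hypotheses of
  \<open>semisimple_ring_if_orthogonal_full\<close>: \<open>level\<close> treats equal
  \<open>k\<close>, \<open>cross\<close> treats different \<open>k\<close>, and a downward induction
  through \<open>reduce\<close> shows that \<open>U\<close> generates the unit ideal.\<close>

lemma semisimple_if_nonzero:
  assumes q: "\<And>t. 2 \<le> t \<Longrightarrow> t \<le> N \<Longrightarrow> q t \<noteq> 0"
  shows "semisimple_ring R"
proof -
  have spec: "jw_spec m" if "1 \<le> m" "m \<le> N" for m
    using that q by (intro jw_props) auto
  have specN: "jw_spec (N - 2 * k)" if "2 * k < N" for k
    using that by (intro spec) simp_all
  define U where "U = {g \<otimes> F k | g k. 2 * k < N \<and> g \<in> W (N - 2 * k)}"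
  have same: "(g \<otimes> F k) \<otimes> r \<otimes> (h \<otimes> F k) = c \<cdot> ((g \<otimes> h) \<otimes> F k)" if "g \<otimes> a = c \<cdot> g"
    and "F k \<otimes> r \<otimes> F k = a \<otimes> F k" and "g \<in> carrier R" "h \<in> carrier R" "a \<in> carrier R" "r \<in> carrier R"
    and "F k \<otimes> h = h \<otimes> F k" for g h a r c k
  proof -
    have "(g \<otimes> F k) \<otimes> r \<otimes> (h \<otimes> F k) = (g \<otimes> F k) \<otimes> r \<otimes> (F k \<otimes> h)"
      unfolding that(7) ..
    also have "\<dots> = g \<otimes> (F k \<otimes> r \<otimes> F k) \<otimes> h"
      using that(3-6) by (simp add: m_assoc)
    also have "\<dots> = (g \<otimes> a) \<otimes> (F k \<otimes> h)" unfolding that(2) using that(3-6) by (simp add: m_assoc)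
    also have "\<dots> = c \<cdot> ((g \<otimes> h) \<otimes> F k)"
      unfolding that(1,7) using that(3-6) by (simp add: m_assoc smul_mult_left)
    finally show ?thesis .
  qed
  have level: "\<exists>c. (g \<otimes> F k) \<otimes> r \<otimes> (h \<otimes> F k) = c \<cdot> ((g \<otimes> h) \<otimes> F k)"
    if k: "2 * k < N" and gh: "g \<in> W (N - 2 * k)" "h \<in> W (N - 2 * k)" and r: "r \<in> carrier R" for g h k r
  proof -
    obtain a where a: "a \<in> A (N - 2 * k)" "F k \<otimes> r \<otimes> F k = a \<otimes> F k" using F_corner k r by blast
    obtain c where c: "g \<otimes> a = c \<cdot> g"
      using W_scalar[OF specN[OF k] _ gh(1) a(1)] by auto
    have "g \<in> carrier R" "h \<in> carrier R" "a \<in> carrier R"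
      using A_closed[OF W_in_A[OF gh(1)]] A_closed[OF W_in_A[OF gh(2)]] A_closed[OF a(1)] by simp_all
    moreover have "F k \<otimes> h = h \<otimes> F k" using F_commute[OF _ W_in_A[OF gh(2)]] k by simp
    ultimately show ?thesis using same[OF c a(2)] r by blast
  qed
  have Wc: "g \<in> carrier R" if "g \<in> W (N - 2 * k)" for g k
    using W_in_A[OF that] A_closed by auto
  \<comment> \<open>For \<open>j < k\<close> this generator commutes with \<open>h\<close> and is
    absorbed by \<open>F k\<close>.\<close>
  have absorb: "e (N - 2 * j - 1) \<otimes> v = \<delta> \<cdot> v \<and> v \<otimes> e (N - 2 * j - 1) = \<delta> \<cdot> v"
    if "j < k" "2 * k < N" "h \<in> W (N - 2 * k)" "v = h \<otimes> F k" for j k h v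
  proof -
    let ?e = "e (N - 2 * j - 1)"
    have e: "?e \<in> carrier R" "h \<in> carrier R" using N3 Wc that by auto
    have "?e \<otimes> h = h \<otimes> ?e" using A_commute[OF W_in_A[OF that(3)]] that by auto
    then show ?thesis
      using F_absorb[OF that(2,1)] that(4) e mult_assoc_eq[of ?e h "h \<otimes> ?e" "F k"]
      by (simp add: m_assoc smul_mult_right)
  qed
  \<comment> \<open>The top generator of \<open>A (N - 2 * j)\<close> is killed by the projection
    \<open>jw (N - 2 * j)\<close> but acts on \<open>v\<close> as the invertible scalar
    \<open>\<delta>\<close>, so the projection and \<open>v\<close> are orthogonal. If
    \<open>r\<close> stands in between, \<open>v\<close> is replaced by a multiple of its product
    with \<open>F j\<close>, which moves \<open>r\<close> into the corner of
    \<open>F j\<close>.\<close>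
  have cross: "(jw (N - 2 * j) \<otimes> F j) \<otimes> r \<otimes> v = \<zero> \<and> v \<otimes> r \<otimes> (jw (N - 2 * j) \<otimes> F j) = \<zero>"
    if jk: "j < k" "2 * k < N" and h: "h \<in> W (N - 2 * k)" "v = h \<otimes> F k" and r: "r \<in> carrier R" for j k h v r
  proof -
    let ?g = "jw (N - 2 * j)" and ?e = "e (N - 2 * j - 1)"
    have c: "?g \<in> carrier R" "v \<in> carrier R" "?e \<in> carrier R" using N3 h Wc by auto
    have ab: "?e \<otimes> v = \<delta> \<cdot> v" "v \<otimes> ?e = \<delta> \<cdot> v" using absorb[OF jk h] by auto
    have sp: "jw_spec (N - 2 * j)" using specN jk by simp
    have i: "N - 2 * j - 1 \<in> G (N - 2 * j)" using jk by (auto simp: G_def)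
    have "\<delta> \<cdot> (?g \<otimes> v) = ?g \<otimes> (?e \<otimes> v)" "\<delta> \<cdot> (v \<otimes> ?g) = (v \<otimes> ?e) \<otimes> ?g"
      unfolding ab using c by (simp_all add: smul_mult_left smul_mult_right)
    then have "\<delta> \<cdot> (?g \<otimes> v) = (?g \<otimes> ?e) \<otimes> v" "\<delta> \<cdot> (v \<otimes> ?g) = v \<otimes> (?e \<otimes> ?g)"
      using c by (simp_all add: m_assoc)
    then have "\<delta> \<cdot> (?g \<otimes> v) = \<zero>" "\<delta> \<cdot> (v \<otimes> ?g) = \<zero>"
      using sp i c by (simp_all add: jw_spec_def)
    then have gv: "?g \<otimes> v = \<zero>" "v \<otimes> ?g = \<zero>"
      using c by (auto intro: smul_eq_zero[OF _ \<delta>_nz])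
    have jN: "2 * j < N" using jk by auto
    obtain a where a: "a \<in> A (N - 2 * j)" "F j \<otimes> r \<otimes> F j = a \<otimes> F j" using F_corner jN r by blast
    have ac: "a \<in> carrier R" using a A_closed by auto
    have Fa: "F j \<otimes> a = a \<otimes> F j" "F j \<otimes> ?g = ?g \<otimes> F j"
      using F_commute a(1) jw_in_A jN by auto
    obtain s where s: "?g \<otimes> a = s \<cdot> ?g"
      using right_annihilated[of ?g "N - 2 * j" a] sp a c by (auto simp: jw_spec_def)
    obtain s' where s': "a \<otimes> ?g = s' \<cdot> ?g"
      using left_annihilated[of ?g "N - 2 * j" a] sp a c by (auto simp: jw_spec_def)
    have Fv: "F j \<otimes> v = \<delta> ^ j \<cdot> v" "v \<otimes> F j = \<delta> ^ j \<cdot> v"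
      using F_absorb_power[of v j] absorb_F_power[of v j] c absorb[OF _ jk(2) h] jk jN by auto
    have "\<delta> ^ j \<cdot> ((?g \<otimes> F j) \<otimes> r \<otimes> v) = ?g \<otimes> (F j \<otimes> r \<otimes> (F j \<otimes> v))"
      unfolding Fv using c r by (simp add: smul_mult_right m_assoc)
    also have "\<dots> = ?g \<otimes> (F j \<otimes> r \<otimes> F j) \<otimes> v" using c r by (simp add: m_assoc)
    also have "\<dots> = (?g \<otimes> a) \<otimes> (F j \<otimes> v)" unfolding a(2) using c ac by (simp add: m_assoc)
    also have "\<dots> = \<zero>" unfolding s Fv using c gv by (simp add: smul_mult_left smul_mult_right)
    finally have 1: "(?g \<otimes> F j) \<otimes> r \<otimes> v = \<zero>"
      using c r \<delta>_nz by (auto intro: smul_eq_zero[of _ "\<delta> ^ j"])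
    have "\<delta> ^ j \<cdot> (v \<otimes> r \<otimes> (?g \<otimes> F j)) = (v \<otimes> F j) \<otimes> r \<otimes> (F j \<otimes> ?g)"
      unfolding Fv Fa(2) using c r by (simp add: smul_mult_left m_assoc)
    also have "\<dots> = v \<otimes> (F j \<otimes> r \<otimes> F j) \<otimes> ?g" using c r by (simp add: m_assoc)
    also have "\<dots> = (v \<otimes> F j) \<otimes> (a \<otimes> ?g)" unfolding a(2) Fa(1)[symmetric] using c ac by (simp add: m_assoc)
    also have "\<dots> = \<zero>" unfolding s' Fv using c gv by (simp add: smul_mult_left smul_mult_right)
    finally have 2: "v \<otimes> r \<otimes> (?g \<otimes> F j) = \<zero>"
      using c r \<delta>_nz by (auto intro: smul_eq_zero[of _ "\<delta> ^ j"])
    show ?thesis using 1 2 by blast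
  qed
  \<comment> \<open>Before the last level \<open>N - 2 * j\<close> exceeds 2, so \<open>W\<close>
    contains no leaves there.\<close>
  have Wjw: "g = jw (N - 2 * j)" if "j < k" "2 * k < N" "g \<in> W (N - 2 * j)" for g j k
    using that by (auto simp: W_def split: if_splits)
  show ?thesis
  proof (rule semisimple_ring_if_orthogonal_full[of U])
    show "U \<subseteq> carrier R" using Wc by (auto simp: U_def)
    show "u \<otimes> r \<otimes> v = \<zero>" if uv: "u \<in> U" "v \<in> U" "u \<noteq> v" and r: "r \<in> carrier R" for u v r
    proof -
      obtain g j where u: "2 * j < N" "g \<in> W (N - 2 * j)" "u = g \<otimes> F j" using uv by (auto simp: U_def)
      obtain h k where v: "2 * k < N" "h \<in> W (N - 2 * k)" "v = h \<otimes> F k" using uv by (auto simp: U_def)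
      consider "j < k" | "k < j" | "j = k" by linarith
      then show ?thesis
      proof cases
        case 1
        then show ?thesis using cross[OF 1 v r] Wjw[OF 1 v(1) u(2)] u by simp
      next
        case 2
        then show ?thesis using cross[OF 2 u r] Wjw[OF 2 u(1) v(2)] v by simp
      next
        case 3
        then have "g \<noteq> h" using uv u v by auto
        then have "g \<otimes> h = \<zero>" using W_orthogonal[OF specN[OF u(1)] _ u(2)] v(2) 3 by simp
        then show ?thesis using level[OF v(1) _ v(2) r] u v 3 by fastforce
      qed
    qed
    show "\<exists>s\<in>carrier R. s \<otimes> (u \<otimes> r \<otimes> u) = u"
      if u: "u \<in> U" and r: "r \<in> carrier R" and nz: "u \<otimes> r \<otimes> u \<noteq> \<zero>" for u r
    proof -
      obtain g k where g: "2 * k < N" "g \<in> W (N - 2 * k)" "u = g \<otimes> F k" using u by (auto simp: U_def)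
      have gc: "g \<in> carrier R" using Wc g by auto
      obtain c where c: "u \<otimes> r \<otimes> u = c \<cdot> ((g \<otimes> g) \<otimes> F k)" using level[OF g(1,2,2) r] g(3) by auto
      obtain d where d: "g \<otimes> g = d \<cdot> g" using W_scalar[OF specN[OF g(1)] _ g(2) W_in_A[OF g(2)]] by auto
      have "u \<otimes> r \<otimes> u = (c * d) \<cdot> (g \<otimes> F k)" unfolding c d using gc by (simp add: smul_mult_left smul_smul)
      then have "u \<otimes> r \<otimes> u = (c * d) \<cdot> u" unfolding g(3) .
      moreover from this nz have "c * d \<noteq> 0" using gc g(3) by auto
      then obtain t where "t * (c * d) = 1" by (metis left_inverse)
      ultimately have "(t \<cdot> \<one>) \<otimes> (u \<otimes> r \<otimes> u) = u"
        using gc g(3) by (simp add: smul_mult_left smul_smul)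
      then show ?thesis by blast
    qed
    fix J assume J: "ideal J R" "U \<subseteq> J"
    interpret J: ideal J R by (rule J)
    have Jsm: "c \<cdot> x \<in> J" if "x \<in> J" for c x
      using J.I_l_closed[OF that, of "c \<cdot> \<one>"] J.a_subset that by (auto simp: smul_mult_left)
    \<comment> \<open>Every correction term of the recursion contains some \<open>et m\<close>, so
      modulo \<open>J\<close> multiplication by the projection does not change \<open>F k\<close>;
      and \<open>jw (N - 2 * k) \<otimes> F k\<close> belongs to \<open>U\<close>.\<close>
    have reduce: "F k \<in> J" if k: "2 * k < N" and gens: "\<And>i. i \<in> G (N - 2 * k) \<Longrightarrow> e i \<otimes> F k \<in> J" for k
    proof -
      have "F k \<oplus> (- 1) \<cdot> (jw m \<otimes> F k) \<in> J" if "m \<le> N - 2 * k" for m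
        using that
      proof (induction m)
        case 0
        show ?case by (simp add: smul_neg_cancel)
      next
        case (Suc m)
        show ?case
        proof (cases "m = 0")
          case True
          then show ?thesis by (simp add: smul_neg_cancel)
        next
          case False
          have mN: "m \<le> N" "m < N" using Suc.prems by auto
          have et: "et m \<in> carrier R" "et m \<otimes> F k \<in> J"
            using et_closed[of m] False mN gens Suc.prems N3
            by (auto simp: et_def G_def l_distr split: if_splits)
          have jwF: "jw m \<otimes> F k = F k \<otimes> jw m"
            using F_commute[of k "jw m"] jw_in_A A_mono[OF jw_in_A, of m] Suc.prems k by auto
          have "jw m \<otimes> et m \<otimes> jw m \<otimes> F k = jw m \<otimes> (et m \<otimes> F k) \<otimes> jw m"
            using jwF et mN by (simp add: m_assoc)
          then have J1: "jw m \<otimes> et m \<otimes> jw m \<otimes> F k \<in> J"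
            using et mN by (simp add: J.I_l_closed J.I_r_closed)
          let ?c = "q m / q (Suc m)" and ?z = "jw m \<otimes> et m \<otimes> jw m \<otimes> F k"
          have "F k \<oplus> (- 1) \<cdot> (jw (Suc m) \<otimes> F k) = (F k \<oplus> (- 1) \<cdot> (jw m \<otimes> F k)) \<oplus> ?c \<cdot> ?z"
            using False et mN by (simp add: jw.simps(2) l_distr smul_mult_left smul_add_right smul_smul a_assoc)
          then show ?thesis using Suc J1 Jsm by simp
        qed
      qed
      from this[of "N - 2 * k"] have 1: "F k \<oplus> (- 1) \<cdot> (jw (N - 2 * k) \<otimes> F k) \<in> J" by simp
      have 2: "jw (N - 2 * k) \<otimes> F k \<in> J" using J(2) k unfolding U_def W_def by blast
      have "F k = (F k \<oplus> (- 1) \<cdot> (jw (N - 2 * k) \<otimes> F k)) \<oplus> jw (N - 2 * k) \<otimes> F k"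
        using smul_neg_cancel[of "jw (N - 2 * k) \<otimes> F k"]
          a_comm[of "(- 1) \<cdot> (jw (N - 2 * k) \<otimes> F k)" "jw (N - 2 * k) \<otimes> F k"]
        by (simp add: a_assoc)
      then show ?thesis using 1 2 by (metis J.a_closed)
    qed
    \<comment> \<open>Downward from the largest \<open>k\<close> with \<open>2 * k < N\<close>,
      where \<open>N - 2 * k\<close> is 1 or 2 and the generators still required lie in
      \<open>W\<close>. In the step, \<open>F (Suc k)\<close> is \<open>F k\<close> times the top
      generator \<open>e m\<close>.\<close>
    have "F k \<in> J" if "k \<le> (N - 1) div 2" for k
      using that
    proof (induction k rule: inc_induct)
      case base
      let ?k = "(N - 1) div 2"
      have k: "2 * ?k < N" "N - 2 * ?k = 1 \<or> N - 2 * ?k = 2" using N3 by auto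
      have "e i \<otimes> F ?k \<in> J" if "i \<in> G (N - 2 * ?k)" for i
      proof -
        have "N - 2 * ?k = 2 \<and> (i = 0 \<or> i = 1)" using that k(2) by (auto simp: G_def)
        then have "e i \<in> W (N - 2 * ?k)" by (auto simp: W_def)
        then have "e i \<otimes> F ?k \<in> U" using k(1) unfolding U_def by blast
        then show ?thesis using J(2) by blast
      qed
      then show ?case using reduce k(1) by blast
    next
      case (step k)
      then have k: "2 * Suc k < N" by auto
      define m where "m = N - 2 * k - 1"
      have m: "2 \<le> m" "m < N" "N - 2 * k = Suc m" using k by (auto simp: m_def)
      have Fe: "F k \<otimes> e i = e i \<otimes> F k" if "i \<le> m" for i
        using that m k by (intro F_commute e_in_A) auto
      have top: "e m \<otimes> F k \<in> J" using step(3) Fe[of m] by (simp add: m_def)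
      \<comment> \<open>Membership spreads along the edges of the graph, since \<open>e i\<close> is
        recovered by sandwiching its neighbour: first from \<open>m\<close> down to 1, then from 2
        to the leaf 0.\<close>
      have conj: "e i \<otimes> F k \<in> J" if "e i \<otimes> e j \<otimes> e i = e i" "e j \<otimes> F k \<in> J" "i \<le> m" "j \<le> m" for i j
      proof -
        have c: "e i \<in> carrier R" "e j \<in> carrier R" using that m by auto
        have "e i \<otimes> F k = e i \<otimes> e j \<otimes> (e i \<otimes> F k)" using that(1) c by (metis F_closed m_assoc m_closed)
        also have "\<dots> = e i \<otimes> (e j \<otimes> F k) \<otimes> e i"
          unfolding Fe[OF that(3), symmetric] using c by (simp add: m_assoc)
        finally show ?thesis using that(2) c by (simp add: J.I_l_closed J.I_r_closed)
      qed
      have pos: "e i \<otimes> F k \<in> J" if "i \<le> m" "1 \<le> i" for i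
        using that
      proof (induction i rule: inc_induct)
        case (step i)
        then show ?case using conj[of i "Suc i"] e_up[of i] m by auto
      qed (use top in simp)
      have "e i \<otimes> F k \<in> J" if "i \<in> G (N - 2 * k)" for i
      proof (cases "i = 0")
        case True
        then show ?thesis using conj[of 0 2] e_020 pos[of 2] m by auto
      next
        case False
        then show ?thesis using pos that m by (auto simp: G_def)
      qed
      then show ?case using reduce k by auto
    qed
    from this[of 0] show "\<one> \<in> J" by simp
  qed
qed

end

section \<open>A representation on walks in the binary tree\<close>

text \<open>Vertices of the tree are lists, with the root \<open>[]\<close>, and \<open>child_weight d y\<close> is the weight of the step
  from \<open>tl y\<close> to \<open>y\<close>; the step back has weight \<open>1 / child_weight d y\<close>. The weights of the two children of a
  vertex are nonzero and chosen such that the weights of all steps leaving it add up to \<open>d\<close>.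
  The two steps from the root have equal weight, which makes the product of \<open>e\<^sub>1\<close> with its conjugate
  under \<open>flip\<close> below vanish; this conjugate represents the generator of the vertex \<open>1\<close> with a bar.\<close>

fun child_weight :: "'k::field \<Rightarrow> bool list \<Rightarrow> 'k" where
  "child_weight d [] = 1"
| "child_weight d [b] = d / 2"
| "child_weight d (b # c # x) = (let s = d - 1 / child_weight d (c # x) in
     if s = 1 then (if b then - 1 else 2) else (if b then 1 else s - 1))"

definition nbrs :: "bool list \<Rightarrow> bool list set" where
  "nbrs x = {True # x, False # x} \<union> (if x = [] then {} else {tl x})"

definition step_weight :: "'k::field \<Rightarrow> bool list \<Rightarrow> bool list \<Rightarrow> 'k" where
  "step_weight d x y = (if y \<noteq> [] \<and> tl y = x then child_weight d y else 1 / child_weight d x)"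

lemma finite_nbrs [simp]: "finite (nbrs x)"
  by (simp add: nbrs_def)

lemma nbrs_sym: "y \<in> nbrs x \<Longrightarrow> x \<in> nbrs y"
  by (cases x; cases y) (auto simp: nbrs_def split: if_splits)

text \<open>Beyond the root the two children share \<open>s\<close>. The split into \<open>1\<close>
  and \<open>s - 1\<close> degenerates exactly for \<open>s = 1\<close>, where \<open>- 1\<close>
  and \<open>2\<close> are taken instead; at the root \<open>d / 2\<close> is nonzero because
  \<open>d\<close> is.\<close>

lemma child_weight_nonzero: "d \<noteq> 0 \<Longrightarrow> (2 :: 'k::field) \<noteq> 0 \<Longrightarrow> child_weight d x \<noteq> (0 :: 'k)"
  by (induction d x rule: child_weight.induct) (auto simp: Let_def)

lemma step_weight_inverse:
  assumes "d \<noteq> 0" "(2 :: 'k::field) \<noteq> 0" "y \<in> nbrs x"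
  shows "step_weight d x y * step_weight d y x = (1 :: 'k)"
proof -
  \<comment> \<open>No vertex is its own child or its own grandparent, so of the two steps along an
    edge exactly one leads away from the root.\<close>
  have *: "tl z \<noteq> b # z" "z \<noteq> b # z" for b and z :: "bool list"
  proof -
    have "length (tl z) \<noteq> length (b # z)" by simp
    then show "tl z \<noteq> b # z" by metis
  qed simp
  have "z \<noteq> [] \<Longrightarrow> tl (tl z) \<noteq> z" for z :: "bool list"
  proof
    assume z: "z \<noteq> []" "tl (tl z) = z"
    have "length (tl (tl z)) < length z" using z(1) by (cases z) auto
    then show False unfolding z(2) by simp
  qed
  then show ?thesis
    using assms child_weight_nonzero[of d] * by (auto simp: nbrs_def step_weight_def split: if_splits)
qed

lemma sum_step_weight:
  assumes "(2 :: 'k::field) \<noteq> 0"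
  shows "(\<Sum>y\<in>nbrs x. step_weight d x y) = (d :: 'k)"
proof (cases x)
  case Nil
  have "d / 2 + d / 2 = d" using assms by (simp add: field_simps)
  then show ?thesis using Nil by (simp add: nbrs_def step_weight_def)
next
  case (Cons b y)
  have "length y \<noteq> length (c # b # y)" "length (tl y) \<noteq> length (b # y)" for c by simp_all
  then have ne: "y \<noteq> c # b # y" "tl y \<noteq> b # y" for c by metis+
  have "nbrs x = {True # x, False # x, y}" using Cons by (auto simp: nbrs_def)
  then have "(\<Sum>z\<in>nbrs x. step_weight d x z) = step_weight d x (True # x) + (step_weight d x (False # x) + step_weight d x y)"
    using ne(1)[of True] ne(1)[of False] Cons by simp
  also have "\<dots> = child_weight d (True # x) + (child_weight d (False # x) + 1 / child_weight d x)"
    using ne(2) Cons by (simp add: step_weight_def del: child_weight.simps)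
  also have "\<dots> = d" unfolding Cons by (auto simp: Let_def algebra_simps)
  finally show ?thesis .
qed

section \<open>Temperley-Lieb operators on functions of walks\<close>

definition walk :: "(nat \<Rightarrow> bool list) \<Rightarrow> bool" where
  "walk x \<longleftrightarrow> x 0 = [] \<and> (\<forall>j. x (Suc j) \<in> nbrs (x j))"

lemma walk_upd:
  assumes "walk x" "1 \<le> i" "x (i - 1) = x (i + 1)" "y \<in> nbrs (x (i - 1))"
  shows "walk (x(i := y))"
proof -
  have "(x(i := y)) (Suc j) \<in> nbrs ((x(i := y)) j)" for j
    using assms nbrs_sym[OF assms(4)] by (cases "j = i"; cases "Suc j = i") (auto simp: walk_def)
  then show ?thesis using assms by (auto simp: walk_def)
qed

text \<open>The usual path model. Among walks the value does not depend on \<open>x i\<close>, so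
  together with the total weight \<open>d\<close> the operator satisfies the quadratic relation; the
  reciprocal weights of opposite steps give the relations between neighbours.\<close>

definition walk_op :: "'k::field \<Rightarrow> nat \<Rightarrow> ((nat \<Rightarrow> bool list) \<Rightarrow> 'k) \<Rightarrow> (nat \<Rightarrow> bool list) \<Rightarrow> 'k" where
  "walk_op d i \<phi> x = (if walk x \<and> x (i - 1) = x (i + 1)
     then \<Sum>y\<in>nbrs (x (i - 1)). step_weight d (x (i - 1)) y * \<phi> (x(i := y)) else 0)"

lemma walk_op_eq_0: "\<not> (walk x \<and> x (i - 1) = x (i + 1)) \<Longrightarrow> walk_op d i \<phi> x = 0"
  unfolding walk_op_def by (rule if_not_P)

lemma walk_op_upd:
  assumes "walk x" "1 \<le> i" "x (i - 1) = x (i + 1)" "y \<in> nbrs (x (i - 1))"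
  shows "walk_op d i \<phi> (x(i := y)) = walk_op d i \<phi> x"
  using assms walk_upd[OF assms] by (simp add: walk_op_def)

lemma walk_op_single:
  assumes "walk x" "x (i - 1) = x (i + 1)" "y \<in> nbrs (x (i - 1))"
    and "\<And>z. z \<in> nbrs (x (i - 1)) \<Longrightarrow> z \<noteq> y \<Longrightarrow> \<phi> (x(i := z)) = 0"
  shows "walk_op d i \<phi> x = step_weight d (x (i - 1)) y * \<phi> (x(i := y))"
proof -
  have "walk_op d i \<phi> x = (\<Sum>z\<in>nbrs (x (i - 1)). step_weight d (x (i - 1)) z * \<phi> (x(i := z)))"
    using assms by (simp add: walk_op_def)
  also have "\<dots> = (\<Sum>z\<in>{y}. step_weight d (x (i - 1)) z * \<phi> (x(i := z)))"
    by (rule sum.mono_neutral_right) (use assms in auto)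
  finally show ?thesis by simp
qed

lemma walk_op_vanish:
  assumes "\<And>x. x j \<noteq> c \<Longrightarrow> \<phi> x = 0" "i \<noteq> j" "x j \<noteq> c"
  shows "walk_op d i \<phi> x = 0"
  using assms by (simp add: walk_op_def)

lemma walk_op_add: "walk_op d i (\<lambda>x. \<phi> x + \<psi> x) = (\<lambda>x. walk_op d i \<phi> x + walk_op d i \<psi> x)"
  by (auto simp: walk_op_def fun_eq_iff distrib_left sum.distrib)

lemma walk_op_scale: "walk_op d i (\<lambda>x. c * \<phi> x) = (\<lambda>x. c * walk_op d i \<phi> x)"
  by (auto simp: walk_op_def fun_eq_iff sum_distrib_left mult_ac)

lemma walk_op_square:
  assumes "(2 :: 'k::field) \<noteq> 0" "1 \<le> i"
  shows "walk_op d i (walk_op d i \<phi>) = (\<lambda>x. (d :: 'k) * walk_op d i \<phi> x)"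
proof
  fix x :: "nat \<Rightarrow> bool list"
  show "walk_op d i (walk_op d i \<phi>) x = d * walk_op d i \<phi> x"
  proof (cases "walk x \<and> x (i - 1) = x (i + 1)")
    case True
    then have "walk_op d i (walk_op d i \<phi>) x = (\<Sum>y\<in>nbrs (x (i - 1)). step_weight d (x (i - 1)) y * walk_op d i \<phi> (x(i := y)))"
      by (subst walk_op_def) simp
    also have "\<dots> = (\<Sum>y\<in>nbrs (x (i - 1)). step_weight d (x (i - 1)) y * walk_op d i \<phi> x)"
      using True assms(2) by (intro sum.cong refl) (simp add: walk_op_upd)
    also have "\<dots> = d * walk_op d i \<phi> x"
      by (simp add: sum_distrib_right[symmetric] sum_step_weight[OF assms(1)])
    finally show ?thesis .
  qed (simp add: walk_op_eq_0)
qed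

text \<open>Neither operator changes a position on which the condition or the weights of the other
  depend, so the two sums can be exchanged.\<close>

lemma walk_op_far:
  assumes "1 \<le> i" "i + 2 \<le> j"
  shows "walk_op d i (walk_op d j \<phi>) = walk_op d j (walk_op d i \<phi>)"
proof
  fix x :: "nat \<Rightarrow> bool list"
  have ij: "i \<noteq> j" "Suc i \<noteq> j" "i - 1 \<noteq> j" "j - 1 \<noteq> i" "Suc j \<noteq> i" using assms by auto
  let ?I = "x (i - 1) = x (i + 1)" and ?J = "x (j - 1) = x (j + 1)"
  show "walk_op d i (walk_op d j \<phi>) x = walk_op d j (walk_op d i \<phi>) x"
  proof (cases "walk x \<and> ?I \<and> ?J")
    case True
    have 1: "walk_op d j \<phi> (x(i := y)) =
      (\<Sum>z\<in>nbrs (x (j - 1)). step_weight d (x (j - 1)) z * \<phi> (x(i := y, j := z)))" if "y \<in> nbrs (x (i - 1))" for y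
      using True walk_upd[of x i y] assms ij that by (simp add: walk_op_def)
    have 2: "walk_op d i \<phi> (x(j := z)) =
      (\<Sum>y\<in>nbrs (x (i - 1)). step_weight d (x (i - 1)) y * \<phi> (x(i := y, j := z)))" if "z \<in> nbrs (x (j - 1))" for z
      using True walk_upd[of x j z] assms ij that by (simp add: walk_op_def fun_upd_twist)
    have "walk_op d i (walk_op d j \<phi>) x = (\<Sum>y\<in>nbrs (x (i - 1)). \<Sum>z\<in>nbrs (x (j - 1)).
        step_weight d (x (i - 1)) y * (step_weight d (x (j - 1)) z * \<phi> (x(i := y, j := z))))"
      using True 1 by (subst walk_op_def) (simp add: sum_distrib_left)
    also have "\<dots> = (\<Sum>z\<in>nbrs (x (j - 1)). \<Sum>y\<in>nbrs (x (i - 1)).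
        step_weight d (x (j - 1)) z * (step_weight d (x (i - 1)) y * \<phi> (x(i := y, j := z))))"
      by (subst sum.swap) (simp add: mult_ac)
    also have "walk_op d j (walk_op d i \<phi>) x = (\<Sum>z\<in>nbrs (x (j - 1)). \<Sum>y\<in>nbrs (x (i - 1)).
        step_weight d (x (j - 1)) z * (step_weight d (x (i - 1)) y * \<phi> (x(i := y, j := z))))"
      using True 2 by (subst walk_op_def) (simp add: sum_distrib_left)
    note this[symmetric]
    finally show ?thesis .
  next
    case False
    have "walk_op d i (walk_op d j \<phi>) x = 0" if "walk x" "?I" "\<not> ?J"
      using that ij by (simp add: walk_op_def)
    moreover have "walk_op d j (walk_op d i \<phi>) x = 0" if "walk x" "?J" "\<not> ?I"
      using that ij by (simp add: walk_op_def)
    ultimately show ?thesis using False by (cases "walk x"; cases ?I; cases ?J) (simp_all add: walk_op_eq_0)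
  qed
qed

text \<open>The middle operator requires equal positions \<open>i\<close> and \<open>i + 2\<close>,
  so the outer sum keeps only the term \<open>x (i + 2)\<close>; the inner operator then forces the
  middle sum back to \<open>x (i + 1)\<close>. The two steps are opposite, and their weights
  cancel.\<close>

lemma walk_op_up:
  assumes d: "d \<noteq> 0" "(2 :: 'k::field) \<noteq> 0" and i: "1 \<le> i"
  shows "walk_op d i (walk_op d (Suc i) (walk_op d i \<phi>)) = (walk_op d i \<phi> :: _ \<Rightarrow> 'k)"
proof
  fix x :: "nat \<Rightarrow> bool list"
  show "walk_op d i (walk_op d (Suc i) (walk_op d i \<phi>)) x = walk_op d i \<phi> x"
  proof (cases "walk x \<and> x (i - 1) = x (i + 1)")
    case True
    have ni: "i - 1 \<noteq> i" "i - 1 \<noteq> Suc i" using i by auto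
    let ?a = "x (i + 1)" and ?b = "x (Suc (Suc i))"
    have b: "?b \<in> nbrs ?a" using True by (simp add: walk_def)
    have w: "walk (x(i := ?b))" using True b i by (intro walk_upd) auto
    have same: "(x(i := ?b))(Suc i := ?a) = x(i := ?b)" by (auto simp: fun_eq_iff)
    have "walk_op d i (walk_op d (Suc i) (walk_op d i \<phi>)) x = step_weight d ?a ?b * walk_op d (Suc i) (walk_op d i \<phi>) (x(i := ?b))"
      using True b i by (subst walk_op_single[where y = ?b]) (auto intro!: walk_op_eq_0)
    also have "walk_op d (Suc i) (walk_op d i \<phi>) (x(i := ?b)) = step_weight d ?b ?a * walk_op d i \<phi> ((x(i := ?b))(Suc i := ?a))"
      using w True nbrs_sym[OF b] ni i by (subst walk_op_single[where y = ?a]) (auto intro!: walk_op_eq_0)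
    also have "walk_op d i \<phi> ((x(i := ?b))(Suc i := ?a)) = walk_op d i \<phi> x"
      unfolding same using True b i by (intro walk_op_upd) auto
    also have "step_weight d ?a ?b * (step_weight d ?b ?a * walk_op d i \<phi> x) = walk_op d i \<phi> x"
      using step_weight_inverse[OF d b] by (simp add: mult.assoc[symmetric])
    finally show ?thesis .
  qed (simp add: walk_op_eq_0)
qed

text \<open>The mirror image of \<open>walk_op_up\<close>: the surviving term of the outer sum is
  the one at \<open>x (i - 1)\<close>.\<close>

lemma walk_op_down:
  assumes d: "d \<noteq> 0" "(2 :: 'k::field) \<noteq> 0" and i: "1 \<le> i"
  shows "walk_op d (Suc i) (walk_op d i (walk_op d (Suc i) \<phi>)) = (walk_op d (Suc i) \<phi> :: _ \<Rightarrow> 'k)"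
proof
  fix x :: "nat \<Rightarrow> bool list"
  show "walk_op d (Suc i) (walk_op d i (walk_op d (Suc i) \<phi>)) x = walk_op d (Suc i) \<phi> x"
  proof (cases "walk x \<and> x i = x (Suc (Suc i))")
    case True
    have ni: "i - 1 \<noteq> i" "i - 1 \<noteq> Suc i" using i by auto
    let ?a = "x i" and ?b = "x (i - 1)"
    have "x (Suc (i - 1)) \<in> nbrs ?b" using True unfolding walk_def by blast
    then have b: "?b \<in> nbrs ?a" using i nbrs_sym by simp
    have w: "walk (x(Suc i := ?b))" using True b i walk_upd[of x "Suc i" ?b] by auto
    have same: "(x(Suc i := ?b))(i := ?a) = x(Suc i := ?b)" by (auto simp: fun_eq_iff)
    have "walk_op d (Suc i) (walk_op d i (walk_op d (Suc i) \<phi>)) x = step_weight d ?a ?b * walk_op d i (walk_op d (Suc i) \<phi>) (x(Suc i := ?b))"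
      using True b i ni by (subst walk_op_single[where y = ?b]) (auto intro!: walk_op_eq_0)
    also have "walk_op d i (walk_op d (Suc i) \<phi>) (x(Suc i := ?b)) = step_weight d ?b ?a * walk_op d (Suc i) \<phi> ((x(Suc i := ?b))(i := ?a))"
      using w True nbrs_sym[OF b] ni i by (subst walk_op_single[where y = ?a]) (auto intro!: walk_op_eq_0)
    also have "walk_op d (Suc i) \<phi> ((x(Suc i := ?b))(i := ?a)) = walk_op d (Suc i) \<phi> x"
      unfolding same using True b i by (intro walk_op_upd) auto
    also have "step_weight d ?a ?b * (step_weight d ?b ?a * walk_op d (Suc i) \<phi> x) = walk_op d (Suc i) \<phi> x"
      using step_weight_inverse[OF d b] by (simp add: mult.assoc[symmetric])
    finally show ?thesis .
  qed (simp add: walk_op_eq_0)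
qed

section \<open>The operator of the second leaf\<close>

definition first_sign :: "(nat \<Rightarrow> bool list) \<Rightarrow> 'k::field" where
  "first_sign x = (if x 1 = [True] then 1 else - 1)"

definition flip :: "((nat \<Rightarrow> bool list) \<Rightarrow> 'k::field) \<Rightarrow> (nat \<Rightarrow> bool list) \<Rightarrow> 'k" where
  "flip \<phi> x = first_sign x * \<phi> x"

lemma flip_flip [simp]: "flip (flip \<phi>) = \<phi>"
  by (auto simp: flip_def first_sign_def)

lemma flip_walk_op: "2 \<le> i \<Longrightarrow> flip (walk_op d i \<phi>) = walk_op d i (flip \<phi>)"
  by (auto simp: flip_def walk_op_def first_sign_def fun_eq_iff sum_negf)

lemma flip_scale: "flip (\<lambda>x. c * \<phi> x) = (\<lambda>x. c * flip \<phi> x)"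
  and flip_add: "flip (\<lambda>x. \<phi> x + \<psi> x) = (\<lambda>x. flip \<phi> x + flip \<psi> x)"
  by (auto simp: flip_def algebra_simps)

text \<open>Both steps from the root have weight \<open>d / 2\<close>, and \<open>flip\<close> gives
  them opposite signs, so the sum over the first position cancels.\<close>

lemma walk_op_flip_walk_op: "walk_op d 1 (flip (walk_op d 1 \<phi>)) = (\<lambda>_. 0)"
proof
  fix x :: "nat \<Rightarrow> bool list"
  show "walk_op d 1 (flip (walk_op d 1 \<phi>)) x = 0"
  proof (cases "walk x \<and> x 0 = x 2")
    case True
    then have nb0: "nbrs (x 0) = {[True], [False]}" by (simp add: walk_def nbrs_def)
    have "walk_op d 1 \<phi> (x(1 := y)) = walk_op d 1 \<phi> x" if "y \<in> nbrs (x 0)" for y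
      using True that by (intro walk_op_upd) (auto simp: numeral_2_eq_2)
    moreover have "walk_op d 1 (flip (walk_op d 1 \<phi>)) x
        = (\<Sum>y\<in>nbrs (x 0). step_weight d (x 0) y * flip (walk_op d 1 \<phi>) (x(1 := y)))"
      using True by (subst walk_op_def) (simp add: numeral_2_eq_2)
    moreover have "x 0 = []" using True by (simp add: walk_def)
    ultimately show ?thesis using nb0 by (simp add: flip_def first_sign_def step_weight_def)
  qed (simp add: walk_op_eq_0 numeral_2_eq_2)
qed

definition gen_op :: "'k::field \<Rightarrow> nat \<Rightarrow> ((nat \<Rightarrow> bool list) \<Rightarrow> 'k) \<Rightarrow> (nat \<Rightarrow> bool list) \<Rightarrow> 'k" where
  "gen_op d i \<phi> = (if i = 0 then flip (walk_op d 1 (flip \<phi>)) else walk_op d i \<phi>)"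

lemma gen_op_add: "gen_op d i (\<lambda>x. \<phi> x + \<psi> x) = (\<lambda>x. gen_op d i \<phi> x + gen_op d i \<psi> x)"
  by (simp add: gen_op_def walk_op_add flip_add)

lemma gen_op_scale: "gen_op d i (\<lambda>x. c * \<phi> x) = (\<lambda>x. c * gen_op d i \<phi> x)"
  by (simp add: gen_op_def walk_op_scale flip_scale)

lemma gen_op_relations:
  fixes d :: "'k::field"
  assumes d: "d \<noteq> 0" "(2 :: 'k) \<noteq> 0"
  shows gen_op_square: "gen_op d i (gen_op d i \<phi>) = (\<lambda>x. d * gen_op d i \<phi> x)"
    and gen_op_far: "i + 2 \<le> j \<Longrightarrow> (i, j) \<noteq> (0, 2) \<Longrightarrow> gen_op d i (gen_op d j \<phi>) = gen_op d j (gen_op d i \<phi>)"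
    and gen_op_up: "1 \<le> i \<Longrightarrow> gen_op d i (gen_op d (Suc i) (gen_op d i \<phi>)) = gen_op d i \<phi>"
    and gen_op_down: "1 \<le> i \<Longrightarrow> gen_op d (Suc i) (gen_op d i (gen_op d (Suc i) \<phi>)) = gen_op d (Suc i) \<phi>"
    and gen_op_020: "gen_op d 0 (gen_op d 2 (gen_op d 0 \<phi>)) = gen_op d 0 \<phi>"
    and gen_op_202: "gen_op d 2 (gen_op d 0 (gen_op d 2 \<phi>)) = gen_op d 2 \<phi>"
    and gen_op_01: "gen_op d 0 (gen_op d 1 \<phi>) = (\<lambda>_. 0)"
    and gen_op_10: "gen_op d 1 (gen_op d 0 \<phi>) = (\<lambda>_. 0)"
proof -
  show "gen_op d i (gen_op d i \<phi>) = (\<lambda>x. d * gen_op d i \<phi> x)"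
    using d by (simp add: gen_op_def walk_op_square flip_scale)
  show "gen_op d i (gen_op d j \<phi>) = gen_op d j (gen_op d i \<phi>)" if "i + 2 \<le> j" "(i, j) \<noteq> (0, 2)"
  proof (cases "i = 0")
    case True
    then have "3 \<le> j" using that by auto
    then show ?thesis using True walk_op_far[of 1 j d] by (simp add: gen_op_def flip_walk_op)
  next
    case False
    then show ?thesis using that walk_op_far[of i j d] by (simp add: gen_op_def)
  qed
  show "1 \<le> i \<Longrightarrow> gen_op d i (gen_op d (Suc i) (gen_op d i \<phi>)) = gen_op d i \<phi>"
    using d by (simp add: gen_op_def walk_op_up)
  show "1 \<le> i \<Longrightarrow> gen_op d (Suc i) (gen_op d i (gen_op d (Suc i) \<phi>)) = gen_op d (Suc i) \<phi>"
    using d by (simp add: gen_op_def walk_op_down)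
  show "gen_op d 0 (gen_op d 2 (gen_op d 0 \<phi>)) = gen_op d 0 \<phi>"
    using walk_op_up[OF d, of 1] by (simp add: gen_op_def flip_walk_op numeral_2_eq_2)
  show "gen_op d 2 (gen_op d 0 (gen_op d 2 \<phi>)) = gen_op d 2 \<phi>"
  proof -
    have "gen_op d 2 (gen_op d 0 (gen_op d 2 \<phi>)) = flip (walk_op d 2 (walk_op d 1 (walk_op d 2 (flip \<phi>))))"
      by (simp add: gen_op_def flip_walk_op)
    also have "\<dots> = flip (walk_op d 2 (flip \<phi>))"
      using walk_op_down[OF d, of 1] by (simp add: numeral_2_eq_2)
    finally show ?thesis by (simp add: gen_op_def flip_walk_op)
  qed
  show "gen_op d 0 (gen_op d 1 \<phi>) = (\<lambda>_. 0)"
    using walk_op_flip_walk_op[of d \<phi>] by (simp add: gen_op_def flip_def fun_eq_iff)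
  show "gen_op d 1 (gen_op d 0 \<phi>) = (\<lambda>_. 0)"
    using walk_op_flip_walk_op[of d "flip \<phi>"] by (simp add: gen_op_def)
qed

section \<open>A test walk and test functions\<close>

definition zigzag :: "nat \<Rightarrow> nat \<Rightarrow> nat \<Rightarrow> bool list" where
  "zigzag m c j = replicate (if j < m then j else if even (j - m) then m - 2 else c) True"

text \<open>An eigenvector, with eigenvalue \<open>d\<close>, for the generators of index
  \<open>M + 1\<close>, \<open>M + 3\<close> and so on. If \<open>M = N - 2 * k\<close>, these
  include all factors of \<open>F k\<close>.\<close>

definition tail_indicator :: "(nat \<Rightarrow> bool list) \<Rightarrow> nat \<Rightarrow> (nat \<Rightarrow> bool list) \<Rightarrow> 'k::field" where
  "tail_indicator v M x = (if walk x \<and> (\<forall>j\<le>M. x j = v j) \<and> (\<forall>l. x (M + 2 * l) = v M) then 1 else 0)"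

lemma nbrs_replicate [simp]:
  "replicate (Suc k) True \<in> nbrs (replicate k True)" "replicate k True \<in> nbrs (replicate (Suc k) True)"
  by (simp_all add: nbrs_def)

text \<open>The walk moves straight to depth \<open>m - 1\<close>, turns back there for the first
  time, and from time \<open>m\<close> on oscillates between depth \<open>m - 2\<close> and depth
  \<open>c\<close>, which is adjacent to it in both cases.\<close>

lemma walk_zigzag:
  assumes m: "3 \<le> m" and c: "c = m - 1 \<or> c = m - 3"
  shows "walk (zigzag m c)"
proof -
  define k where "k = m - 3"
  have k: "m = Suc (Suc (Suc k))" unfolding k_def using m by linarith
  have "zigzag m c (Suc j) \<in> nbrs (zigzag m c j)" for j
  proof -
    consider "Suc j < m" | "Suc j = m" | "m \<le> j" by linarith
    then show ?thesis
    proof cases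
      case 2
      then have "j = Suc (Suc k)" using k by simp
      then show ?thesis using k by (simp add: zigzag_def del: replicate.simps)
    next
      case 3
      then have e: "even (Suc j - m) \<longleftrightarrow> odd (j - m)" by (simp add: Suc_diff_le)
      have mk: "m - 2 = Suc k" using k by simp
      have "c = Suc (Suc k) \<or> c = k" using c k by simp
      then have "replicate c True \<in> nbrs (replicate (Suc k) True)"
        "replicate (Suc k) True \<in> nbrs (replicate c True)"
        using nbrs_replicate by blast+
      moreover have "\<not> j < m" "\<not> Suc j < m" using 3 by simp_all
      ultimately show ?thesis unfolding zigzag_def mk e by (cases "even (j - m)") (simp_all only: if_True if_False not_True_eq_False not_False_eq_True)
    next
      case 1
      then have "j < m" by simp
      then show ?thesis unfolding zigzag_def using 1 nbrs_replicate(1)[of j] by (simp only: if_True)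
    qed
  qed
  then show ?thesis using m by (simp add: walk_def zigzag_def)
qed

text \<open>By parity position \<open>i\<close> is unconstrained, while positions
  \<open>i - 1\<close> and \<open>i + 1\<close> both have to equal \<open>v M\<close>. So the
  function is constant in the summation, and the weights add up to \<open>d\<close>.\<close>

lemma tail_indicator_tail:
  assumes "(2 :: 'k::field) \<noteq> 0"
  shows "gen_op d (M + 1 + 2 * l) (tail_indicator v M) = (\<lambda>x. d * (tail_indicator v M x :: 'k))"
proof
  fix x :: "nat \<Rightarrow> bool list"
  define i where "i = M + 1 + 2 * l"
  have i: "1 \<le> i" "M < i" "i \<noteq> M + 2 * l'" for l' unfolding i_def by presburger+
  show "gen_op d (M + 1 + 2 * l) (tail_indicator v M) x = d * tail_indicator v M x"
  proof (cases "walk x \<and> x (i - 1) = x (i + 1)")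
    case True
    have "tail_indicator v M (x(i := y)) = (tail_indicator v M x :: 'k)" if "y \<in> nbrs (x (i - 1))" for y
      using True walk_upd[of x i y] i(1) that i(2) i(3) by (auto simp: tail_indicator_def)
    then have "walk_op d i (tail_indicator v M) x = (\<Sum>y\<in>nbrs (x (i - 1)). step_weight d (x (i - 1)) y * tail_indicator v M x)"
      using True unfolding walk_op_def by (auto intro!: sum.cong)
    also have "\<dots> = d * tail_indicator v M x" by (simp add: sum_distrib_right[symmetric] sum_step_weight[OF assms])
    finally show ?thesis using i(1) unfolding i_def by (simp add: gen_op_def)
  next
    case False
    have "tail_indicator v M x = (0 :: 'k)"
    proof (rule ccontr)
      assume "tail_indicator v M x \<noteq> (0 :: 'k)"
      then have *: "walk x" "\<And>l. x (M + 2 * l) = v M" by (auto simp: tail_indicator_def split: if_splits)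
      have "i - 1 = M + 2 * l" "i + 1 = M + 2 * Suc l" by (simp_all add: i_def)
      then show False using False * by metis
    qed
    moreover have "walk_op d i (tail_indicator v M) x = 0" using False by (rule walk_op_eq_0)
    ultimately show ?thesis using i(1) unfolding i_def by (simp add: gen_op_def)
  qed
qed

text \<open>The sum evaluates \<open>\<phi>\<close> only where positions \<open>i' - 1\<close> and
  \<open>i' + 1\<close> agree. Index 0 operates on position 1, just as index 1 does.\<close>

lemma gen_op_kill:
  assumes "\<And>x. x (i' - 1) = x (i' + 1) \<Longrightarrow> \<phi> x = 0" "i' = (if i = 0 then 1 else i)"
  shows "gen_op d i \<phi> = (\<lambda>_. 0)"
proof -
  have "walk_op d i' \<psi> = (\<lambda>_. 0)" 
    if that': "\<And>x. x (i' - 1) = x (i' + 1) \<Longrightarrow> \<psi> x = 0" for \<psi> :: "_ \<Rightarrow> 'a"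
  proof
    fix x :: "nat \<Rightarrow> bool list"
    have "i' - 1 \<noteq> i'" using assms(2) by (auto split: if_splits)
    then have "\<psi> (x(i' := y)) = 0" if "x (i' - 1) = x (i' + 1)" for y
      using that by (intro that') simp
    then show "walk_op d i' \<psi> x = 0" by (simp add: walk_op_def)
  qed
  then show ?thesis using assms by (auto simp: gen_op_def flip_def fun_eq_iff)
qed

text \<open>Dual to \<open>gen_op_kill\<close>: there one function is killed, here all outputs
  vanish at one walk.\<close>

lemma gen_op_no_backtrack:
  assumes "v (i' - 1) \<noteq> v (i' + 1)" "i' = (if i = 0 then 1 else i)"
  shows "gen_op d i \<psi> v = 0"
  using assms by (auto simp: gen_op_def flip_def walk_op_eq_0)

context
  fixes m c M :: nat
  assumes m: "3 \<le> m" and M: "M = m \<and> c = m - 1 \<or> M = m + 1 \<and> c = m - 3"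
begin

lemma zigzag_no_backtrack: "1 \<le> i \<Longrightarrow> i < m - 1 \<Longrightarrow> zigzag m c (i - 1) \<noteq> zigzag m c (i + 1)"
  by (auto simp: zigzag_def)

lemma gen_op_zigzag: "i < m - 1 \<Longrightarrow> gen_op d i \<psi> (zigzag m c) = 0"
  using m by (intro gen_op_no_backtrack[OF zigzag_no_backtrack]) auto

lemma gen_op_tail_indicator_zigzag: "i < m - 1 \<Longrightarrow> gen_op d i (tail_indicator (zigzag m c) M) = (\<lambda>_. 0)"
proof (rule gen_op_kill)
  assume i: "i < m - 1"
  let ?i = "if i = 0 then 1 else i"
  fix x :: "nat \<Rightarrow> bool list"
  assume x: "x (?i - 1) = x (?i + 1)"
  have "?i - 1 \<le> M" "?i + 1 \<le> M" using i m M by auto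
  moreover have "zigzag m c (?i - 1) \<noteq> zigzag m c (?i + 1)"
    using i m by (intro zigzag_no_backtrack) auto
  ultimately show "tail_indicator (zigzag m c) M x = 0" using x unfolding tail_indicator_def by metis
qed simp

lemma tail_indicator_zigzag [simp]: "tail_indicator (zigzag m c) M (zigzag m c) = 1"
  using walk_zigzag[of m c] m M by (auto simp: tail_indicator_def zigzag_def)

text \<open>The indicator fixes position \<open>m - 1 \<le> M\<close>, so only the term of the walk
  itself survives.\<close>

lemma walk_op_tail_indicator_zigzag:
  "walk_op d (m - 1) (tail_indicator (zigzag m c) M) (zigzag m c)
    = step_weight d (replicate (m - 2) True) (replicate (m - 1) True)"
proof -
  let ?v = "zigzag m c"
  have v: "?v (m - 1 - 1) = replicate (m - 2) True" "?v (m - 1 + 1) = replicate (m - 2) True"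
    "?v (m - 1) = replicate (m - 1) True"
    using m by (auto simp: zigzag_def numeral_2_eq_2)
  have w: "walk ?v" using walk_zigzag m M by auto
  have nbrs: "replicate (m - 1) True \<in> nbrs (?v (m - 1 - 1))"
  proof -
    have "Suc (m - 2) = m - 1" using m by simp
    then show ?thesis unfolding v using nbrs_replicate(1)[of "m - 2"] by (simp only:)
  qed
  have u: "?v(m - 1 := replicate (m - 1) True) = ?v" using v(3) by (metis fun_upd_triv)
  have "tail_indicator ?v M (?v(m - 1 := z)) = 0" if "z \<noteq> replicate (m - 1) True" for z
  proof -
    have "m - 1 \<le> M" "(?v(m - 1 := z)) (m - 1) \<noteq> ?v (m - 1)" using that m M v(3) by auto
    then show ?thesis unfolding tail_indicator_def by metis
  qed
  then have "walk_op d (m - 1) (tail_indicator ?v M) ?v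
      = step_weight d (?v (m - 1 - 1)) (replicate (m - 1) True) * tail_indicator ?v M (?v(m - 1 := replicate (m - 1) True))"
    using w nbrs v by (intro walk_op_single) auto
  then show ?thesis unfolding u v by simp
qed

end

definition fused_op :: "'k::field \<Rightarrow> nat \<Rightarrow> ((nat \<Rightarrow> bool list) \<Rightarrow> 'k) \<Rightarrow> (nat \<Rightarrow> bool list) \<Rightarrow> 'k" where
  "fused_op d k \<phi> = (if k = 1 then (\<lambda>x. gen_op d 0 \<phi> x + gen_op d 1 \<phi> x) else gen_op d k \<phi>)"

lemma step_weight_replicate_nonzero:
  assumes "d \<noteq> 0" "(2 :: 'k::field) \<noteq> 0"
  shows "step_weight d (replicate k True) (replicate (Suc k) True) \<noteq> (0 :: 'k)"
    and "step_weight d (replicate (Suc k) True) (replicate k True) \<noteq> (0 :: 'k)"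
  using step_weight_inverse[OF assms nbrs_replicate(1)[of k]] by auto

lemma value_up:
  assumes d: "d \<noteq> 0" "(2 :: 'k::field) \<noteq> 0" and m: "3 \<le> m"
  shows "gen_op d (m - 1) (tail_indicator (zigzag m (m - 1)) m) (zigzag m (m - 1)) \<noteq> (0 :: 'k)"
proof -
  have "Suc (m - 2) = m - 1" using m by simp
  then show ?thesis
    using walk_op_tail_indicator_zigzag[of m m "m - 1" d] step_weight_replicate_nonzero(1)[OF d, of "m - 2"] m
    by (simp add: gen_op_def)
qed

text \<open>At each operator a single term survives, so the value is a product of step weights, with
  a factor 2 where both leaves act.\<close>

lemma value_down:
  assumes d: "d \<noteq> 0" "(2 :: 'k::field) \<noteq> 0" and m: "3 \<le> m"
  defines "v \<equiv> zigzag m (m - 3)"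
  shows "gen_op d (m - 1) (fused_op d (m - 2) (gen_op d m (gen_op d (m - 1) (tail_indicator v (m + 1))))) v \<noteq> (0 :: 'k)"
proof -
  define k where "k = m - 3"
  have k: "m = Suc (Suc (Suc k))" unfolding k_def using m by linarith
  let ?H = "\<lambda>k. replicate k True"
  let ?step_weight = "\<lambda>i j. step_weight d (?H i) (?H j)"
  have v: "v k = ?H k" "v (Suc k) = ?H (Suc k)" "v (Suc (Suc k)) = ?H (Suc (Suc k))"
    "v (Suc (Suc (Suc k))) = ?H (Suc k)" "v (Suc (Suc (Suc (Suc k)))) = ?H k"
    by (auto simp: v_def zigzag_def k)
  have wv: "walk v" unfolding v_def using walk_zigzag m by auto
  define a0 :: "_ \<Rightarrow> 'k" where "a0 = tail_indicator v (m + 1)"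
  define a1 where "a1 = walk_op d (m - 1) a0"
  define a2 where "a2 = walk_op d m a1"
  \<comment> \<open>The walk \<open>v\<close> with its peak at time \<open>m - 1\<close> folded down
    to depth \<open>k\<close>. The intermediate functions only have to be evaluated here.\<close>
  define w where "w = v(m - 1 := ?H k)"
  have w: "w k = ?H k" "w (Suc k) = ?H (Suc k)" "w (Suc (Suc k)) = ?H k"
    "w (Suc (Suc (Suc k))) = ?H (Suc k)" "w (Suc (Suc (Suc (Suc k)))) = ?H k"
    by (auto simp: w_def v k)
  have nbs: "?H (Suc j) \<in> nbrs (?H j)" "?H j \<in> nbrs (?H (Suc j))" for j by (rule nbrs_replicate)+
  have ww: "walk w" unfolding w_def
    using wv v nbs k by (intro walk_upd) auto
  \<comment> \<open>Positions not yet operated on must keep their values from \<open>v\<close>; this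
    singles out one term in each later sum.\<close>
  have a0: "a0 x = 0" if "x j \<noteq> v j" "j \<le> m + 1" for x j
    using that unfolding a0_def tail_indicator_def by metis
  have a1m: "a1 x = 0" if "x m \<noteq> ?H (Suc k)" for x
    unfolding a1_def using that a0[of _ m] v k by (intro walk_op_vanish[of m "?H (Suc k)"]) auto
  have a1m2: "a1 x = 0" if "x (m - 2) \<noteq> ?H (Suc k)" for x
    unfolding a1_def using that a0[of _ "m - 2"] v k by (intro walk_op_vanish[of "m - 2" "?H (Suc k)"]) auto
  have a2: "a2 x = 0" if "x (m - 2) \<noteq> ?H (Suc k)" for x
    unfolding a2_def using that a1m2 k by (intro walk_op_vanish[of "m - 2" "?H (Suc k)"]) auto
  have a1w: "a1 w = ?step_weight (Suc k) (Suc (Suc k))"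
  proof -
    have "a1 w = a1 v" unfolding a1_def w_def using wv v nbs k by (intro walk_op_upd) auto
    then show ?thesis
      using walk_op_tail_indicator_zigzag[of m "m + 1" "m - 3" d] m k by (simp add: a1_def a0_def v_def)
  qed
  have trivw: "w(m := ?H (Suc k)) = w" "w(m - 2 := ?H (Suc k)) = w"
    using w k by (simp_all add: fun_upd_idem)
  have a2w: "a2 w = ?step_weight k (Suc k) * a1 w"
  proof -
    have "walk_op d m a1 w = step_weight d (w (m - 1)) (?H (Suc k)) * a1 (w(m := ?H (Suc k)))"
      using ww w nbs k a1m by (intro walk_op_single) auto
    then show ?thesis using trivw w k by (simp add: a2_def)
  qed
  have pw: "walk_op d (m - 2) \<psi> w = ?step_weight k (Suc k) * \<psi> w"
    if "\<And>x. x (m - 2) \<noteq> ?H (Suc k) \<Longrightarrow> \<psi> x = 0" for \<psi>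
  proof -
    have "walk_op d (m - 2) \<psi> w = step_weight d (w (m - 2 - 1)) (?H (Suc k)) * \<psi> (w(m - 2 := ?H (Suc k)))"
      using ww w nbs k that by (intro walk_op_single) auto
    then show ?thesis using trivw w k by simp
  qed
  define a3 where "a3 = fused_op d (m - 2) a2"
  have a3w: "a3 w = (if k = 0 then 2 else 1) * (?step_weight k (Suc k) * a2 w)"
  proof (cases "k = 0")
    case True
    \<comment> \<open>For \<open>k = 0\<close> the first step of \<open>w\<close> leads to
      \<open>[True]\<close>, so the two leaves contribute equally and do not cancel; their sum
      survives because 2 is nonzero.\<close>
    have sgw: "first_sign w = (1 :: 'k)" using w True by (simp add: first_sign_def)
    have "walk_op d (m - 2) (flip a2) w = ?step_weight k (Suc k) * flip a2 w"
      using a2 by (intro pw) (simp add: flip_def)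
    then show ?thesis using pw[OF a2] True k sgw by (simp add: a3_def fused_op_def gen_op_def flip_def)
  next
    case False
    then show ?thesis using pw[OF a2] k by (simp add: a3_def fused_op_def gen_op_def)
  qed
  have "walk_op d (m - 1) a3 v = step_weight d (v (m - 1 - 1)) (?H k) * a3 (v(m - 1 := ?H k))"
  proof (rule walk_op_single)
    \<comment> \<open>With any other \<open>z\<close> at time \<open>m - 1\<close> there is no
      backtracking at step \<open>m - 2\<close>.\<close>
    fix z assume z: "z \<noteq> ?H k"
    let ?x = "v(m - 1 := z)"
    have "walk_op d (m - 2) \<psi> ?x = 0" for \<psi> using z v k by (intro walk_op_eq_0) auto
    then show "a3 ?x = 0" using k by (auto simp: a3_def fused_op_def gen_op_def flip_def)
  qed (use wv v nbs k in auto)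
  then have "walk_op d (m - 1) a3 v = ?step_weight (Suc k) k * a3 w" using v k by (simp add: w_def)
  then have "walk_op d (m - 1) a3 v \<noteq> 0"
    unfolding a3w a2w a1w using step_weight_replicate_nonzero[OF d] d by (simp del: replicate.simps)
  moreover have "gen_op d (m - 1) \<psi> = walk_op d (m - 1) \<psi>" "gen_op d m \<psi> = walk_op d m \<psi>" for \<psi>
    using k by (simp_all add: gen_op_def)
  ultimately show ?thesis by (simp add: a3_def a2_def a1_def a0_def)
qed

section \<open>The non-semisimple case\<close>

context ftl_algebra begin

section \<open>Nilpotent elements at the first zero of \<open>q\<close>\<close>

context
  fixes k :: nat
  assumes m: "1 \<le> k" "Suc (Suc k) \<le> N" and q0: "q (Suc (Suc k)) = 0" and qnz: "\<And>t. 2 \<le> t \<Longrightarrow> t < (Suc (Suc k)) \<Longrightarrow> q t \<noteq> 0"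
begin

text \<open>The product in the recursion for \<open>jw (Suc (Suc k))\<close> whose coefficient has
  its denominator \<open>q (Suc (Suc k))\<close> equal to zero.\<close>

definition crit :: 'a where
  "crit = jw (Suc k) \<otimes> e (Suc k) \<otimes> jw (Suc k)"

lemma crit_spec: "jw_spec (Suc k)"
  using m qnz by (intro jw_props) auto

lemma crit_closed [simp]: "jw (Suc k) \<in> carrier R" "jw k \<in> carrier R" "e (Suc k) \<in> carrier R"
  using m by auto

lemma crit_sandwich: "e (Suc k) \<otimes> jw (Suc k) \<otimes> e (Suc k) = \<zero>"
proof -
  have "et (Suc k) = e (Suc k)" using m by (auto simp: et_def)
  then have "e (Suc k) \<otimes> jw (Suc k) \<otimes> e (Suc k) = (q (Suc (Suc k)) / q (Suc k)) \<cdot> (jw k \<otimes> e (Suc k))"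
    using crit_spec m unfolding jw_spec_def by auto
  then show ?thesis using q0 m by simp
qed

lemma crit_in_A: "crit \<in> A (Suc (Suc k))"
  unfolding crit_def using m A_mono[OF jw_in_A, of "Suc k" "Suc (Suc k)"] by (intro alg.mult e_in_A) auto

lemma crit_carrier [simp]: "crit \<in> carrier R"
  unfolding crit_def by simp

text \<open>The last generator is killed because its sandwich of the projection carries the factor
  \<open>q (Suc (Suc k))\<close>; the others are killed by the projection.\<close>

lemma crit_e: "i \<in> G (Suc (Suc k)) \<Longrightarrow> crit \<otimes> e i = \<zero>"
proof -
  assume i: "i \<in> G (Suc (Suc k))"
  show ?thesis
  proof (cases "i = Suc k")
    case True
    have "crit \<otimes> e i = jw (Suc k) \<otimes> (e (Suc k) \<otimes> jw (Suc k) \<otimes> e (Suc k))"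
      unfolding crit_def True by (simp add: m_assoc)
    then show ?thesis unfolding crit_sandwich by simp
  next
    case False
    then have "i \<in> G (Suc k)" "i < N" using i m by (auto simp: G_def split: if_splits)
    moreover from this have "jw (Suc k) \<otimes> e i = \<zero>" using crit_spec by (simp add: jw_spec_def)
    ultimately show ?thesis unfolding crit_def by (simp add: m_assoc)
  qed
qed

lemma jw_idem: "jw (Suc k) \<otimes> jw (Suc k) = jw (Suc k)"
  using crit_spec by (simp add: jw_spec_def)

lemma crit_jw: "crit \<otimes> jw (Suc k) = crit" "jw (Suc k) \<otimes> crit = crit"
  unfolding crit_def by (simp_all add: m_assoc jw_idem mult_assoc_eq[OF jw_idem])

lemma crit_mult_crit: "w \<in> carrier R \<Longrightarrow> w \<otimes> jw (Suc k) = w \<Longrightarrow> w \<otimes> e (Suc k) = \<zero> \<Longrightarrow> w \<otimes> crit = \<zero>"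
proof -
  assume w: "w \<in> carrier R" "w \<otimes> jw (Suc k) = w" "w \<otimes> e (Suc k) = \<zero>"
  have "w \<otimes> crit = w \<otimes> jw (Suc k) \<otimes> e (Suc k) \<otimes> jw (Suc k)"
    unfolding crit_def using w(1) by (simp add: m_assoc)
  then show ?thesis unfolding w by simp
qed

lemma crit_square: "crit \<otimes> crit = \<zero>"
  using m by (intro crit_mult_crit crit_jw crit_e) (auto simp: G_def)

text \<open>Where \<open>q (k + 2)\<close> vanishes, the Jones-Wenzl projection \<open>jw (k + 3)\<close> has this residue.\<close>

definition crit_res :: 'a where
  "crit_res = crit \<otimes> e (Suc (Suc k)) \<otimes> crit \<oplus> (- 1) \<cdot> crit"

section \<open>The nilpotent one vertex further\<close>

context
  assumes mN: "Suc (Suc k) < N"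
begin

lemma em_closed [simp]: "e (Suc (Suc k)) \<in> carrier R"
  using mN by auto

lemma jw_em: "e (Suc (Suc k)) \<otimes> jw (Suc k) = jw (Suc k) \<otimes> e (Suc (Suc k))"
  using A_commute[OF jw_in_A, of "Suc k" "Suc (Suc k)"] m mN by auto

lemma e_m: "e (Suc (Suc k)) \<otimes> e (Suc k) \<otimes> e (Suc (Suc k)) = e (Suc (Suc k))" "e (Suc k) \<otimes> e (Suc (Suc k)) \<otimes> e (Suc k) = e (Suc k)"
  using e_down[of "Suc k"] e_up[of "Suc k"] m mN by simp_all

lemma crit_res_in_A: "crit_res \<in> A (Suc (Suc (Suc k)))"
  unfolding crit_res_def using crit_in_A A_mono[of crit "Suc (Suc k)" "Suc (Suc (Suc k))"] m
  by (intro alg.add alg.smul alg.mult e_in_A) auto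

lemma crit_res_carrier [simp]: "crit_res \<in> carrier R"
  unfolding crit_res_def by simp

text \<open>Since \<open>e (Suc (Suc k))\<close> commutes with the projection, it sandwiches
  \<open>crit\<close> to \<open>jw (Suc k) \<otimes> e (Suc (Suc k))\<close>. The first summand of
  \<open>crit_res\<close> therefore reproduces \<open>crit \<otimes> e (Suc (Suc k))\<close>, which
  the second one cancels.\<close>

lemma crit_res_e: "i \<in> G (Suc (Suc (Suc k))) \<Longrightarrow> crit_res \<otimes> e i = \<zero>"
proof -
  assume i: "i \<in> G (Suc (Suc (Suc k)))"
  show ?thesis
  proof (cases "i = (Suc (Suc k))")
    case True
    have "e (Suc (Suc k)) \<otimes> crit \<otimes> e (Suc (Suc k)) = (e (Suc (Suc k)) \<otimes> jw (Suc k)) \<otimes> e (Suc k) \<otimes> (jw (Suc k) \<otimes> e (Suc (Suc k)))"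
      unfolding crit_def by (simp add: m_assoc)
    also have "\<dots> = (jw (Suc k) \<otimes> e (Suc (Suc k))) \<otimes> e (Suc k) \<otimes> (e (Suc (Suc k)) \<otimes> jw (Suc k))" by (simp only: jw_em)
    also have "\<dots> = jw (Suc k) \<otimes> (e (Suc (Suc k)) \<otimes> e (Suc k) \<otimes> e (Suc (Suc k))) \<otimes> jw (Suc k)" by (simp add: m_assoc)
    also have "\<dots> = jw (Suc k) \<otimes> (e (Suc (Suc k)) \<otimes> jw (Suc k))" unfolding e_m by (simp add: m_assoc)
    also have "\<dots> = jw (Suc k) \<otimes> e (Suc (Suc k))" unfolding jw_em by (simp add: mult_assoc_eq[OF jw_idem])
    finally have "crit \<otimes> (e (Suc (Suc k)) \<otimes> crit \<otimes> e (Suc (Suc k))) = crit \<otimes> jw (Suc k) \<otimes> e (Suc (Suc k))" by (simp add: m_assoc)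
    then have "crit \<otimes> (e (Suc (Suc k)) \<otimes> (crit \<otimes> e (Suc (Suc k)))) = crit \<otimes> e (Suc (Suc k))" unfolding crit_jw by (simp add: m_assoc)
    then show ?thesis unfolding crit_res_def True by (simp add: smul_simps smul_neg_cancel)
  next
    case False
    then have "i \<in> G (Suc (Suc k))" "i < N" using i m mN by (auto simp: G_def split: if_splits)
    then show ?thesis unfolding crit_res_def using crit_e by (simp add: smul_simps)
  qed
qed

lemma crit_res_square: "crit_res \<otimes> crit_res = \<zero>"
proof -
  have "crit_res \<otimes> jw (Suc k) = crit_res"
    unfolding crit_res_def by (simp add: l_distr smul_mult_left m_assoc crit_jw)
  moreover have "crit_res \<otimes> e (Suc k) = \<zero>" using m by (intro crit_res_e) (auto simp: G_def)
  ultimately have "crit_res \<otimes> crit = \<zero>" by (intro crit_mult_crit) simp_all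
  then show ?thesis
    by (subst (2) crit_res_def) (simp add: r_distr smul_mult_right m_assoc[symmetric])
qed

text \<open>A single product can be evaluated on walks. When the middle projection is expanded once,
  its leading term collapses through \<open>e_m\<close> to \<open>crit\<close>, which is subtracted
  again, and only the correction term survives.\<close>

lemma crit_res_eq:
  "crit_res = (- (q k / q (Suc k))) \<cdot>
    (jw (Suc k) \<otimes> (e (Suc k) \<otimes> (et k \<otimes> (e (Suc (Suc k)) \<otimes> (e (Suc k) \<otimes> jw (Suc k))))))"
proof -
  let ?p = "jw (Suc k)" and ?r = "jw k" and ?e = "e (Suc k)" and ?f = "e (Suc (Suc k))" and ?E = "et k"
  let ?c = "- (q k / q (Suc k))"
  have E: "?E \<in> carrier R" using et_closed[of k] m by auto
  have p: "?p = ?r \<oplus> ?c \<cdot> (?r \<otimes> ?E \<otimes> ?r)"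
    by (subst jw.simps(2)) (use m in simp)
  have p0e: "?e \<otimes> ?r = ?r \<otimes> ?e" and p0f: "?f \<otimes> ?r = ?r \<otimes> ?f"
    using A_commute[OF jw_in_A] m mN by auto
  have pp0: "?p \<otimes> ?r = ?p" "?r \<otimes> ?p = ?p" using crit_spec unfolding jw_spec_def by auto
  have Ef: "?E \<otimes> ?f = ?f \<otimes> ?E"
    using A_commute[OF et_in_A, of k "Suc (Suc k)"] m mN by simp
  have "crit \<otimes> ?f \<otimes> crit = ?p \<otimes> ?e \<otimes> (?p \<otimes> ?f) \<otimes> (?p \<otimes> ?e \<otimes> ?p)"
    unfolding crit_def by (simp add: m_assoc)
  also have "\<dots> = ?p \<otimes> ?e \<otimes> (?f \<otimes> (?p \<otimes> ?p)) \<otimes> ?e \<otimes> ?p"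
    unfolding jw_em[symmetric] by (simp add: m_assoc)
  also have "\<dots> = ?p \<otimes> (?e \<otimes> ?f \<otimes> ?p \<otimes> ?e) \<otimes> ?p"
    unfolding jw_idem by (simp add: m_assoc)
  also have "?e \<otimes> ?f \<otimes> ?p \<otimes> ?e = ?e \<otimes> ?f \<otimes> (?r \<otimes> ?e) \<oplus> ?c \<cdot> (?e \<otimes> (?f \<otimes> ?r) \<otimes> ?E \<otimes> (?r \<otimes> ?e))"
    by (subst p) (use E in \<open>simp add: l_distr r_distr smul_mult_left smul_mult_right m_assoc\<close>)
  also have "\<dots> = ?e \<otimes> ?f \<otimes> (?e \<otimes> ?r) \<oplus> ?c \<cdot> (?e \<otimes> (?r \<otimes> ?f) \<otimes> ?E \<otimes> (?e \<otimes> ?r))"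
    by (simp only: p0e p0f)
  also have "\<dots> = (?e \<otimes> ?f \<otimes> ?e) \<otimes> ?r \<oplus> ?c \<cdot> ((?e \<otimes> ?r) \<otimes> (?f \<otimes> ?E) \<otimes> ?e \<otimes> ?r)"
    using E by (simp add: m_assoc)
  also have "\<dots> = ?r \<otimes> ?e \<oplus> ?c \<cdot> ((?r \<otimes> ?e) \<otimes> (?E \<otimes> ?f) \<otimes> ?e \<otimes> ?r)"
    by (simp only: e_m p0e Ef)
  also have "?p \<otimes> \<dots> \<otimes> ?p = (?p \<otimes> ?r) \<otimes> ?e \<otimes> ?p \<oplus> ?c \<cdot> ((?p \<otimes> ?r) \<otimes> ?e \<otimes> (?E \<otimes> ?f) \<otimes> ?e \<otimes> (?r \<otimes> ?p))"
    using E by (simp add: l_distr r_distr smul_mult_left smul_mult_right m_assoc)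
  also have "\<dots> = crit \<oplus> ?c \<cdot> (?p \<otimes> (?e \<otimes> (?E \<otimes> (?f \<otimes> (?e \<otimes> ?p)))))"
    unfolding pp0 crit_def using E by (simp add: m_assoc)
  finally have "crit_res = crit \<oplus> ?c \<cdot> (?p \<otimes> (?e \<otimes> (?E \<otimes> (?f \<otimes> (?e \<otimes> ?p))))) \<oplus> (- 1) \<cdot> crit"
    unfolding crit_res_def by simp
  also have "\<dots> = ?c \<cdot> (?p \<otimes> (?e \<otimes> (?E \<otimes> (?f \<otimes> (?e \<otimes> ?p))))) \<oplus> (crit \<oplus> (- 1) \<cdot> crit)"
    using E by (simp add: a_ac)
  finally show ?thesis using E by (simp add: smul_neg_cancel)
qed

end

end

end

section \<open>Projections and corners acting on walks\<close>

locale walk_ftl_algebra = generated_ftl_algebra R \<delta> N e smul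
  for R :: "('a, 'm) ring_scheme" (structure) and \<delta> :: "'b::field" and N e
    and smul (infixr "\<cdot>" 75) +
  fixes act :: "'a \<Rightarrow> ((nat \<Rightarrow> bool list) \<Rightarrow> 'b) \<Rightarrow> (nat \<Rightarrow> bool list) \<Rightarrow> 'b"
  assumes two_nz: "(2 :: 'b) \<noteq> 0"
    and act_add: "x \<in> carrier R \<Longrightarrow> y \<in> carrier R \<Longrightarrow> act (x \<oplus> y) \<phi> = (\<lambda>s. act x \<phi> s + act y \<phi> s)"
    and act_mult: "x \<in> carrier R \<Longrightarrow> y \<in> carrier R \<Longrightarrow> act (x \<otimes> y) \<phi> = act x (act y \<phi>)"
    and act_smul: "x \<in> carrier R \<Longrightarrow> act (c \<cdot> x) \<phi> = (\<lambda>s. c * act x \<phi> s)"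
    and act_one: "act \<one> \<phi> = \<phi>"
    and act_e: "i < N \<Longrightarrow> act (e i) \<phi> = gen_op \<delta> i \<phi>"
    and act_scale: "x \<in> carrier R \<Longrightarrow> act x (\<lambda>s. c * \<phi> s) = (\<lambda>s. c * act x \<phi> s)"
begin

lemma act_zero_fun: "x \<in> carrier R \<Longrightarrow> act x (\<lambda>_. 0) = (\<lambda>_. 0)"
  using act_scale[of x 0 "\<lambda>_. 0"] by simp

lemma act_zero: "act \<zero> \<phi> = (\<lambda>_. 0)"
  using act_smul[of \<zero> 0 \<phi>] by simp

lemma act_et: "1 \<le> k \<Longrightarrow> k < N \<Longrightarrow> act (et k) \<phi> = fused_op \<delta> k \<phi>"
  using act_e[of 0] act_e[of 1] N3 by (auto simp: et_def fused_op_def act_add act_e)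

lemma act_jw_Suc:
  assumes "1 \<le> k" "k < N"
  shows "act (jw (Suc k)) \<phi> = (\<lambda>s. act (jw k) \<phi> s + - (q k / q (Suc k)) * act (jw k) (fused_op \<delta> k (act (jw k) \<phi>)) s)"
  using assms et_closed[of k] by (simp add: jw.simps(2) act_add act_smul act_mult act_et)

text \<open>By induction the inner projection of a correction term leaves \<open>\<phi>\<close>
  unchanged, and the generator after it gives zero.\<close>

lemma act_jw_right:
  "n \<le> N \<Longrightarrow> (\<And>i. i < n \<Longrightarrow> gen_op \<delta> i \<phi> = (\<lambda>_. 0)) \<Longrightarrow> act (jw n) \<phi> = \<phi>"
proof (induction n)
  case (Suc n)
  show ?case
  proof (cases "n = 0")
    case False
    then have "fused_op \<delta> n \<phi> = (\<lambda>_. 0)" using Suc by (auto simp: fused_op_def)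
    then show ?thesis using Suc False by (simp add: act_jw_Suc act_zero_fun)
  qed (simp add: act_one)
qed (simp add: act_one)

text \<open>Dually, by induction for arbitrary functions the outer projection of a correction term
  does not change values at \<open>v\<close>, and the generator behind it has value zero
  there.\<close>

lemma act_jw_left:
  "n \<le> N \<Longrightarrow> (\<And>i \<phi>. i < n \<Longrightarrow> gen_op \<delta> i \<phi> v = 0) \<Longrightarrow> act (jw n) \<phi> v = \<phi> v"
proof (induction n arbitrary: \<phi>)
  case (Suc n)
  show ?case
  proof (cases "n = 0")
    case False
    then have "fused_op \<delta> n \<psi> v = 0" for \<psi> using Suc.prems by (auto simp: fused_op_def)
    then show ?thesis using Suc False by (simp add: act_jw_Suc)
  qed (simp add: act_one)
qed (simp add: act_one)

lemma act_F:
  assumes "2 * k \<le> N" "\<And>j. j < k \<Longrightarrow> gen_op \<delta> (N - 2 * j - 1) \<phi> = (\<lambda>s. \<delta> * \<phi> s)"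
  shows "act (F k) \<phi> = (\<lambda>s. \<delta> ^ k * \<phi> s)"
  using assms
proof (induction k)
  case (Suc k)
  have "N - 2 * k - 1 < N" using N3 by simp
  then show ?case
    using Suc by (simp add: act_mult act_e act_scale mult_ac)
qed (simp add: act_one)

lemma act_F_tail_indicator:
  assumes "2 * k < N"
  shows "act (F k) (tail_indicator v (N - 2 * k)) = (\<lambda>s. \<delta> ^ k * tail_indicator v (N - 2 * k) s)"
proof (rule act_F)
  fix j assume "j < k"
  then have "N - 2 * j - 1 = N - 2 * k + 1 + 2 * (k - j - 1)" using assms by auto
  then show "gen_op \<delta> (N - 2 * j - 1) (tail_indicator v (N - 2 * k)) = (\<lambda>s. \<delta> * tail_indicator v (N - 2 * k) s)"
    using tail_indicator_tail[OF two_nz] by metis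
qed (use assms in simp)

text \<open>The parity of \<open>N - m\<close> decides which nilpotent fits: \<open>crit\<close>
  lies in \<open>A m\<close> and \<open>crit_res\<close> in \<open>A (Suc m)\<close>, and one of the
  two indices has the form \<open>N - 2 * k\<close>. Semiprimeness makes its product with
  \<open>F k\<close> zero, which a matrix entry refutes.\<close>

lemma not_semisimple:
  assumes m: "3 \<le> m" "m \<le> N" and q0: "q m = 0" and qnz: "\<And>t. 2 \<le> t \<Longrightarrow> t < m \<Longrightarrow> q t \<noteq> 0"
  shows "\<not> semisimple_ring R"
proof
  assume ss: "semisimple_ring R"
  have vanish: "w \<otimes> F k = \<zero>" if "2 * k < N" "w \<in> A (N - 2 * k)" "w \<otimes> w = \<zero>"
    "\<And>i. i \<in> G (N - 2 * k) \<Longrightarrow> w \<otimes> e i = \<zero>" for w k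
  proof (rule semisimple_ring_semiprime[OF ss])
    show "w \<otimes> F k \<in> carrier R" using A_closed[OF that(2)] by simp
  qed (rule corner_nilpotent[OF that])
  define r where "r = m - 2"
  have r: "1 \<le> r" "m = Suc (Suc r)" unfolding r_def using m by linarith+
  have rN: "Suc (Suc r) \<le> N" "q (Suc (Suc r)) = 0" "\<And>t. 2 \<le> t \<Longrightarrow> t < Suc (Suc r) \<Longrightarrow> q t \<noteq> 0"
    using m q0 qnz r by auto
  let ?p = "jw (Suc r)" and ?e = "e (Suc r)"
  have c: "?p \<in> carrier R" "?e \<in> carrier R" using m r by auto
  have m1: "Suc r \<le> N" "Suc r < N" "m - 1 = Suc r" "m - 2 = r" using m r by auto
  show False
  proof (cases "even (N - m)")
    case True
    then obtain k where "N - m = 2 * k" by (rule evenE)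
    then have k: "2 * k < N" "N - 2 * k = m" using m by auto
    let ?v = "zigzag m (m - 1)"
    let ?\<phi> = "tail_indicator ?v m :: _ \<Rightarrow> 'b"
    have zz: "m = m \<and> m - 1 = m - 1 \<or> m = m + 1 \<and> m - 1 = m - 3" by simp
    note kill = gen_op_tail_indicator_zigzag[OF m(1) zz] and left = gen_op_zigzag[OF m(1) zz]
    have p\<phi>: "act ?p ?\<phi> = ?\<phi>" using m1 kill by (intro act_jw_right) (auto simp: m1)
    have pv: "act ?p \<psi> ?v = \<psi> ?v" for \<psi> using m1 left by (intro act_jw_left) (auto simp: m1)
    have "crit r \<otimes> F k = \<zero>"
      using crit_in_A[OF r(1) rN] crit_square[OF r(1) rN] crit_e[OF r(1) rN] k r
      by (intro vanish[OF k(1)]) simp_all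
    then have "act (crit r \<otimes> F k) ?\<phi> ?v = 0" by (simp add: act_zero)
    \<comment> \<open>Between the test function and the test walk both projections act as the
      identity and \<open>F k\<close> as \<open>\<delta> ^ k\<close>, so only the generator in the
      middle remains.\<close>
    also have "act (crit r \<otimes> F k) ?\<phi> ?v = \<delta> ^ k * gen_op \<delta> (Suc r) ?\<phi> ?v"
      using act_F_tail_indicator[OF k(1), of ?v] k(2) c m1 p\<phi> pv
        crit_def[OF r(1) rN]
      by (simp add: act_mult act_scale act_e m1)
    finally show False using value_up[OF \<delta>_nz two_nz m(1)] \<delta>_nz unfolding m1 by simp
  next
    case False
    \<comment> \<open>An odd difference leaves room for one more vertex, as \<open>crit_res\<close>
      requires.\<close>
    then have "m < N" "even (N - Suc m)" using m by (auto simp: le_less)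
    from this(2) obtain k where "N - Suc m = 2 * k" by (rule evenE)
    then have k: "2 * k < N" "N - 2 * k = Suc m" using \<open>m < N\<close> by auto
    let ?v = "zigzag m (m - 3)"
    let ?\<phi> = "tail_indicator ?v (m + 1) :: _ \<Rightarrow> 'b"
    let ?c = "- (q r / q (Suc r))"
    have zz: "m + 1 = m \<and> m - 3 = m - 1 \<or> m + 1 = m + 1 \<and> m - 3 = m - 3" by simp
    note kill = gen_op_tail_indicator_zigzag[OF m(1) zz] and left = gen_op_zigzag[OF m(1) zz]
    have p\<phi>: "act ?p ?\<phi> = ?\<phi>" using m1 kill by (intro act_jw_right) (auto simp: m1)
    have pv: "act ?p \<psi> ?v = \<psi> ?v" for \<psi> using m1 left by (intro act_jw_left) (auto simp: m1)
    have E: "et r \<in> carrier R" "e (Suc (Suc r)) \<in> carrier R" "r < N"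
      using et_closed[of r] r \<open>m < N\<close> by auto
    have rN': "Suc (Suc r) < N" using \<open>m < N\<close> r by simp
    note cr = r(1) rN rN'
    have "crit_res r \<otimes> F k = \<zero>"
      using crit_res_in_A[OF cr] crit_res_square[OF cr] crit_res_e[OF cr] k r
      by (intro vanish[OF k(1)]) simp_all
    then have "act (crit_res r \<otimes> F k) ?\<phi> ?v = 0" by (simp add: act_zero)
    also have "act (crit_res r \<otimes> F k) ?\<phi> ?v
        = ?c * (\<delta> ^ k * gen_op \<delta> (Suc r) (fused_op \<delta> r (gen_op \<delta> m (gen_op \<delta> (Suc r) ?\<phi>))) ?v)"
      using act_F_tail_indicator[OF k(1), of ?v] k(2) c m1 p\<phi> pv E \<open>m < N\<close>
        crit_res_eq[OF cr]
      by (simp add: act_mult act_scale act_smul act_e act_et[OF r(1) E(3)] m1 r(2))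
    finally have "?c = 0" using value_down[OF \<delta>_nz two_nz m(1)] \<delta>_nz unfolding m1 by simp
    \<comment> \<open>Both indices lie below \<open>m\<close>; the case \<open>r = 1\<close>, which
      \<open>qnz\<close> does not cover, is \<open>q_1\<close>.\<close>
    moreover have "q (Suc r) \<noteq> 0" "q r \<noteq> 0"
      using rN(3)[of "Suc r"] rN(3)[of r] r q_1 \<delta>_nz by (cases "r = 1"; simp)+
    ultimately show False by simp
  qed
qed

end

section \<open>The forked Temperley-Lieb algebra\<close>

lemma poly_mapping_sum_single:
  fixes p :: "'a \<Rightarrow>\<^sub>0 'b::comm_monoid_add"
  shows "p = (\<Sum>w\<in>Poly_Mapping.keys p. Poly_Mapping.single w (Poly_Mapping.lookup p w))"
proof (rule poly_mapping_eqI)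
  fix v
  have "(\<Sum>w\<in>Poly_Mapping.keys p. Poly_Mapping.lookup (Poly_Mapping.single w (Poly_Mapping.lookup p w)) v)
    = (\<Sum>w\<in>Poly_Mapping.keys p. if w = v then Poly_Mapping.lookup p w else 0)"
    by (intro sum.cong) (auto simp: lookup_single when_def)
  also have "\<dots> = Poly_Mapping.lookup p v"
    by (simp add: in_keys_iff)
  finally show "Poly_Mapping.lookup p v
      = Poly_Mapping.lookup (\<Sum>w\<in>Poly_Mapping.keys p. Poly_Mapping.single w (Poly_Mapping.lookup p w)) v"
    by (simp add: lookup_sum)
qed

text \<open>The single terms are restricted to the support of \<open>p\<close>, so that a condition
  on the letters occurring in \<open>p\<close> is available in the induction.\<close>

lemma poly_mapping_keys_induct [case_names zero single add]:
  fixes p :: "'a \<Rightarrow>\<^sub>0 'b::comm_monoid_add"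
  assumes zero: "P 0" and single: "\<And>w c. w \<in> Poly_Mapping.keys p \<Longrightarrow> P (Poly_Mapping.single w c)"
    and add: "\<And>f g. P f \<Longrightarrow> P g \<Longrightarrow> P (f + g)"
  shows "P p"
proof -
  have "P (\<Sum>w\<in>S. Poly_Mapping.single w (Poly_Mapping.lookup p w))"
    if "finite S" "S \<subseteq> Poly_Mapping.keys p" for S
    using that by (induction S rule: finite_induct) (auto intro: zero single add)
  from this[OF finite_keys subset_refl] show ?thesis
    by (simp only: poly_mapping_sum_single[of p, symmetric])
qed

section \<open>Numbering the vertices\<close>

definition idx :: "vertex \<Rightarrow> nat" where
  "idx g = (case g of VBar \<Rightarrow> 0 | V i \<Rightarrow> i)"

definition vx :: "nat \<Rightarrow> vertex" where
  "vx i = (if i = 0 then VBar else V i)"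

lemma idx_vx [simp]: "idx (vx i) = i"
  by (simp add: idx_def vx_def)

text \<open>\<open>V 0\<close> is not a vertex of the graph, so \<open>idx\<close> and
  \<open>vx\<close> are inverse to each other on the vertices.\<close>

lemma D_vertices_eq: "1 \<le> n \<Longrightarrow> D_vertices n = vx ` {..<n}"
proof
  show "D_vertices n \<subseteq> vx ` {..<n}" if "1 \<le> n"
  proof
    fix g assume "g \<in> D_vertices n"
    then have "g = vx (idx g)" "idx g < n"
      using that by (auto simp: D_vertices_def vx_def idx_def)
    then show "g \<in> vx ` {..<n}" by blast
  qed
qed (auto simp: D_vertices_def vx_def)

lemma vx_eq_iff [simp]: "vx i = vx j \<longleftrightarrow> i = j"
  by (auto simp: vx_def)

lemma D_edges_iff:
  assumes "3 \<le> n" "i < j" "j < n"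
  shows "{vx i, vx j} \<in> D_edges n \<longleftrightarrow> (i, j) = (0, 2) \<or> 1 \<le> i \<and> j = Suc i"
  using assms by (auto simp: D_edges_def vx_def doubleton_eq_iff split: if_splits)

section \<open>The free algebra acting on functions of walks\<close>

definition word_op :: "'k::field \<Rightarrow> vertex fmon \<Rightarrow> ((nat \<Rightarrow> bool list) \<Rightarrow> 'k) \<Rightarrow> (nat \<Rightarrow> bool list) \<Rightarrow> 'k" where
  "word_op d w = foldr (\<lambda>g. gen_op d (idx g)) (letters w)"

lemma word_op_zero [simp]: "word_op d 0 \<phi> = \<phi>"
  by (simp add: word_op_def)

lemma word_op_plus: "word_op d (u + v) \<phi> = word_op d u (word_op d v \<phi>)"
  by (simp add: word_op_def)

lemma foldr_gen_op_add:
  "foldr (\<lambda>g. gen_op d (f g)) xs (\<lambda>x. \<phi> x + \<psi> x)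
    = (\<lambda>x. foldr (\<lambda>g. gen_op d (f g)) xs \<phi> x + foldr (\<lambda>g. gen_op d (f g)) xs \<psi> x)"
  by (induction xs) (simp_all add: gen_op_add)

lemma foldr_gen_op_scale:
  "foldr (\<lambda>g. gen_op d (f g)) xs (\<lambda>x. c * \<phi> x) = (\<lambda>x. c * foldr (\<lambda>g. gen_op d (f g)) xs \<phi> x)"
  by (induction xs) (simp_all add: gen_op_scale)

definition rho :: "'k::field \<Rightarrow> (vertex fmon \<Rightarrow>\<^sub>0 'k) \<Rightarrow> ((nat \<Rightarrow> bool list) \<Rightarrow> 'k) \<Rightarrow> (nat \<Rightarrow> bool list) \<Rightarrow> 'k" where
  "rho d p \<phi> x = (\<Sum>w\<in>Poly_Mapping.keys p. Poly_Mapping.lookup p w * word_op d w \<phi> x)"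

lemma rho_superset:
  "finite S \<Longrightarrow> Poly_Mapping.keys p \<subseteq> S \<Longrightarrow> rho d p \<phi> x = (\<Sum>w\<in>S. Poly_Mapping.lookup p w * word_op d w \<phi> x)"
  unfolding rho_def by (rule sum.mono_neutral_left) (auto simp: in_keys_iff)

lemma rho_zero [simp]: "rho d 0 \<phi> = (\<lambda>_. 0)"
  by (simp add: rho_def fun_eq_iff)

lemma rho_add: "rho d (p + q) \<phi> = (\<lambda>x. rho d p \<phi> x + rho d q \<phi> x)"
proof
  fix x
  let ?S = "Poly_Mapping.keys p \<union> Poly_Mapping.keys q"
  show "rho d (p + q) \<phi> x = rho d p \<phi> x + rho d q \<phi> x"
    using keys_add[of p q]
    by (simp add: rho_superset[of ?S] lookup_add distrib_right sum.distrib)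
qed

lemma rho_single: "rho d (Poly_Mapping.single w c) \<phi> = (\<lambda>x. c * word_op d w \<phi> x)"
  by (cases "c = 0") (auto simp: rho_def fun_eq_iff)

text \<open>By additivity in both factors only multiples of words matter, for which concatenation
  becomes composition.\<close>

lemma rho_mult: "rho d (p * q) \<phi> = rho d p (rho d q \<phi>)"
proof (induction p rule: poly_mapping_keys_induct)
  case (single w c)
  show ?case
  proof (induction q rule: poly_mapping_keys_induct)
    case zero
    show ?case using foldr_gen_op_scale[of d idx "letters w" 0 "\<lambda>_. 0"] by (simp add: rho_single word_op_def)
  next
    case (single v b)
    show ?case
      by (simp add: mult_single rho_single word_op_plus)
         (simp add: word_op_def foldr_gen_op_scale mult.assoc)
  next
    case (add f g)
    then show ?case
      by (simp add: distrib_left rho_add) (simp add: rho_single word_op_def foldr_gen_op_add distrib_left)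
  qed
qed (simp_all add: distrib_right rho_add)

lemma rho_minus: "rho d (p - q) \<phi> x = rho d p \<phi> x - rho d q \<phi> x"
  using rho_add[of d "p - q" q \<phi>] by (simp add: fun_eq_iff)

lemma rho_one: "rho d 1 \<phi> = \<phi>"
  using rho_single[of d 0 1 \<phi>] by (simp add: single_one)

lemma rho_fgen: "rho d (fgen g) \<phi> = gen_op d (idx g) \<phi>"
  by (simp add: fgen_def rho_single word_op_def)

lemma rho_fscalar: "rho d (fscalar c) \<phi> = (\<lambda>x. c * \<phi> x)"
  by (simp add: fscalar_def rho_single)

lemma rho_scale: "rho d p (\<lambda>x. c * \<phi> x) = (\<lambda>x. c * rho d p \<phi> x)"
  by (auto simp: rho_def word_op_def foldr_gen_op_scale fun_eq_iff sum_distrib_left mult_ac)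

lemma fscalar_commute: "fscalar c * p = p * fscalar c"
  by (induction p rule: poly_mapping_keys_induct)
     (simp_all add: fscalar_def mult_single distrib_left distrib_right mult.commute)

lemma rho_relator:
  fixes d :: "'k::field"
  assumes d: "d \<noteq> 0" "(2 :: 'k) \<noteq> 0" and n: "3 \<le> n" and r: "r \<in> FTL_relators n d"
  shows "rho d r \<phi> = (\<lambda>_. 0)"
proof -
  have V: "D_vertices n = vx ` {..<n}" using n by (intro D_vertices_eq) simp
  \<comment> \<open>The two leaves are not adjacent, but their distance is too small for
    \<open>gen_op_far\<close>; there both products vanish.\<close>
  have gen_op_comm: "gen_op d i (gen_op d j \<psi>) = gen_op d j (gen_op d i \<psi>)"
    if "i < j" "j < n" "{vx i, vx j} \<notin> D_edges n" for i j \<psi>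
  proof (cases "(i, j) = (0, 1)")
    case True
    then show ?thesis using gen_op_01[OF d] gen_op_10[OF d] by simp
  next
    case False
    have "(i, j) \<noteq> (0, 2)" "\<not> (1 \<le> i \<and> j = Suc i)"
      using D_edges_iff[OF n that(1,2)] that(3) by blast+
    then have "i + 2 \<le> j" using False that(1) by (cases i) auto
    then show ?thesis using gen_op_far[OF d] \<open>(i, j) \<noteq> (0, 2)\<close> by blast
  qed
  have gen_op_adj: "gen_op d i (gen_op d j (gen_op d i \<psi>)) = gen_op d i \<psi> \<and> gen_op d j (gen_op d i (gen_op d j \<psi>)) = gen_op d j \<psi>"
    if "i < j" "j < n" "{vx i, vx j} \<in> D_edges n" for i j \<psi>
    using D_edges_iff[OF n that(1,2)] that(3) gen_op_020[OF d] gen_op_202[OF d] gen_op_up[OF d] gen_op_down[OF d]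
    by auto
  have vxE: "\<exists>i<n. g = vx i" if "g \<in> D_vertices n" for g
    using that unfolding V by blast
  show ?thesis
    using r unfolding FTL_relators_def
  proof (elim UnE CollectE exE conjE singletonE, goal_cases)
    case (1 g)
    then show ?thesis
      by (simp add: rho_minus rho_mult rho_fgen rho_fscalar gen_op_square[OF d] fun_eq_iff)
  next
    case (2 g h)
    then obtain i j where ij: "g = vx i" "h = vx j" "i < n" "j < n" using vxE by meson
    then consider (less) "i < j" | (greater) "j < i" using 2(4) by fastforce
    then have "gen_op d i (gen_op d j \<phi>) = gen_op d j (gen_op d i \<phi>)"
    proof cases
      case less
      then show ?thesis using gen_op_comm less 2(5) ij by blast
    next
      case greater
      then show ?thesis using gen_op_comm[OF greater ij(3), of \<phi>] 2(5) ij by (simp add: insert_commute)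
    qed
    then show ?thesis unfolding 2(1) ij(1,2) by (simp add: rho_minus rho_mult rho_fgen fun_eq_iff)
  next
    case (3 g h)
    then obtain i j where ij: "g = vx i" "h = vx j" "i < n" "j < n" using vxE by meson
    \<comment> \<open>An edge has two elements, so such a relator never concerns a single
      vertex.\<close>
    have "i \<noteq> j"
    proof
      assume "i = j"
      then have "card {g, h} = 1" using ij by simp
      moreover have "card E = 2" if "E \<in> D_edges n" for E
        using that by (auto simp: D_edges_def)
      from this[OF 3(4)] have "card {g, h} = 2" .
      ultimately show False by simp
    qed
    then consider (less) "i < j" | (greater) "j < i" by linarith
    then have "gen_op d i (gen_op d j (gen_op d i \<phi>)) = gen_op d i \<phi>"
    proof cases
      case less
      then show ?thesis using gen_op_adj less 3(4) ij by blast
    next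
      case greater
      then show ?thesis using gen_op_adj[OF greater ij(3), of \<phi>] 3(4) ij by (simp add: insert_commute)
    qed
    then show ?thesis unfolding 3(1) ij(1,2) by (simp add: rho_minus rho_mult rho_fgen fun_eq_iff)
  next
    case 4
    then show ?thesis using gen_op_01[OF d] by (simp add: rho_mult rho_fgen idx_def)
  qed
qed

section \<open>The quotient by the relators\<close>

context
  fixes n :: nat and \<delta> :: "'k::field"
  assumes n: "3 \<le> n" and \<delta>: "\<delta> \<noteq> 0"
begin

abbreviation "FA \<equiv> free_algebra (D_vertices n) :: (vertex fmon \<Rightarrow>\<^sub>0 'k) ring"

definition rel_ideal :: "(vertex fmon \<Rightarrow>\<^sub>0 'k) set" where
  "rel_ideal = genideal FA (FTL_relators n \<delta>)"

definition cls :: "(vertex fmon \<Rightarrow>\<^sub>0 'k) \<Rightarrow> (vertex fmon \<Rightarrow>\<^sub>0 'k) set" where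
  "cls p = rel_ideal +>\<^bsub>FA\<^esub> p"

lemma relators_closed: "FTL_relators n \<delta> \<subseteq> carrier FA"
  using n by (intro FTL_relators_closed) simp

lemma rel_ideal: "ideal rel_ideal FA"
  unfolding rel_ideal_def by (intro ring.genideal_ideal free_algebra_ring relators_closed)

lemma FTL_eq: "FTL n \<delta> = FA Quot rel_ideal"
  by (simp add: FTL_def rel_ideal_def)

lemma cls_hom: "cls \<in> ring_hom FA (FTL n \<delta>)"
  using ideal.rcos_ring_hom[OF rel_ideal] unfolding FTL_eq cls_def[abs_def] .

lemma carrier_FTL: "carrier (FTL n \<delta>) = cls ` carrier FA"
  unfolding FTL_eq FactRing_def cls_def[abs_def] by (auto simp: A_RCOSETS_def')

lemma cls_closed [simp]: "p \<in> carrier FA \<Longrightarrow> cls p \<in> carrier (FTL n \<delta>)"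
  using carrier_FTL by blast

lemma cls_mult: "p \<in> carrier FA \<Longrightarrow> q \<in> carrier FA \<Longrightarrow> cls p \<otimes>\<^bsub>FTL n \<delta>\<^esub> cls q = cls (p * q)"
  using ring_hom_mult[OF cls_hom] by simp

lemma cls_add: "p \<in> carrier FA \<Longrightarrow> q \<in> carrier FA \<Longrightarrow> cls p \<oplus>\<^bsub>FTL n \<delta>\<^esub> cls q = cls (p + q)"
  using ring_hom_add[OF cls_hom] by simp

lemma cls_one: "cls 1 = \<one>\<^bsub>FTL n \<delta>\<^esub>"
  using ring_hom_one[OF cls_hom] by simp

lemma cls_zero: "cls 0 = \<zero>\<^bsub>FTL n \<delta>\<^esub>"
  using ring_hom_zero[OF cls_hom free_algebra_ring] FTL_ring[of n \<delta>] n by simp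

lemma cls_relator: "r \<in> FTL_relators n \<delta> \<Longrightarrow> cls r = cls 0"
proof -
  assume "r \<in> FTL_relators n \<delta>"
  then have "r \<in> rel_ideal"
    unfolding rel_ideal_def using ring.genideal_self[OF free_algebra_ring relators_closed] by blast
  moreover have sub: "abelian_subgroup rel_ideal FA"
    using ideal.axioms(1)[OF rel_ideal] ideal.axioms(2)[OF rel_ideal]
    by (intro abelian_subgroupI3 additive_subgroup.a_subgroup ring.is_abelian_group) auto
  moreover have "0 \<in> rel_ideal"
    using additive_subgroup.zero_closed[OF ideal.axioms(1)[OF rel_ideal]] by simp
  ultimately show ?thesis
    unfolding cls_def
    using abelian_subgroup.a_rcos_const[OF sub] by simp
qed

lemma cls_eqI:
  assumes "p - q \<in> FTL_relators n \<delta>" "p \<in> carrier FA" "q \<in> carrier FA"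
  shows "cls p = cls q"
proof -
  have c: "p - q \<in> carrier FA" using assms relators_closed by blast
  have "cls p = cls (p - q) \<oplus>\<^bsub>FTL n \<delta>\<^esub> cls q" using assms c by (simp add: cls_add)
  also have "\<dots> = cls 0 \<oplus>\<^bsub>FTL n \<delta>\<^esub> cls q" using cls_relator[OF assms(1)] by simp
  also have "\<dots> = cls q" using assms by (simp add: cls_add zero_closed)
  finally show ?thesis .
qed

definition cgen :: "nat \<Rightarrow> (vertex fmon \<Rightarrow>\<^sub>0 'k) set" where
  "cgen i = cls (fgen (vx i))"

definition csmul :: "'k \<Rightarrow> (vertex fmon \<Rightarrow>\<^sub>0 'k) set \<Rightarrow> (vertex fmon \<Rightarrow>\<^sub>0 'k) set" where
  "csmul c x = cls (fscalar c) \<otimes>\<^bsub>FTL n \<delta>\<^esub> x"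

lemma vx_in: "i < n \<Longrightarrow> vx i \<in> D_vertices n"
  using D_vertices_eq n by auto

lemma fgen_vx [simp]: "i < n \<Longrightarrow> fgen (vx i) \<in> carrier FA"
  by (intro fgen_closed vx_in)

lemma fscalar_in [simp]: "fscalar c \<in> carrier FA"
  by (rule fscalar_closed)

lemma csmul_cls: "p \<in> carrier FA \<Longrightarrow> csmul c (cls p) = cls (fscalar c * p)"
  by (simp add: csmul_def cls_mult)

lemma carrierE:
  assumes "x \<in> carrier (FTL n \<delta>)"
  obtains p where "p \<in> carrier FA" "x = cls p"
  using assms carrier_FTL by blast

lemma FTL_ftl_algebra: "ftl_algebra (FTL n \<delta>) \<delta> n cgen csmul"
proof (intro ftl_algebra.intro ftl_algebra_axioms.intro)
  show "ring (FTL n \<delta>)" using n by (intro FTL_ring) simp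
  show "3 \<le> n" by (rule n)
  show "\<delta> \<noteq> 0" by (rule \<delta>)
  have fs: "fscalar (a + b) = fscalar a + fscalar b" "fscalar (a * b) = fscalar a * fscalar b"
    "fscalar 1 = 1" for a b :: 'k
    by (simp_all add: fscalar_def single_add mult_single)
  note simps = cls_add cls_mult csmul_cls mult_closed add_closed
  show "csmul c x \<in> carrier (FTL n \<delta>)" if "x \<in> carrier (FTL n \<delta>)" for c x
    using that by (elim carrierE) (simp add: simps)
  show "csmul (a + b) x = csmul a x \<oplus>\<^bsub>FTL n \<delta>\<^esub> csmul b x" if "x \<in> carrier (FTL n \<delta>)" for a b x
    using that by (elim carrierE) (simp add: simps fs distrib_right)
  show "csmul c (x \<oplus>\<^bsub>FTL n \<delta>\<^esub> y) = csmul c x \<oplus>\<^bsub>FTL n \<delta>\<^esub> csmul c y"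
    if "x \<in> carrier (FTL n \<delta>)" "y \<in> carrier (FTL n \<delta>)" for c x y
    using that by (elim carrierE) (simp add: simps distrib_left)
  show "csmul a (csmul b x) = csmul (a * b) x" if "x \<in> carrier (FTL n \<delta>)" for a b x
    using that by (elim carrierE) (simp add: simps fs mult.assoc)
  show "csmul 1 x = x" if "x \<in> carrier (FTL n \<delta>)" for x
    using that by (elim carrierE) (simp add: simps fs)
  show "csmul c x \<otimes>\<^bsub>FTL n \<delta>\<^esub> y = csmul c (x \<otimes>\<^bsub>FTL n \<delta>\<^esub> y)"
    if "x \<in> carrier (FTL n \<delta>)" "y \<in> carrier (FTL n \<delta>)" for c x y
    using that by (elim carrierE) (simp add: simps mult.assoc)
  show "x \<otimes>\<^bsub>FTL n \<delta>\<^esub> csmul c y = csmul c (x \<otimes>\<^bsub>FTL n \<delta>\<^esub> y)"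
    if "x \<in> carrier (FTL n \<delta>)" "y \<in> carrier (FTL n \<delta>)" for c x y
  proof -
    from that obtain p r where "x = cls p" "y = cls r" and pr: "p \<in> carrier FA" "r \<in> carrier FA"
      by (elim carrierE) blast
    moreover have "p * (fscalar c * r) = fscalar c * (p * r)"
      by (metis fscalar_commute mult.assoc)
    ultimately show ?thesis by (simp add: simps)
  qed
  show "cgen i \<in> carrier (FTL n \<delta>)" if "i < n" for i
    using that by (simp add: cgen_def)
  show "cgen i \<otimes>\<^bsub>FTL n \<delta>\<^esub> cgen i = csmul \<delta> (cgen i)" if i: "i < n" for i
  proof -
    have "cls (fgen (vx i) * fgen (vx i)) = cls (fscalar \<delta> * fgen (vx i))"
      using i vx_in[OF i] by (intro cls_eqI mult_closed) (auto simp: FTL_relators_def)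
    then show ?thesis using i by (simp add: cgen_def simps)
  qed
  have comm: "cgen i \<otimes>\<^bsub>FTL n \<delta>\<^esub> cgen j = cgen j \<otimes>\<^bsub>FTL n \<delta>\<^esub> cgen i"
    if "i < j" "j < n" "(i, j) \<noteq> (0, 2)" "\<not> (1 \<le> i \<and> j = Suc i)" for i j
  proof -
    have "{vx i, vx j} \<notin> D_edges n" using D_edges_iff[OF n] that by blast
    moreover have "vx i \<in> D_vertices n" "vx j \<in> D_vertices n" "vx i \<noteq> vx j"
      using that vx_in by auto
    ultimately have "fgen (vx i) * fgen (vx j) - fgen (vx j) * fgen (vx i) \<in> FTL_relators n \<delta>"
      unfolding FTL_relators_def by blast
    then have "cls (fgen (vx i) * fgen (vx j)) = cls (fgen (vx j) * fgen (vx i))"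
      using that by (intro cls_eqI mult_closed) auto
    then show ?thesis using that by (simp add: cgen_def simps)
  qed
  show "cgen i \<otimes>\<^bsub>FTL n \<delta>\<^esub> cgen j = cgen j \<otimes>\<^bsub>FTL n \<delta>\<^esub> cgen i"
    if "i + 2 \<le> j" "j < n" "(i, j) \<noteq> (0, 2)" for i j
    using that by (intro comm) auto
  have adj: "cgen i \<otimes>\<^bsub>FTL n \<delta>\<^esub> cgen j \<otimes>\<^bsub>FTL n \<delta>\<^esub> cgen i = cgen i"
    if "i < n" "j < n" "{vx i, vx j} \<in> D_edges n" for i j
  proof -
    have "fgen (vx i) * fgen (vx j) * fgen (vx i) - fgen (vx i) \<in> FTL_relators n \<delta>"
      unfolding FTL_relators_def using that vx_in by blast
    then have "cls (fgen (vx i) * fgen (vx j) * fgen (vx i)) = cls (fgen (vx i))"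
      using that by (intro cls_eqI mult_closed) auto
    then show ?thesis using that by (simp add: cgen_def simps)
  qed
  have edge: "{vx i, vx j} \<in> D_edges n" "{vx j, vx i} \<in> D_edges n"
    if "i < j" "j < n" "(i, j) = (0, 2) \<or> 1 \<le> i \<and> j = Suc i" for i j
    using D_edges_iff[OF n that(1,2)] that(3) by (auto simp: insert_commute)
  show "cgen i \<otimes>\<^bsub>FTL n \<delta>\<^esub> cgen (Suc i) \<otimes>\<^bsub>FTL n \<delta>\<^esub> cgen i = cgen i"
    "cgen (Suc i) \<otimes>\<^bsub>FTL n \<delta>\<^esub> cgen i \<otimes>\<^bsub>FTL n \<delta>\<^esub> cgen (Suc i) = cgen (Suc i)"
    if "1 \<le> i" "Suc i < n" for i
    using that by (intro adj edge; simp)+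
  show "cgen 0 \<otimes>\<^bsub>FTL n \<delta>\<^esub> cgen 2 \<otimes>\<^bsub>FTL n \<delta>\<^esub> cgen 0 = cgen 0"
    "cgen 2 \<otimes>\<^bsub>FTL n \<delta>\<^esub> cgen 0 \<otimes>\<^bsub>FTL n \<delta>\<^esub> cgen 2 = cgen 2"
    using n by (intro adj edge; simp)+
  show 01: "cgen 0 \<otimes>\<^bsub>FTL n \<delta>\<^esub> cgen 1 = \<zero>\<^bsub>FTL n \<delta>\<^esub>"
  proof -
    have "fgen (vx 0) * fgen (vx 1) \<in> FTL_relators n \<delta>" by (simp add: FTL_relators_def vx_def)
    then have "cls (fgen (vx 0) * fgen (vx 1)) = cls 0" by (rule cls_relator)
    then show ?thesis using n by (simp add: cgen_def cls_mult cls_zero)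
  qed
  \<comment> \<open>The opposite product is not itself a relator; it vanishes because the vertices 0
    and 1 are not adjacent, so that their generators commute.\<close>
  have "cgen 0 \<otimes>\<^bsub>FTL n \<delta>\<^esub> cgen 1 = cgen 1 \<otimes>\<^bsub>FTL n \<delta>\<^esub> cgen 0"
    using n by (intro comm) auto
  then show "cgen 1 \<otimes>\<^bsub>FTL n \<delta>\<^esub> cgen 0 = \<zero>\<^bsub>FTL n \<delta>\<^esub>" using 01 by simp
qed

lemma FTL_generated: "generated_ftl_algebra (FTL n \<delta>) \<delta> n cgen csmul"
proof (intro generated_ftl_algebra.intro FTL_ftl_algebra generated_ftl_algebra_axioms.intro)
  interpret ftl_algebra "FTL n \<delta>" \<delta> n cgen csmul by (rule FTL_ftl_algebra)
  have word: "Poly_Mapping.single (FMon ws) 1 \<in> carrier FA \<and> cls (Poly_Mapping.single (FMon ws) 1) \<in> A n"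
    if "set ws \<subseteq> D_vertices n" for ws
    using that
  proof (induction ws)
    case Nil
    have "Poly_Mapping.single (FMon [] :: vertex fmon) (1 :: 'k) = 1"
      by (metis single_one zero_fmon_def)
    then show ?case by (simp add: cls_one Defs.one_closed alg.one)
  next
    case (Cons g ws)
    then obtain i where i: "g = vx i" "i < n" using D_vertices_eq n by auto
    have "Poly_Mapping.single (FMon (g # ws)) (1 :: 'k) = fgen g * Poly_Mapping.single (FMon ws) 1"
      by (simp add: fgen_def mult_single plus_fmon_def)
    moreover have "cls (fgen g) \<in> A n"
      using i e_in_A[of i n] n by (simp add: cgen_def)
    ultimately show ?case
      using Cons i alg.mult[of "cls (fgen g)" "G n" "cls (Poly_Mapping.single (FMon ws) 1)"]
      by (simp add: cls_mult mult_closed)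
  qed
  have "p \<in> carrier FA \<and> cls p \<in> A n" if "p \<in> carrier FA" for p
  proof (induction p rule: poly_mapping_keys_induct)
    case zero
    \<comment> \<open>\<open>alg\<close> has no rule for zero, which is therefore obtained as a
      scalar multiple of \<open>\<one>\<close>.\<close>
    have "cls 0 = csmul 0 (cls 1)" by (simp add: csmul_cls Defs.one_closed fscalar_def)
    then show ?case using alg.smul[OF alg.one, of 0] by (simp add: cls_one Defs.zero_closed)
  next
    case (single w c)
    then have "set (letters w) \<subseteq> D_vertices n" using that by (simp add: free_algebra_carrier)
    from word[OF this] have w: "Poly_Mapping.single w 1 \<in> carrier FA" "cls (Poly_Mapping.single w 1) \<in> A n"
      by simp_all
    have "Poly_Mapping.single w c = fscalar c * Poly_Mapping.single w 1"
      by (simp add: fscalar_def mult_single)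
    then show ?case using w alg.smul[OF w(2), of c] by (simp add: csmul_cls mult_closed)
  next
    case (add f g)
    then show ?case using alg.add[of "cls f" "G n" "cls g"] by (simp add: cls_add add_closed)
  qed
  then show "carrier (FTL n \<delta>) \<subseteq> A n" using carrier_FTL by auto
qed

text \<open>A representative is chosen here. For \<open>2 \<noteq> 0\<close> the choice does not
  matter, by \<open>cact_cls\<close>.\<close>

definition cact :: "(vertex fmon \<Rightarrow>\<^sub>0 'k) set \<Rightarrow> ((nat \<Rightarrow> bool list) \<Rightarrow> 'k) \<Rightarrow> (nat \<Rightarrow> bool list) \<Rightarrow> 'k" where
  "cact x = rho \<delta> (SOME p. p \<in> carrier FA \<and> x = cls p)"

text \<open>The elements that act as zero form a two-sided ideal, and it contains the
  relators.\<close>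

lemma rho_rel_ideal:
  assumes two: "(2 :: 'k) \<noteq> 0" and p: "p \<in> rel_ideal"
  shows "rho \<delta> p \<phi> = (\<lambda>_. 0)"
proof -
  let ?K = "{p \<in> carrier FA. \<forall>\<phi>. rho \<delta> p \<phi> = (\<lambda>_. 0)}"
  have zero_fun: "rho \<delta> p (\<lambda>_. 0) = (\<lambda>_. 0)" for p
    using rho_scale[of \<delta> p 0 "\<lambda>_. 0"] by simp
  have "ideal ?K FA"
  proof (rule idealI)
    show "ring FA" by (rule free_algebra_ring)
    then have "left_ideal ?K FA"
      unfolding ring.left_ideal_iff[OF free_algebra_ring]
      by (auto simp: zero_closed add_closed mult_closed rho_add rho_mult zero_fun)
    then show "subgroup ?K (add_monoid FA)"
      by (simp add: left_ideal_def additive_subgroup_def)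
  qed (auto simp: mult_closed rho_mult zero_fun)
  moreover have "FTL_relators n \<delta> \<subseteq> ?K"
    using relators_closed rho_relator[OF \<delta> two n] by auto
  ultimately have "rel_ideal \<subseteq> ?K"
    unfolding rel_ideal_def by (rule ring.genideal_minimal[OF free_algebra_ring])
  then show ?thesis using p by auto
qed

lemma cact_cls:
  assumes two: "(2 :: 'k) \<noteq> 0" and p: "p \<in> carrier FA"
  shows "cact (cls p) \<phi> = rho \<delta> p \<phi>"
proof -
  define p' where "p' = (SOME p'. p' \<in> carrier FA \<and> cls p = cls p')"
  have p': "p' \<in> carrier FA" "cls p = cls p'"
    using someI[of "\<lambda>p'. p' \<in> carrier FA \<and> cls p = cls p'" p] p unfolding p'_def by auto
  have sub: "abelian_subgroup rel_ideal FA"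
    using ideal.axioms(1)[OF rel_ideal] ideal.axioms(2)[OF rel_ideal]
    by (intro abelian_subgroupI3 additive_subgroup.a_subgroup ring.is_abelian_group) auto
  have "p \<in> cls p" unfolding cls_def using abelian_subgroup.a_rcos_self[OF sub p] .
  then have "p \<in> cls p'" using p'(2) by simp
  then have "p \<in> rel_ideal +>\<^bsub>FA\<^esub> p'" unfolding cls_def .
  then obtain h where h: "h \<in> rel_ideal" "p = h + p'" by (auto simp: a_r_coset_def')
  have "rho \<delta> p \<phi> = rho \<delta> p' \<phi>"
    unfolding h(2) using rho_rel_ideal[OF two h(1)] by (simp add: rho_add)
  then show ?thesis unfolding cact_def p'_def by simp
qed

lemma FTL_walk:
  assumes two: "(2 :: 'k) \<noteq> 0"
  shows "walk_ftl_algebra (FTL n \<delta>) \<delta> n cgen csmul cact"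
proof (intro walk_ftl_algebra.intro FTL_generated walk_ftl_algebra_axioms.intro)
  note simps = cls_add cls_mult csmul_cls mult_closed add_closed cact_cls[OF two] rho_add rho_mult
    rho_scale rho_fscalar
  let ?R = "FTL n \<delta>"
  show "(2 :: 'k) \<noteq> 0" by (rule two)
  show "cact (x \<oplus>\<^bsub>?R\<^esub> y) \<phi> = (\<lambda>s. cact x \<phi> s + cact y \<phi> s)"
    "cact (x \<otimes>\<^bsub>?R\<^esub> y) \<phi> = cact x (cact y \<phi>)"
    if "x \<in> carrier ?R" "y \<in> carrier ?R" for x y \<phi>
    using that by (elim carrierE, simp add: simps)+
  show "cact (csmul c x) \<phi> = (\<lambda>s. c * cact x \<phi> s)"
    "cact x (\<lambda>s. c * \<phi> s) = (\<lambda>s. c * cact x \<phi> s)" if "x \<in> carrier ?R" for c x \<phi>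
    using that by (elim carrierE, simp add: simps)+
  show "cact \<one>\<^bsub>?R\<^esub> \<phi> = \<phi>" for \<phi>
    using cact_cls[OF two one_closed] by (simp add: cls_one rho_one)
  show "cact (cgen i) \<phi> = gen_op \<delta> i \<phi>" if "i < n" for i \<phi>
    using that by (simp add: cgen_def simps rho_fgen)
qed

end

theorem proposition7p3:
  fixes \<delta> :: "'k::field" and n :: nat
  assumes "CHAR('k) \<noteq> 2"
    and "\<delta> \<noteq> 0"
    and "n \<ge> 3"
  shows "semisimple_ring (FTL n \<delta>) \<longleftrightarrow> (\<forall>t \<in> {2..n}. poly (Q t) \<delta> \<noteq> 0)"
proof -
  \<comment> \<open>If 2 were zero, the characteristic would divide 2; it is never 1, so it would be
    2.\<close>
  have two: "(2 :: 'k) \<noteq> 0"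
  proof
    assume "(2 :: 'k) = 0"
    then have "CHAR('k) dvd 2" using of_nat_eq_0_iff_char_dvd[of 2, where 'a = 'k] by simp
    then have "CHAR('k) = 1 \<or> CHAR('k) = 2" using prime_nat_iff[of 2] two_is_prime_nat by blast
    then show False using assms(1) CHAR_not_1'[where 'a = 'k] by simp
  qed
  interpret walk_ftl_algebra "FTL n \<delta>" \<delta> n "cgen n \<delta>" "csmul n \<delta>" "cact n \<delta>"
    using assms two by (intro FTL_walk)
  have q: "q t = poly (Q t) \<delta>" if "2 \<le> t" for t
    using that by (simp add: q_def)
  show ?thesis
  proof
    assume "\<forall>t \<in> {2..n}. poly (Q t) \<delta> \<noteq> 0"
    then show "semisimple_ring (FTL n \<delta>)"
      using q by (intro semisimple_if_nonzero) auto
  next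
    assume ss: "semisimple_ring (FTL n \<delta>)"
    show "\<forall>t \<in> {2..n}. poly (Q t) \<delta> \<noteq> 0"
    proof (rule ccontr)
      assume "\<not> ?thesis"
      then have ex: "\<exists>t. 2 \<le> t \<and> t \<le> n \<and> q t = 0" using q by auto
      \<comment> \<open>The least zero of \<open>q\<close>. It is at least 3 because
        \<open>q 2\<close> is \<open>\<delta> * \<delta>\<close>.\<close>
      define m where "m = (LEAST t. 2 \<le> t \<and> t \<le> n \<and> q t = 0)"
      have m: "2 \<le> m" "m \<le> n" "q m = 0" using LeastI_ex[OF ex] unfolding m_def by auto
      have less: "q t \<noteq> 0" if "2 \<le> t" "t < m" for t
        using not_less_Least[of t "\<lambda>t. 2 \<le> t \<and> t \<le> n \<and> q t = 0"] that m(2) unfolding m_def by auto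
      have "m \<noteq> 2" using m(3) q_2 assms(2) by auto
      then have "3 \<le> m" using m(1) by simp
      then show False using not_semisimple m less ss by blast
    qed
  qed
qed

end
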